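(* Let $T>0$, let $N>0$ be an integer, $\tau=T/N$ and $t_n=n\tau$ for $n=0,1,\dots,N$. Assume the initial value $\phi_0$ is smooth, periodic on $\mathbb{T}^2$ and satisfies $0\le\phi_0\le1$, and that the exact solution $\phi(x,t)$ on $\mathbb{T}^2\times[0,T]$ of $$\frac{\partial}{\partial t}\phi=\epsilon\Delta\phi-\frac1\epsilon W'(\phi)-\gamma\big[(-\Delta)^{-1}(f(\phi)-\omega)\big]f'(\phi)-M\Big(\int_{\mathbb{T}^2}(f(\phi)-\omega)\,dx\Big)f'(\phi),\qquad\phi(\cdot,0)=\phi_0,$$ is sufficiently smooth. Let $\{\Phi^n\}_{n=1}^N\subset\mathcal{M}_h$ be the approximate solution computed by the scheme $$\Big(\frac1\tau+\frac{\kappa_h}{\epsilon}\Big)(\Phi^{n+1}-\Phi^n)=\epsilon\Delta_h\Phi^{n+1}-\frac1\epsilon W'(\Phi^n)-\gamma\big[(-\Delta_h)^{-1}(f(\Phi^n)-\omega)\big]\odot f'(\Phi^n)-M\langle f(\Phi^n)-\omega,1\rangle_h\,f'(\Phi^n)$$ with $\Phi^0=\phi_0|_{\mathbb{T}^2_h}$, where the stabilization constant $\kappa_h$ satisfies $$\frac{\kappa_h}{\epsilon}\ \ge\ \frac{L_{W''}}{\epsilon}+(L_{f'}^2+\tilde\omega L_{f''})\Big(\gamma\|(-\Delta_h)^{-1}\|+M|\mathbb{T}^2|\Big).$$ If the step size $\tau$ is sufficiently small, then $$\|\phi(t_n)-\Phi^n\|_{h,L^2}\le C(\tau+h_1^2+h_2^2),\qquad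 n\in\{1,\dots,N\},$$ where $\phi(t_n)$ is restricted to the grid $\mathbb{T}^2_h$ and $C>0$ is a constant which depends on $\phi,T,\kappa_h,\epsilon,\gamma,M,|\mathbb{T}^2|$ but is independent of $\tau,h_1,h_2$.
   Context: $\mathbb{T}^2=\prod_{i=1}^2[-X_i,X_i]$ is a periodic box; $N_1,N_2$ are positive even integers, $h_i=2X_i/N_i$, $\mathbb{T}^2_h=\mathbb{T}^2\cap(h_1\mathbb{Z}\times h_2\mathbb{Z})$, $S_h=\{(k_1,k_2)\in\mathbb{Z}^2:1\le k_i\le N_i\}$, and $\mathcal{M}_h$ is the space of real periodic grid functions ($u_{k_1+m_1N_1,k_2+m_2N_2}=u_{k_1,k_2}$ for all $m_1,m_2\in\mathbb{Z}$). $\langle u,v\rangle_h=h_1h_2\sum_{(i,j)\in S_h}u_{ij}v_{ij}$, $\|u\|_{h,L^2}=\sqrt{\langle u,u\rangle_h}$, $\|u\|_{h,L^\infty}=\max_{S_h}|u_{ij}|$. $(\Delta_hu)_{ij}=h_1^{-2}(u_{i-1,j}-2u_{ij}+u_{i+1,j})+h_2^{-2}(u_{i,j-1}-2u_{ij}+u_{i,j+1})$ with periodic indices. $\Delta_h$ is invertible on mean-zero grid functions; for $g\in\mathcal{M}_h$, $(-\Delta_h)^{-1}g$ denotes the mean-zero $u$ with $-\Delta_hu=g-\frac{1}{|\mathbb{T}^2|}\langle g,1\rangle_h$. $\|(-\Delta_h)^{-1}\|$ is the optimal $C$ in $\|(-\Delta_h)^{-1}g\|_{h,L^\infty}\le C\|g\|_{h,L^\infty}$,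 $g\in\mathcal{M}_h$. Similarly $(-\Delta)^{-1}g$ is the periodic mean-zero $u$ with $-\Delta u=g-\frac1{|\mathbb{T}^2|}\int_{\mathbb{T}^2}g\,dx$. $\odot$ is pointwise multiplication; $W',f,f'$ act pointwise. The parameters are $\epsilon>0$, $\gamma>0$, $M>0$, $\kappa_h>0$, $\omega\in(0,1)$, $\tilde\omega=\max\{\omega,1-\omega\}$. $W(s)=18(s^2-s)^2$, $f(s)=3s^2-2s^3$, $L_{W''}=\|W''\|_{L^\infty[0,1]}$, $L_{f'}=\|f'\|_{L^\infty[0,1]}$, $L_{f''}=\|f''\|_{L^\infty[0,1]}$. "Sufficiently smooth" means $\phi_{tt}\in L^\infty(0,T;L^\infty(\mathbb{T}^2))$ and $\phi\in L^\infty(0,T;C^4(\mathbb{T}^2))$. "$\tau$ sufficiently small" means $\tau\le\tau_0$ for some threshold $\tau_0>0$ independent of $h_1,h_2$. *)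

theory Defs
  imports "HOL-Analysis.Analysis"
begin

(* Conventions.  X = (X_1, X_2) holds the half-widths of the box and N = (N_1, N_2) the numbers
   of mesh intervals.  Functions on the torus are functions on the whole plane that are periodic
   with periods 2 X_1 and 2 X_2; grid functions are functions on all of Z x Z that are periodic
   with periods N_1 and N_2. *)

section \<open>The double-well potential and the nonlinearity\<close>

definition W :: "real \<Rightarrow> real" where
  "W s = 18 * (s\<^sup>2 - s)\<^sup>2"

definition f :: "real \<Rightarrow> real" where
  "f s = 3 * s\<^sup>2 - 2 * s ^ 3"

(* Only applied to continuous functions, for which the essential supremum over [0,1] is the
   supremum. *)
definition Linf01 :: "(real \<Rightarrow> real) \<Rightarrow> real" where
  "Linf01 g = (SUP s\<in>{0..1}. \<bar>g s\<bar>)"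


section \<open>Functions on the torus\<close>

definition torus :: "real \<times> real \<Rightarrow> (real \<times> real) set" where
  "torus X = cbox (- X) X"

definition area :: "real \<times> real \<Rightarrow> real" where
  "area X = measure lborel (torus X)"

definition periodic :: "real \<times> real \<Rightarrow> (real \<times> real \<Rightarrow> real) \<Rightarrow> bool" where
  "periodic X u \<longleftrightarrow>
     (\<forall>x y. u (x + 2 * fst X, y) = u (x, y) \<and> u (x, y + 2 * snd X) = u (x, y))"

definition pd1 :: "(real \<times> real \<Rightarrow> real) \<Rightarrow> real \<times> real \<Rightarrow> real" where
  "pd1 u = (\<lambda>(x, y). deriv (\<lambda>s. u (s, y)) x)"

definition pd2 :: "(real \<times> real \<Rightarrow> real) \<Rightarrow> real \<times> real \<Rightarrow> real" where
  "pd2 u = (\<lambda>(x, y). deriv (\<lambda>s. u (x, s)) y)"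

primrec Ck :: "nat \<Rightarrow> (real \<times> real \<Rightarrow> real) \<Rightarrow> bool" where
  "Ck 0 u \<longleftrightarrow> continuous_on UNIV u"
| "Ck (Suc k) u \<longleftrightarrow>
     (\<forall>x y. (\<lambda>s. u (s, y)) differentiable (at x) \<and> (\<lambda>s. u (x, s)) differentiable (at y))
     \<and> Ck k (pd1 u) \<and> Ck k (pd2 u)"

definition laplacian :: "(real \<times> real \<Rightarrow> real) \<Rightarrow> real \<times> real \<Rightarrow> real" where
  "laplacian u x = pd1 (pd1 u) x + pd2 (pd2 u) x"

(* The classical solution; it exists and is unique for every periodic C^2 function g. *)
definition inv_neg_laplacian ::
    "real \<times> real \<Rightarrow> (real \<times> real \<Rightarrow> real) \<Rightarrow> real \<times> real \<Rightarrow> real" where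
  "inv_neg_laplacian X g =
     (THE u. periodic X u \<and> Ck 2 u \<and> integral (torus X) u = 0
        \<and> (\<forall>x. - laplacian u x = g x - 1 / area X * integral (torus X) g))"


section \<open>The exact solution\<close>

definition pde_rhs ::
    "real \<times> real \<Rightarrow> real \<Rightarrow> real \<Rightarrow> real \<Rightarrow> real \<Rightarrow> (real \<times> real \<Rightarrow> real) \<Rightarrow> real \<times> real \<Rightarrow> real" where
  "pde_rhs X \<epsilon> \<gamma> M \<omega> u x =
     \<epsilon> * laplacian u x - 1 / \<epsilon> * deriv W (u x)
     - \<gamma> * inv_neg_laplacian X (\<lambda>y. f (u y) - \<omega>) x * deriv f (u x)
     - M * integral (torus X) (\<lambda>y. f (u y) - \<omega>) * deriv f (u x)"

(* The time derivative is one-sided at t = 0 and t = T. *)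
definition exact_solution ::
    "real \<times> real \<Rightarrow> real \<Rightarrow> real \<Rightarrow> real \<Rightarrow> real \<Rightarrow> real \<Rightarrow> (real \<times> real \<Rightarrow> real)
       \<Rightarrow> (real \<Rightarrow> real \<times> real \<Rightarrow> real) \<Rightarrow> bool" where
  "exact_solution X T \<epsilon> \<gamma> M \<omega> \<phi>0 \<phi> \<longleftrightarrow>
     (\<forall>t\<in>{0..T}. periodic X (\<phi> t) \<and> Ck 2 (\<phi> t)) \<and>
     (\<forall>x. \<phi> 0 x = \<phi>0 x) \<and>
     (\<forall>t\<in>{0..T}. \<forall>x.
        ((\<lambda>s. \<phi> s x) has_real_derivative pde_rhs X \<epsilon> \<gamma> M \<omega> (\<phi> t) x) (at t within {0..T}))"

definition time_deriv ::
    "real \<Rightarrow> (real \<Rightarrow> real \<times> real \<Rightarrow> real) \<Rightarrow> real \<Rightarrow> real \<times> real \<Rightarrow> real" where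
  "time_deriv T \<phi> t x = vector_derivative (\<lambda>s. \<phi> s x) (at t within {0..T})"

(* phi in L^infinity(0,T; C^4). *)
definition Linf_C4 :: "real \<Rightarrow> (real \<Rightarrow> real \<times> real \<Rightarrow> real) \<Rightarrow> bool" where
  "Linf_C4 T \<phi> \<longleftrightarrow>
     (\<exists>B. AE t in lborel. t \<in> {0<..<T} \<longrightarrow>
        Ck 4 (\<phi> t) \<and> (\<forall>j k x. j + k \<le> 4 \<longrightarrow> \<bar>(pd1 ^^ j) ((pd2 ^^ k) (\<phi> t)) x\<bar> \<le> B))"

(* phi_tt in L^infinity(0,T; L^infinity): phi_t has an essentially bounded weak time derivative
   psi, i.e. phi_t is the time integral of psi, as an identity of L^infinity functions of x. *)
definition tt_Linf :: "real \<times> real \<Rightarrow> real \<Rightarrow> (real \<Rightarrow> real \<times> real \<Rightarrow> real) \<Rightarrow> bool" where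
  "tt_Linf X T \<phi> \<longleftrightarrow>
     (\<exists>\<psi> :: real \<times> (real \<times> real) \<Rightarrow> real. \<exists>B.
        \<psi> \<in> borel_measurable borel \<and>
        (AE p in lborel. p \<in> {0..T} \<times> torus X \<longrightarrow> \<bar>\<psi> p\<bar> \<le> B) \<and>
        (\<forall>t\<in>{0..T}. AE x in lborel. x \<in> torus X \<longrightarrow>
           time_deriv T \<phi> t x = time_deriv T \<phi> 0 x + integral {0..t} (\<lambda>s. \<psi> (s, x))))"

definition sufficiently_smooth ::
    "real \<times> real \<Rightarrow> real \<Rightarrow> (real \<Rightarrow> real \<times> real \<Rightarrow> real) \<Rightarrow> bool" where
  "sufficiently_smooth X T \<phi> \<longleftrightarrow> tt_Linf X T \<phi> \<and> Linf_C4 T \<phi>"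


section \<open>Grid functions\<close>

type_synonym gridfun = "int \<times> int \<Rightarrow> real"

definition h1 :: "real \<times> real \<Rightarrow> nat \<times> nat \<Rightarrow> real" where
  "h1 X N = 2 * fst X / real (fst N)"

definition h2 :: "real \<times> real \<Rightarrow> nat \<times> nat \<Rightarrow> real" where
  "h2 X N = 2 * snd X / real (snd N)"

definition grid_index :: "nat \<times> nat \<Rightarrow> (int \<times> int) set" where
  "grid_index N = {1..int (fst N)} \<times> {1..int (snd N)}"

definition gridfuns :: "nat \<times> nat \<Rightarrow> gridfun set" where
  "gridfuns N =
     {u. \<forall>k1 k2 m1 m2. u (k1 + m1 * int (fst N), k2 + m2 * int (snd N)) = u (k1, k2)}"

(* The index k stands for the point (k_1 h_1, k_2 h_2).  For even N_1, N_2 the points with index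
   in grid_index N are, modulo periodicity, those of T^2 intersected with h_1 Z x h_2 Z. *)
definition on_grid ::
    "real \<times> real \<Rightarrow> nat \<times> nat \<Rightarrow> (real \<times> real \<Rightarrow> real) \<Rightarrow> gridfun" where
  "on_grid X N u = (\<lambda>(k1, k2). u (of_int k1 * h1 X N, of_int k2 * h2 X N))"

definition inner_h :: "real \<times> real \<Rightarrow> nat \<times> nat \<Rightarrow> gridfun \<Rightarrow> gridfun \<Rightarrow> real" where
  "inner_h X N u v = h1 X N * h2 X N * (\<Sum>k\<in>grid_index N. u k * v k)"

definition norm_L2_h :: "real \<times> real \<Rightarrow> nat \<times> nat \<Rightarrow> gridfun \<Rightarrow> real" where
  "norm_L2_h X N u = sqrt (inner_h X N u u)"

definition norm_Linf_h :: "nat \<times> nat \<Rightarrow> gridfun \<Rightarrow> real" where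
  "norm_Linf_h N u = Max ((\<lambda>k. \<bar>u k\<bar>) ` grid_index N)"

definition laplacian_h :: "real \<times> real \<Rightarrow> nat \<times> nat \<Rightarrow> gridfun \<Rightarrow> gridfun" where
  "laplacian_h X N u = (\<lambda>(i, j).
     (u (i - 1, j) - 2 * u (i, j) + u (i + 1, j)) / (h1 X N)\<^sup>2
     + (u (i, j - 1) - 2 * u (i, j) + u (i, j + 1)) / (h2 X N)\<^sup>2)"

definition inv_neg_laplacian_h :: "real \<times> real \<Rightarrow> nat \<times> nat \<Rightarrow> gridfun \<Rightarrow> gridfun" where
  "inv_neg_laplacian_h X N g =
     (THE u. u \<in> gridfuns N \<and> inner_h X N u (\<lambda>_. 1) = 0
        \<and> (\<forall>k. - laplacian_h X N u k = g k - 1 / area X * inner_h X N g (\<lambda>_. 1)))"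

definition norm_inv_neg_laplacian_h :: "real \<times> real \<Rightarrow> nat \<times> nat \<Rightarrow> real" where
  "norm_inv_neg_laplacian_h X N =
     Inf {C. \<forall>g\<in>gridfuns N. norm_Linf_h N (inv_neg_laplacian_h X N g) \<le> C * norm_Linf_h N g}"


section \<open>The scheme\<close>

definition scheme_step ::
    "real \<times> real \<Rightarrow> nat \<times> nat \<Rightarrow> real \<Rightarrow> real \<Rightarrow> real \<Rightarrow> real \<Rightarrow> real \<Rightarrow> real
       \<Rightarrow> gridfun \<Rightarrow> gridfun \<Rightarrow> bool" where
  "scheme_step X N \<tau> \<kappa> \<epsilon> \<gamma> M \<omega> u v \<longleftrightarrow>
     (\<forall>k. (1 / \<tau> + \<kappa> / \<epsilon>) * (v k - u k) =
        \<epsilon> * laplacian_h X N v k - 1 / \<epsilon> * deriv W (u k)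
        - \<gamma> * inv_neg_laplacian_h X N (\<lambda>l. f (u l) - \<omega>) k * deriv f (u k)
        - M * inner_h X N (\<lambda>l. f (u l) - \<omega>) (\<lambda>_. 1) * deriv f (u k))"

definition stabilizing ::
    "real \<times> real \<Rightarrow> nat \<times> nat \<Rightarrow> real \<Rightarrow> real \<Rightarrow> real \<Rightarrow> real \<Rightarrow> real \<Rightarrow> bool" where
  "stabilizing X N \<kappa> \<epsilon> \<gamma> M \<omega> \<longleftrightarrow>
     \<kappa> / \<epsilon> \<ge> Linf01 (deriv (deriv W)) / \<epsilon>
       + ((Linf01 (deriv f))\<^sup>2 + max \<omega> (1 - \<omega>) * Linf01 (deriv (deriv f)))
         * (\<gamma> * norm_inv_neg_laplacian_h X N + M * area X)"

end

theory Submission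
  imports Defs
begin

text \<open>
The error estimate combines stability of the scheme with consistency, both with constants that do not depend
on the mesh.

Stability. By the stabilization, the explicit part of the scheme is a monotone function of the old value that,
divided by the factor on the left, maps the unit interval into itself, so the discrete maximum principle keeps the numerical solution between 0 and 1
(\<open>scheme_bounds\<close>). There the nonlinearity is Lipschitz in the mean square norm (\<open>nonlin_L2\<close>), because the
discrete inverse Laplacian is bounded both in the mean square norm, by the discrete Poincare inequality, and in
the supremum norm. The latter bound (\<open>osc_stability\<close>) comes from a discrete Sobolev inequality of product
type, in which the mixed second differences are controlled by the discrete Laplacian. The error equation, tested
with the new error, and the discrete Gronwall argument then bound the error by the residual of the exact solution
(\<open>discrete_convergence\<close>).

Consistency in space. For the Laplacian this is Taylor's formula. For the nonlocal terms one needs solutions of the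
Poisson problem on the torus with enough regularity. They are obtained from the discrete problem itself. Solving the
discrete Poisson problem on all translates of the grid at once gives a finite linear combination of translates of
the data (\<open>Q\<close>). It is as smooth as the data, with bounds independent of the mesh, and solves the Poisson problem up
to a small error; when the grid is refined, these functions converge together with their derivatives up to order
two (\<open>poisson_limit\<close>). Their fourth derivatives stay bounded, which gives second order consistency of the
discrete Laplacian on the limit. Since the Laplacian and the discrete Laplacian have mean zero, the same solutions
bound the quadrature error (\<open>quadrature\<close>), and then the error of the discrete inverse Laplacian
(\<open>inv_laplacian_consistency\<close>).

Consistency in time. The C4 bounds hold at almost every time only, and at such times the right-hand side of the equation
is Lipschitz in time (\<open>rhs_time_lipschitz\<close>). On a fixed grid the semidiscrete right-hand side is continuous
in time, so estimates between the two pass to all times (\<open>time_residual\<close>).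
\<close>

section \<open>Periodic grid functions\<close>

lemma sum_shift_int:
  fixes F :: "int \<Rightarrow> real"
  assumes "\<And>i. F (i + int n) = F i"
  shows "(\<Sum>i=1..int n. F (i + a)) = (\<Sum>i=1..int n. F i)"
proof -
  have step: "(\<Sum>i=1..int n. F (i + (b + 1))) = (\<Sum>i=1..int n. F (i + b))" for b
  proof (cases "n = 0")
    case False
    have "(\<Sum>i=1..int n. F (i + (b + 1))) = (\<Sum>i=2..int n + 1. F (i + b))"
      by (rule sum.reindex_bij_witness[of _ "\<lambda>i. i - 1" "\<lambda>i. i + 1"]) (auto simp: algebra_simps)
    also have "\<dots> = (\<Sum>i=2..int n. F (i + b)) + F (int n + 1 + b)"
    proof -
      have "{2..int n + 1} = insert (int n + 1) {2..int n}" using False by auto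
      then show ?thesis by simp
    qed
    also have "F (int n + 1 + b) = F (1 + b)"
      using assms[of "1 + b"] by (simp add: algebra_simps)
    also have "(\<Sum>i=2..int n. F (i + b)) + F (1 + b) = (\<Sum>i=1..int n. F (i + b))"
    proof -
      have "{1..int n} = insert 1 {2..int n}" using False by auto
      then show ?thesis by simp
    qed
    finally show ?thesis .
  qed simp
  show ?thesis
  proof (induction a rule: int_induct[of _ 0])
    case base then show ?case by simp
  next
    case (step1 i) then show ?case using step[of i] by simp
  next
    case (step2 i) then show ?case using step[of "i - 1"] by simp
  qed
qed

lemma osc_le_sum_int:
  fixes F :: "int \<Rightarrow> real"
  assumes "i \<in> {1..n}" "j \<in> {1..n}"
  shows "\<bar>F i - F j\<bar> \<le> (\<Sum>p=1..n. \<bar>F (p + 1) - F p\<bar>)"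
proof -
  have *: "\<bar>F b - F a\<bar> \<le> (\<Sum>p=1..n. \<bar>F (p + 1) - F p\<bar>)" if "1 \<le> a" "a \<le> b" "b \<le> n" for a b
  proof -
    have "F b - F a = (\<Sum>p\<in>{a..<b}. F (p + 1) - F p)"
      using that(2)
    proof (induction b rule: int_ge_induct)
      case (step i)
      have "{a..<i + 1} = insert i {a..<i}" using step by auto
      then show ?case using step by simp
    qed simp
    also have "\<bar>\<dots>\<bar> \<le> (\<Sum>p\<in>{a..<b}. \<bar>F (p + 1) - F p\<bar>)" by (rule sum_abs)
    also have "\<dots> \<le> (\<Sum>p=1..n. \<bar>F (p + 1) - F p\<bar>)"
      by (rule sum_mono2) (use that in auto)
    finally show ?thesis .
  qed
  show ?thesis
  proof (cases "i \<le> j")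
    case True then show ?thesis using *[of i j] assms by (auto simp: abs_minus_commute)
  next
    case False then show ?thesis using *[of j i] assms by auto
  qed
qed

lemma abs_le_mean_plus_osc:
  fixes F :: "int \<Rightarrow> real"
  assumes "j \<in> {1..int n}"
  shows "\<bar>F j\<bar> \<le> (\<Sum>q=1..int n. \<bar>F q\<bar>) / real n + (\<Sum>p=1..int n. \<bar>F (p + 1) - F p\<bar>)"
proof -
  have n: "n > 0" using assms by auto
  have "real n * \<bar>F j\<bar> = (\<Sum>q=1..int n. \<bar>F j\<bar>)" by simp
  also have "\<dots> \<le> (\<Sum>q=1..int n. \<bar>F q\<bar> + (\<Sum>p=1..int n. \<bar>F (p + 1) - F p\<bar>))"
  proof (rule sum_mono)
    fix q assume "q \<in> {1..int n}"
    then show "\<bar>F j\<bar> \<le> \<bar>F q\<bar> + (\<Sum>p=1..int n. \<bar>F (p + 1) - F p\<bar>)"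
      using osc_le_sum_int[OF assms, of q F] by linarith
  qed
  also have "\<dots> = (\<Sum>q=1..int n. \<bar>F q\<bar>) + real n * (\<Sum>p=1..int n. \<bar>F (p + 1) - F p\<bar>)"
    by (simp add: sum.distrib)
  finally show ?thesis using n by (simp add: field_simps)
qed

lemma square_sum_le:
  fixes F :: "'a \<Rightarrow> real"
  assumes "finite A"
  shows "(\<Sum>x\<in>A. \<bar>F x\<bar>)\<^sup>2 \<le> real (card A) * (\<Sum>x\<in>A. (F x)\<^sup>2)"
  using Cauchy_Schwarz_ineq_sum[of "\<lambda>x. 1" "\<lambda>x. \<bar>F x\<bar>" A] by simp

text \<open>Forward difference and second difference of a grid function in the direction of the index
vector e, not divided by the mesh size.\<close>

definition fdiff :: "int \<times> int \<Rightarrow> gridfun \<Rightarrow> gridfun" where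
  "fdiff e u = (\<lambda>k. u (k + e) - u k)"

definition sdiff :: "int \<times> int \<Rightarrow> gridfun \<Rightarrow> gridfun" where
  "sdiff e u = (\<lambda>k. u (k - e) - 2 * u k + u (k + e))"

abbreviation e1 :: "int \<times> int" where "e1 \<equiv> (1, 0)"
abbreviation e2 :: "int \<times> int" where "e2 \<equiv> (0, 1)"

lemma laplacian_h_sdiff:
  "laplacian_h X N u k = sdiff e1 u k / (h1 X N)\<^sup>2 + sdiff e2 u k / (h2 X N)\<^sup>2"
  by (cases k) (simp add: laplacian_h_def sdiff_def)

lemma gridfuns_shift: "u \<in> gridfuns N \<Longrightarrow> (\<lambda>k. u (k + l)) \<in> gridfuns N"
proof -
  assume u: "u \<in> gridfuns N"
  obtain a b where l: "l = (a, b)" by (cases l)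
  have "u (k1 + a + m1 * int (fst N), k2 + b + m2 * int (snd N)) = u (k1 + a, k2 + b)" for k1 k2 m1 m2
    using u unfolding gridfuns_def by blast
  then show ?thesis by (simp add: gridfuns_def l algebra_simps)
qed

lemma gridfuns_comp2: "u \<in> gridfuns N \<Longrightarrow> v \<in> gridfuns N \<Longrightarrow> (\<lambda>k. F (u k) (v k)) \<in> gridfuns N"
  by (simp add: gridfuns_def)

lemma gridfuns_comp: "u \<in> gridfuns N \<Longrightarrow> (\<lambda>k. F (u k)) \<in> gridfuns N"
  by (simp add: gridfuns_def)

lemma gridfuns_const [simp]: "(\<lambda>k. c) \<in> gridfuns N"
  by (simp add: gridfuns_def)

lemma gridfuns_fdiff: "u \<in> gridfuns N \<Longrightarrow> fdiff e u \<in> gridfuns N"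
  unfolding fdiff_def by (rule gridfuns_comp2[OF gridfuns_shift])

lemma gridfuns_sdiff: "u \<in> gridfuns N \<Longrightarrow> sdiff e u \<in> gridfuns N"
  unfolding sdiff_def
  using gridfuns_comp2[OF gridfuns_comp2[OF gridfuns_shift[of u N "-e"], of u "\<lambda>a b. a - 2 * b"]
      gridfuns_shift[of u N e], of "(+)"] by simp

lemma gridfuns_laplacian_h: "u \<in> gridfuns N \<Longrightarrow> laplacian_h X N u \<in> gridfuns N"
  using gridfuns_comp2[OF gridfuns_sdiff[of u N e1] gridfuns_sdiff[of u N e2],
      of "\<lambda>a b. a / (h1 X N)\<^sup>2 + b / (h2 X N)\<^sup>2"]
  by (simp add: laplacian_h_sdiff[abs_def])

lemma finite_grid_index [simp]: "finite (grid_index N)"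
  by (simp add: grid_index_def)

lemma sum_grid: "(\<Sum>k\<in>grid_index N. u k) = (\<Sum>i=1..int (fst N). \<Sum>j=1..int (snd N). u (i, j))"
  by (simp add: grid_index_def sum.cartesian_product)

lemma sum_grid_shift:
  assumes "u \<in> gridfuns N"
  shows "(\<Sum>k\<in>grid_index N. u (k + l)) = (\<Sum>k\<in>grid_index N. u k)"
proof -
  obtain a b where l: "l = (a, b)" by (cases l)
  have per: "u (i + int (fst N), j) = u (i, j)" "u (i, j + int (snd N)) = u (i, j)" for i j
  proof -
    have "u (i + 1 * int (fst N), j + 0 * int (snd N)) = u (i, j)"
      "u (i + 0 * int (fst N), j + 1 * int (snd N)) = u (i, j)"
      using assms unfolding gridfuns_def by blast+
    then show "u (i + int (fst N), j) = u (i, j)" "u (i, j + int (snd N)) = u (i, j)" by simp_all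
  qed
  have "(\<Sum>k\<in>grid_index N. u (k + l)) = (\<Sum>i=1..int (fst N). \<Sum>j=1..int (snd N). u (i + a, j + b))"
    by (simp add: sum_grid l)
  also have "\<dots> = (\<Sum>i=1..int (fst N). \<Sum>j=1..int (snd N). u (i + a, j))"
    by (intro sum.cong refl sum_shift_int) (simp add: per)
  also have "\<dots> = (\<Sum>i=1..int (fst N). \<Sum>j=1..int (snd N). u (i, j))"
    by (rule sum_shift_int[of "\<lambda>i. \<Sum>j=1..int (snd N). u (i, j)"]) (simp add: per)
  finally show ?thesis by (simp add: sum_grid)
qed

lemma sum_by_parts:
  assumes "u \<in> gridfuns N" "v \<in> gridfuns N"
  shows "(\<Sum>k\<in>grid_index N. sdiff e u k * v k) = - (\<Sum>k\<in>grid_index N. fdiff e u k * fdiff e v k)"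
proof -
  let ?F = "\<lambda>k. u k * v (k + e) - u (k + e) * v (k + e)"
  have F: "?F \<in> gridfuns N"
    using gridfuns_comp2[OF gridfuns_comp2[OF assms(1) gridfuns_shift[OF assms(2), of e], of "\<lambda>x y. x * y"]
      gridfuns_comp2[OF gridfuns_shift[OF assms(1), of e] gridfuns_shift[OF assms(2), of e], of "\<lambda>x y. x * y"], of "(-)"] .
  have "(\<Sum>k\<in>grid_index N. sdiff e u k * v k) + (\<Sum>k\<in>grid_index N. fdiff e u k * fdiff e v k)
     = (\<Sum>k\<in>grid_index N. ?F (k + - e)) - (\<Sum>k\<in>grid_index N. ?F k)"
    unfolding sum.distrib[symmetric] sum_subtractf[symmetric]
    by (rule sum.cong) (simp_all add: sdiff_def fdiff_def algebra_simps)
  then show ?thesis using sum_grid_shift[OF F, of "-e"] by simp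
qed

lemma fdiff_sdiff: "fdiff a (sdiff b u) = sdiff b (fdiff a u)"
  by (rule ext) (simp add: fdiff_def sdiff_def algebra_simps)

section \<open>The discrete Laplacian: energy estimates\<close>

text \<open>Two constants depending on the box only: the constant of the discrete Poincare inequality, and the
constant that bounds the oscillation of a grid function by the supremum of its discrete Laplacian.
That they do not depend on the mesh is what makes all later estimates uniform.\<close>

definition poincare_const :: "real \<times> real \<Rightarrow> real" where
  "poincare_const X = 4 * ((fst X)\<^sup>2 + (snd X)\<^sup>2)"

definition sup_const :: "real \<times> real \<Rightarrow> real" where
  "sup_const X = 2 * (fst X + snd X) * sqrt (poincare_const X) + 8 * fst X * snd X"

text \<open>A box together with numbers of mesh intervals. Inside this locale \<open>gs\<close> is the plain sum over one
period, \<open>nn\<close> the number of grid points, \<open>Lh\<close> the discrete Laplacian.\<close>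

locale torus_grid =
  fixes X :: "real \<times> real" and N :: "nat \<times> nat"
  assumes X1: "fst X > 0" and X2: "snd X > 0" and N1: "fst N > 0" and N2: "snd N > 0"
begin

lemma box_grid_simps [simp]:
  "0 < fst N" "0 < snd N" "fst N \<noteq> 0" "snd N \<noteq> 0" "0 < fst X" "0 < snd X" "fst X \<noteq> 0" "snd X \<noteq> 0" "0 \<le> fst X" "0 \<le> snd X"
  using N1 N2 X1 X2 by auto

abbreviation Lh where "Lh \<equiv> laplacian_h X N"
abbreviation gs :: "gridfun \<Rightarrow> real" where "gs u \<equiv> (\<Sum>k\<in>grid_index N. u k)"
abbreviation nn :: real where "nn \<equiv> real (fst N) * real (snd N)"

lemma h1_pos: "h1 X N > 0" and h2_pos: "h2 X N > 0"
  using X1 X2 N1 N2 by (auto simp: h1_def h2_def)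

lemma nn_pos: "nn > 0" using N1 N2 by simp

lemma h1N: "h1 X N * real (fst N) = 2 * fst X" and h2N: "h2 X N * real (snd N) = 2 * snd X"
  using N1 N2 by (auto simp: h1_def h2_def)

lemma card_grid: "real (card (grid_index N)) = nn"
  by (simp add: grid_index_def)

text \<open>The index in \<open>grid_index N\<close> that represents a given index modulo the periods.\<close>

definition rep :: "int \<times> int \<Rightarrow> int \<times> int" where
  "rep k = ((fst k - 1) mod int (fst N) + 1, (snd k - 1) mod int (snd N) + 1)"

lemma rep_in_grid: "rep k \<in> grid_index N"
proof -
  have "(fst k - 1) mod int (fst N) < int (fst N)" "(snd k - 1) mod int (snd N) < int (snd N)"
    "0 \<le> (fst k - 1) mod int (fst N)" "0 \<le> (snd k - 1) mod int (snd N)" by simp_all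
  then show ?thesis
    unfolding rep_def grid_index_def mem_Times_iff fst_conv snd_conv atLeastAtMost_iff by linarith
qed

lemma gridfun_rep: "u \<in> gridfuns N \<Longrightarrow> u (rep k) = u k"
proof -
  assume u: "u \<in> gridfuns N"
  have "u k = u ((fst k - 1) mod int (fst N) + 1 + ((fst k - 1) div int (fst N)) * int (fst N),
      (snd k - 1) mod int (snd N) + 1 + ((snd k - 1) div int (snd N)) * int (snd N))"
    by (simp add: algebra_simps minus_mult_div_eq_mod)
  also have "\<dots> = u (rep k)" using u unfolding gridfuns_def rep_def by blast
  finally show ?thesis by simp
qed

lemma gridfuns_rep_fun: "(\<lambda>k. F (rep k)) \<in> gridfuns N"
proof -
  have "rep (k1 + m1 * int (fst N), k2 + m2 * int (snd N)) = rep (k1, k2)" for k1 k2 m1 m2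
  proof -
    have *: "(a + m * b - 1) mod b = (a - 1) mod b" for a m b :: int
      using mod_mult_self1[of "a - 1" m b] by (simp add: algebra_simps)
    show ?thesis by (simp add: rep_def *)
  qed
  then show ?thesis by (simp add: gridfuns_def)
qed

lemma grid_rep:
  obtains m where "m \<in> grid_index N" "\<And>u. u \<in> gridfuns N \<Longrightarrow> u m = u k"
  by (rule that[OF rep_in_grid gridfun_rep])

lemma gs_laplacian_mult:
  assumes "u \<in> gridfuns N" "v \<in> gridfuns N"
  shows "gs (\<lambda>k. Lh u k * v k) =
    - (gs (\<lambda>k. fdiff e1 u k * fdiff e1 v k) / (h1 X N)\<^sup>2 + gs (\<lambda>k. fdiff e2 u k * fdiff e2 v k) / (h2 X N)\<^sup>2)"
proof -
  have "gs (\<lambda>k. Lh u k * v k) = gs (\<lambda>k. sdiff e1 u k * v k) / (h1 X N)\<^sup>2 + gs (\<lambda>k. sdiff e2 u k * v k) / (h2 X N)\<^sup>2"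
    by (simp add: laplacian_h_sdiff algebra_simps sum.distrib sum_divide_distrib)
  then show ?thesis by (simp add: sum_by_parts[OF assms])
qed

lemma gs_laplacian: "u \<in> gridfuns N \<Longrightarrow> gs (Lh u) = 0"
  using gs_laplacian_mult[of u "\<lambda>k. 1"] by (simp add: fdiff_def)

text \<open>The discrete Dirichlet integral, up to the factor \<open>h1 * h2\<close>.\<close>

definition energy :: "gridfun \<Rightarrow> real" where
  "energy u = gs (\<lambda>k. (fdiff e1 u k)\<^sup>2) / (h1 X N)\<^sup>2 + gs (\<lambda>k. (fdiff e2 u k)\<^sup>2) / (h2 X N)\<^sup>2"

lemma energy_eq: "u \<in> gridfuns N \<Longrightarrow> gs (\<lambda>k. Lh u k * u k) = - energy u"
  using gs_laplacian_mult[of u u] by (simp add: energy_def power2_eq_square)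

lemma energy_nonneg: "energy u \<ge> 0"
  by (auto simp: energy_def intro!: add_nonneg_nonneg divide_nonneg_nonneg sum_nonneg)

abbreviation PC where "PC \<equiv> poincare_const X"

lemma PC_pos: "PC > 0" unfolding poincare_const_def by (intro mult_pos_pos add_pos_pos) auto

lemma row_osc:
  assumes "i \<in> {1..int (fst N)}" "i' \<in> {1..int (fst N)}"
  shows "\<bar>u (i, j) - u (i', j)\<bar> \<le> (\<Sum>p=1..int (fst N). \<bar>fdiff e1 u (p, j)\<bar>)"
  using osc_le_sum_int[OF assms, of "\<lambda>i. u (i, j)"] by (simp add: fdiff_def)

lemma col_osc:
  assumes "j \<in> {1..int (snd N)}" "j' \<in> {1..int (snd N)}"
  shows "\<bar>u (i, j) - u (i, j')\<bar> \<le> (\<Sum>q=1..int (snd N). \<bar>fdiff e2 u (i, q)\<bar>)"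
  using osc_le_sum_int[OF assms, of "\<lambda>j. u (i, j)"] by (simp add: fdiff_def)

text \<open>Two grid points are joined by first moving along a row and then along a column.\<close>

lemma pair_osc_square:
  assumes "i \<in> {1..int (fst N)}" "i' \<in> {1..int (fst N)}" "j \<in> {1..int (snd N)}" "j' \<in> {1..int (snd N)}"
  shows "(u (i, j) - u (i', j'))\<^sup>2 \<le> 2 * real (fst N) * (\<Sum>p=1..int (fst N). (fdiff e1 u (p, j))\<^sup>2)
     + 2 * real (snd N) * (\<Sum>q=1..int (snd N). (fdiff e2 u (i', q))\<^sup>2)"
proof -
  have a: "(u (i, j) - u (i', j))\<^sup>2 \<le> real (fst N) * (\<Sum>p=1..int (fst N). (fdiff e1 u (p, j))\<^sup>2)"
  proof -
    have "(u (i, j) - u (i', j))\<^sup>2 \<le> (\<Sum>p=1..int (fst N). \<bar>fdiff e1 u (p, j)\<bar>)\<^sup>2"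
      using row_osc[OF assms(1,2), of u j] by (intro abs_le_square_iff[THEN iffD1]) (simp add: sum_nonneg)
    also have "\<dots> \<le> real (fst N) * (\<Sum>p=1..int (fst N). (fdiff e1 u (p, j))\<^sup>2)"
      using square_sum_le[of "{1..int (fst N)}" "\<lambda>p. fdiff e1 u (p, j)"] by simp
    finally show ?thesis .
  qed
  have b: "(u (i', j) - u (i', j'))\<^sup>2 \<le> real (snd N) * (\<Sum>q=1..int (snd N). (fdiff e2 u (i', q))\<^sup>2)"
  proof -
    have "(u (i', j) - u (i', j'))\<^sup>2 \<le> (\<Sum>q=1..int (snd N). \<bar>fdiff e2 u (i', q)\<bar>)\<^sup>2"
      using col_osc[OF assms(3,4), of u i'] by (intro abs_le_square_iff[THEN iffD1]) (simp add: sum_nonneg)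
    also have "\<dots> \<le> real (snd N) * (\<Sum>q=1..int (snd N). (fdiff e2 u (i', q))\<^sup>2)"
      using square_sum_le[of "{1..int (snd N)}" "\<lambda>q. fdiff e2 u (i', q)"] by simp
    finally show ?thesis .
  qed
  have "(u (i, j) - u (i', j'))\<^sup>2 \<le> 2 * (u (i, j) - u (i', j))\<^sup>2 + 2 * (u (i', j) - u (i', j'))\<^sup>2"
    using sum_squares_ge_zero[of "(u (i, j) - u (i', j)) - (u (i', j) - u (i', j'))" 0]
    by (simp add: power2_eq_square algebra_simps)
  with a b show ?thesis by linarith
qed

lemma poincare:
  assumes "gs u = 0"
  shows "gs (\<lambda>k. (u k)\<^sup>2) \<le> PC * energy u"
proof -
  let ?n1 = "real (fst N)" and ?n2 = "real (snd N)"
  let ?D1 = "gs (\<lambda>k. (fdiff e1 u k)\<^sup>2)" and ?D2 = "gs (\<lambda>k. (fdiff e2 u k)\<^sup>2)"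
  have "gs (\<lambda>k. gs (\<lambda>l. (u k - u l)\<^sup>2)) = gs (\<lambda>k. gs (\<lambda>l. (u k)\<^sup>2) + gs (\<lambda>l. (u l)\<^sup>2) - 2 * u k * gs u)"
    by (intro sum.cong refl) (simp add: power2_diff sum.distrib sum_subtractf sum_distrib_left)
  also have "\<dots> = 2 * nn * gs (\<lambda>k. (u k)\<^sup>2)"
    by (simp add: assms sum.distrib card_grid sum_distrib_left[symmetric])
  finally have eq: "gs (\<lambda>k. gs (\<lambda>l. (u k - u l)\<^sup>2)) = 2 * nn * gs (\<lambda>k. (u k)\<^sup>2)" .
  have "gs (\<lambda>k. gs (\<lambda>l. (u k - u l)\<^sup>2)) \<le> gs (\<lambda>k. gs (\<lambda>l.
       2 * ?n1 * (\<Sum>p=1..int (fst N). (fdiff e1 u (p, snd k))\<^sup>2)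
     + 2 * ?n2 * (\<Sum>q=1..int (snd N). (fdiff e2 u (fst l, q))\<^sup>2)))"
  proof (intro sum_mono)
    fix k l assume "k \<in> grid_index N" "l \<in> grid_index N"
    then show "(u k - u l)\<^sup>2 \<le> 2 * ?n1 * (\<Sum>p=1..int (fst N). (fdiff e1 u (p, snd k))\<^sup>2)
     + 2 * ?n2 * (\<Sum>q=1..int (snd N). (fdiff e2 u (fst l, q))\<^sup>2)"
      using pair_osc_square[of "fst k" "fst l" "snd k" "snd l" u] by (auto simp: grid_index_def)
  qed
  also have "\<dots> = nn * (2 * ?n1 * gs (\<lambda>k. \<Sum>p=1..int (fst N). (fdiff e1 u (p, snd k))\<^sup>2))
      + nn * (2 * ?n2 * gs (\<lambda>l. \<Sum>q=1..int (snd N). (fdiff e2 u (fst l, q))\<^sup>2))"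
    by (simp add: sum.distrib card_grid sum_distrib_left[symmetric] algebra_simps)
  also have "gs (\<lambda>k. \<Sum>p=1..int (fst N). (fdiff e1 u (p, snd k))\<^sup>2) = ?n1 * ?D1"
  proof -
    have "gs (\<lambda>k. \<Sum>p=1..int (fst N). (fdiff e1 u (p, snd k))\<^sup>2)
      = ?n1 * (\<Sum>j=1..int (snd N). \<Sum>p=1..int (fst N). (fdiff e1 u (p, j))\<^sup>2)"
      by (simp add: sum_grid)
    also have "(\<Sum>j=1..int (snd N). \<Sum>p=1..int (fst N). (fdiff e1 u (p, j))\<^sup>2) = ?D1"
      unfolding sum_grid by (rule sum.swap)
    finally show ?thesis .
  qed
  also have "gs (\<lambda>l. \<Sum>q=1..int (snd N). (fdiff e2 u (fst l, q))\<^sup>2) = ?n2 * ?D2"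
    by (simp add: sum_grid sum_distrib_left)
  finally have "2 * nn * gs (\<lambda>k. (u k)\<^sup>2) \<le> 2 * nn * (?n1\<^sup>2 * ?D1 + ?n2\<^sup>2 * ?D2)"
    unfolding eq by (simp add: algebra_simps power2_eq_square)
  then have 1: "gs (\<lambda>k. (u k)\<^sup>2) \<le> ?n1\<^sup>2 * ?D1 + ?n2\<^sup>2 * ?D2"
    using nn_pos by (simp add: mult_le_cancel_left_pos)
  have n1: "?n1\<^sup>2 = 4 * (fst X)\<^sup>2 * (1 / (h1 X N)\<^sup>2)" and n2: "?n2\<^sup>2 = 4 * (snd X)\<^sup>2 * (1 / (h2 X N)\<^sup>2)"
    using X1 X2 N1 N2 by (simp_all add: h1_def h2_def power2_eq_square field_simps)
  have "?n1\<^sup>2 * ?D1 \<le> PC * (?D1 / (h1 X N)\<^sup>2)"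
    unfolding n1 poincare_const_def
    using mult_right_mono[of "4 * (fst X)\<^sup>2" "4 * ((fst X)\<^sup>2 + (snd X)\<^sup>2)" "?D1 / (h1 X N)\<^sup>2"]
    by (simp add: sum_nonneg)
  moreover have "?n2\<^sup>2 * ?D2 \<le> PC * (?D2 / (h2 X N)\<^sup>2)"
    unfolding n2 poincare_const_def
    using mult_right_mono[of "4 * (snd X)\<^sup>2" "4 * ((fst X)\<^sup>2 + (snd X)\<^sup>2)" "?D2 / (h2 X N)\<^sup>2"]
    by (simp add: sum_nonneg)
  ultimately show ?thesis using 1 by (simp add: energy_def algebra_simps)
qed

lemma gs_Cauchy_Schwarz: "(gs (\<lambda>k. u k * v k))\<^sup>2 \<le> gs (\<lambda>k. (u k)\<^sup>2) * gs (\<lambda>k. (v k)\<^sup>2)"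
  using Cauchy_Schwarz_ineq_sum[of u v "grid_index N"] by simp

lemma energy_le:
  assumes u: "u \<in> gridfuns N" and 0: "gs u = 0"
  shows "energy u \<le> PC * gs (\<lambda>k. (Lh u k)\<^sup>2)"
proof (cases "energy u = 0")
  case True then show ?thesis using PC_pos by (simp add: sum_nonneg)
next
  case False
  then have pos: "energy u > 0" using energy_nonneg[of u] by simp
  have "(energy u)\<^sup>2 = (gs (\<lambda>k. Lh u k * u k))\<^sup>2" by (simp add: energy_eq[OF u])
  also have "\<dots> \<le> gs (\<lambda>k. (Lh u k)\<^sup>2) * gs (\<lambda>k. (u k)\<^sup>2)" by (rule gs_Cauchy_Schwarz)
  also have "\<dots> \<le> gs (\<lambda>k. (Lh u k)\<^sup>2) * (PC * energy u)"
    by (intro mult_left_mono poincare 0) (simp add: sum_nonneg)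
  finally have "energy u * energy u \<le> (PC * gs (\<lambda>k. (Lh u k)\<^sup>2)) * energy u"
    by (simp add: power2_eq_square algebra_simps)
  then show ?thesis using pos by (simp add: mult_le_cancel_right)
qed

lemma L2_stability:
  assumes u: "u \<in> gridfuns N" and 0: "gs u = 0"
  shows "gs (\<lambda>k. (u k)\<^sup>2) \<le> PC\<^sup>2 * gs (\<lambda>k. (Lh u k)\<^sup>2)"
proof -
  have "gs (\<lambda>k. (u k)\<^sup>2) \<le> PC * energy u" by (rule poincare[OF 0])
  also have "\<dots> \<le> PC * (PC * gs (\<lambda>k. (Lh u k)\<^sup>2))"
    using energy_le[OF u 0] PC_pos by simp
  finally show ?thesis by (simp add: power2_eq_square)
qed

text \<open>The cross term of the square of the discrete Laplacian is the sum of the squared mixed differences,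
after two summations by parts.\<close>

lemma mixed_diff_le:
  assumes u: "u \<in> gridfuns N"
  shows "2 * gs (\<lambda>k. (fdiff e1 (fdiff e2 u) k)\<^sup>2) / ((h1 X N)\<^sup>2 * (h2 X N)\<^sup>2) \<le> gs (\<lambda>k. (Lh u k)\<^sup>2)"
proof -
  let ?A = "\<lambda>k. sdiff e1 u k / (h1 X N)\<^sup>2" and ?B = "\<lambda>k. sdiff e2 u k / (h2 X N)\<^sup>2"
  have "gs (\<lambda>k. sdiff e1 u k * sdiff e2 u k) = - gs (\<lambda>k. fdiff e1 u k * fdiff e1 (sdiff e2 u) k)"
    by (rule sum_by_parts[OF u gridfuns_sdiff[OF u]])
  also have "\<dots> = - gs (\<lambda>k. sdiff e2 (fdiff e1 u) k * fdiff e1 u k)"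
    by (simp add: fdiff_sdiff mult.commute)
  also have "\<dots> = gs (\<lambda>k. fdiff e2 (fdiff e1 u) k * fdiff e2 (fdiff e1 u) k)"
    by (simp add: sum_by_parts gridfuns_fdiff u)
  also have "fdiff e2 (fdiff e1 u) = fdiff e1 (fdiff e2 u)"
    by (rule ext) (simp add: fdiff_def algebra_simps)
  finally have cross: "gs (\<lambda>k. sdiff e1 u k * sdiff e2 u k) = gs (\<lambda>k. (fdiff e1 (fdiff e2 u) k)\<^sup>2)"
    by (simp add: power2_eq_square)
  have "2 * gs (\<lambda>k. ?A k * ?B k) \<le> gs (\<lambda>k. (Lh u k)\<^sup>2)"
    unfolding sum_distrib_left laplacian_h_sdiff by (intro sum_mono) (simp add: power2_sum algebra_simps)
  moreover have "gs (\<lambda>k. ?A k * ?B k) = gs (\<lambda>k. sdiff e1 u k * sdiff e2 u k) / ((h1 X N)\<^sup>2 * (h2 X N)\<^sup>2)"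
    by (simp add: sum_divide_distrib)
  ultimately show ?thesis using cross by simp
qed

abbreviation SC where "SC \<equiv> sup_const X"

lemma SC_nonneg: "SC \<ge> 0"
  unfolding sup_const_def using PC_pos by (intro add_nonneg_nonneg mult_nonneg_nonneg) auto

lemma gs_abs_square_le: "(gs (\<lambda>k. \<bar>u k\<bar>))\<^sup>2 \<le> nn * gs (\<lambda>k. (u k)\<^sup>2)"
  using square_sum_le[of "grid_index N" u] by (simp add: card_grid)

section \<open>A sup estimate for the discrete Laplacian\<close>

text \<open>The Cauchy-Schwarz step shared by the first and the mixed differences: \<open>P\<close> is a sum of absolute
values, \<open>Q\<close> the sum of the squares, \<open>c = h * n1\<close> a side length of the box or its area.\<close>

lemma gradient_sum_aux:
  fixes P :: real
  assumes "P\<^sup>2 \<le> n1 * n2 * Q" "Q / h\<^sup>2 \<le> C * (n1 * n2 * B\<^sup>2)"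
    and "h > 0" "n1 > 0" "n2 > 0" "h * n1 = c" "C \<ge> 0" "B \<ge> 0"
  shows "P / n2 \<le> c * sqrt C * B"
proof -
  have Q: "Q \<le> h\<^sup>2 * (C * (n1 * n2 * B\<^sup>2))"
    using assms(2,3) by (simp add: divide_le_eq mult.commute)
  have "P\<^sup>2 \<le> n1 * n2 * (h\<^sup>2 * (C * (n1 * n2 * B\<^sup>2)))"
    by (rule order_trans[OF assms(1) mult_left_mono[OF Q]]) (use assms in simp)
  also have "\<dots> = (n2 * (h * n1 * sqrt C * B))\<^sup>2"
    using assms(7) unfolding power_mult_distrib real_sqrt_pow2[OF assms(7)]
    by (simp only: power2_eq_square mult_ac)
  finally have "P \<le> n2 * (h * n1 * sqrt C * B)"
    by (rule power2_le_imp_le) (intro mult_nonneg_nonneg real_sqrt_ge_zero; use assms in simp)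
  then show ?thesis using assms by (simp add: divide_le_eq mult_ac)
qed

text \<open>A Sobolev inequality of product type: along a row, the oscillation is at most the sum of the first
differences on that row, and each of these is at most its mean over the column plus the sum of the mixed
differences.\<close>

lemma osc_le_aux:
  assumes "i \<in> {1..int (fst N)}" "i' \<in> {1..int (fst N)}" "j \<in> {1..int (snd N)}" "j' \<in> {1..int (snd N)}"
  shows "\<bar>u (i, j) - u (i', j')\<bar> \<le> gs (\<lambda>k. \<bar>fdiff e1 u k\<bar>) / real (snd N)
     + gs (\<lambda>k. \<bar>fdiff e2 u k\<bar>) / real (fst N) + 2 * gs (\<lambda>k. \<bar>fdiff e1 (fdiff e2 u) k\<bar>)"
proof -
  have sw: "fdiff e2 (fdiff e1 u) = fdiff e1 (fdiff e2 u)"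
    by (rule ext) (simp add: fdiff_def algebra_simps)
  have cols: "gs F = (\<Sum>q=1..int (snd N). \<Sum>p=1..int (fst N). F (p, q))" for F
    unfolding sum_grid by (rule sum.swap)
  have a: "\<bar>u (i, j) - u (i', j)\<bar> \<le> gs (\<lambda>k. \<bar>fdiff e1 u k\<bar>) / real (snd N) + gs (\<lambda>k. \<bar>fdiff e1 (fdiff e2 u) k\<bar>)"
  proof -
    have "\<bar>u (i, j) - u (i', j)\<bar> \<le> (\<Sum>p=1..int (fst N). \<bar>fdiff e1 u (p, j)\<bar>)"
      by (rule row_osc[OF assms(1,2)])
    also have "\<dots> \<le> (\<Sum>p=1..int (fst N). (\<Sum>q=1..int (snd N). \<bar>fdiff e1 u (p, q)\<bar>) / real (snd N)
        + (\<Sum>q=1..int (snd N). \<bar>fdiff e2 (fdiff e1 u) (p, q)\<bar>))"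
    proof (rule sum_mono)
      fix p
      show "\<bar>fdiff e1 u (p, j)\<bar> \<le> (\<Sum>q=1..int (snd N). \<bar>fdiff e1 u (p, q)\<bar>) / real (snd N)
        + (\<Sum>q=1..int (snd N). \<bar>fdiff e2 (fdiff e1 u) (p, q)\<bar>)"
        using abs_le_mean_plus_osc[OF assms(3), of "\<lambda>q. fdiff e1 u (p, q)"]
        by (simp add: fdiff_def[of e2])
    qed
    finally show ?thesis unfolding sw by (simp add: sum_grid sum.distrib sum_divide_distrib)
  qed
  have b: "\<bar>u (i', j) - u (i', j')\<bar> \<le> gs (\<lambda>k. \<bar>fdiff e2 u k\<bar>) / real (fst N) + gs (\<lambda>k. \<bar>fdiff e1 (fdiff e2 u) k\<bar>)"
  proof -
    have "\<bar>u (i', j) - u (i', j')\<bar> \<le> (\<Sum>q=1..int (snd N). \<bar>fdiff e2 u (i', q)\<bar>)"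
      by (rule col_osc[OF assms(3,4)])
    also have "\<dots> \<le> (\<Sum>q=1..int (snd N). (\<Sum>p=1..int (fst N). \<bar>fdiff e2 u (p, q)\<bar>) / real (fst N)
        + (\<Sum>p=1..int (fst N). \<bar>fdiff e1 (fdiff e2 u) (p, q)\<bar>))"
    proof (rule sum_mono)
      fix q
      show "\<bar>fdiff e2 u (i', q)\<bar> \<le> (\<Sum>p=1..int (fst N). \<bar>fdiff e2 u (p, q)\<bar>) / real (fst N)
        + (\<Sum>p=1..int (fst N). \<bar>fdiff e1 (fdiff e2 u) (p, q)\<bar>)"
        using abs_le_mean_plus_osc[OF assms(2), of "\<lambda>p. fdiff e2 u (p, q)"]
        by (simp add: fdiff_def[of e1])
    qed
    also have "\<dots> = gs (\<lambda>k. \<bar>fdiff e2 u k\<bar>) / real (fst N) + gs (\<lambda>k. \<bar>fdiff e1 (fdiff e2 u) k\<bar>)"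
      unfolding cols by (simp add: sum.distrib sum_divide_distrib)
    finally show ?thesis .
  qed
  from a b show ?thesis by linarith
qed

text \<open>The central a priori estimate: a bound on the discrete Laplacian bounds the oscillation, uniformly in
the mesh. The first and mixed differences are controlled in the mean square by the energy estimate, which
suffices for the preceding inequality.\<close>

lemma osc_stability:
  assumes u: "u \<in> gridfuns N" and B: "\<And>k. \<bar>Lh u k\<bar> \<le> B"
  shows "\<bar>u k - u l\<bar> \<le> SC * B"
proof -
  have B0: "B \<ge> 0" using B[of 0] by linarith
  define c where "c = gs u / nn"
  define v where "v = (\<lambda>k. u k - c)"
  have v: "v \<in> gridfuns N" unfolding v_def by (rule gridfuns_comp[OF u])
  have v0: "gs v = 0" using nn_pos by (simp add: v_def c_def sum_subtractf card_grid)
  have Lv: "Lh v k = Lh u k" for k by (simp add: laplacian_h_sdiff sdiff_def v_def algebra_simps)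
  have fv: "fdiff e v = fdiff e u" for e by (simp add: fdiff_def v_def)
  have LB: "gs (\<lambda>k. (Lh u k)\<^sup>2) \<le> nn * B\<^sup>2"
  proof -
    have "gs (\<lambda>k. (Lh u k)\<^sup>2) \<le> gs (\<lambda>k. B\<^sup>2)"
      by (intro sum_mono abs_le_square_iff[THEN iffD1]) (use B B0 in auto)
    then show ?thesis by (simp add: card_grid)
  qed
  have E: "energy u \<le> PC * (nn * B\<^sup>2)"
  proof -
    have "energy u = energy v" by (simp add: energy_def fv)
    also have "\<dots> \<le> PC * gs (\<lambda>k. (Lh u k)\<^sup>2)" using energy_le[OF v v0] by (simp add: Lv)
    also have "\<dots> \<le> PC * (nn * B\<^sup>2)" using LB PC_pos by simp
    finally show ?thesis .
  qed
  have hh: "h1 X N * h2 X N * nn = 4 * fst X * snd X" using N1 N2 by (simp add: h1_def h2_def)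
  have d1: "gs (\<lambda>k. \<bar>fdiff e1 u k\<bar>) / real (snd N) \<le> 2 * fst X * sqrt PC * B"
  proof (rule gradient_sum_aux[OF gs_abs_square_le])
    have "gs (\<lambda>k. (fdiff e1 u k)\<^sup>2) / (h1 X N)\<^sup>2 \<le> energy u"
      by (simp add: energy_def sum_nonneg)
    with E show "gs (\<lambda>k. (fdiff e1 u k)\<^sup>2) / (h1 X N)\<^sup>2 \<le> PC * (nn * B\<^sup>2)" by linarith
  qed (use h1_pos PC_pos B0 h1N in auto)
  have d2: "gs (\<lambda>k. \<bar>fdiff e2 u k\<bar>) / real (fst N) \<le> 2 * snd X * sqrt PC * B"
  proof (rule gradient_sum_aux[of _ "real (snd N)"])
    show "(gs (\<lambda>k. \<bar>fdiff e2 u k\<bar>))\<^sup>2 \<le> real (snd N) * real (fst N) * gs (\<lambda>k. (fdiff e2 u k)\<^sup>2)"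
      using gs_abs_square_le[of "fdiff e2 u"] by (simp only: mult.commute)
    have "gs (\<lambda>k. (fdiff e2 u k)\<^sup>2) / (h2 X N)\<^sup>2 \<le> energy u"
      by (simp add: energy_def sum_nonneg)
    with E show "gs (\<lambda>k. (fdiff e2 u k)\<^sup>2) / (h2 X N)\<^sup>2 \<le> PC * (real (snd N) * real (fst N) * B\<^sup>2)"
      unfolding mult.commute[of "real (snd N)"] by linarith
  qed (use h2_pos PC_pos B0 h2N in auto)
  have d12: "gs (\<lambda>k. \<bar>fdiff e1 (fdiff e2 u) k\<bar>) \<le> 4 * fst X * snd X * B"
  proof -
    let ?D = "gs (\<lambda>k. (fdiff e1 (fdiff e2 u) k)\<^sup>2)"
    have "?D / ((h1 X N)\<^sup>2 * (h2 X N)\<^sup>2) \<le> 2 * ?D / ((h1 X N)\<^sup>2 * (h2 X N)\<^sup>2)"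
      by (intro divide_right_mono) (auto intro: sum_nonneg)
    also have "\<dots> \<le> nn * B\<^sup>2" using mixed_diff_le[OF u] LB by linarith
    finally have "?D / (h1 X N * h2 X N)\<^sup>2 \<le> 1 * (nn * 1 * B\<^sup>2)"
      by (simp only: power_mult_distrib mult_1 mult_1_right)
    then have "gs (\<lambda>k. \<bar>fdiff e1 (fdiff e2 u) k\<bar>) / 1 \<le> 4 * fst X * snd X * sqrt 1 * B"
      by (rule gradient_sum_aux[rotated])
        (use gs_abs_square_le[of "fdiff e1 (fdiff e2 u)"] h1_pos h2_pos nn_pos B0 hh in simp_all)
    then show ?thesis by simp
  qed
  obtain k' where k': "k' \<in> grid_index N" "u k' = u k" using grid_rep[of k] u by metis
  obtain l' where l': "l' \<in> grid_index N" "u l' = u l" using grid_rep[of l] u by metis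
  have "\<bar>u k' - u l'\<bar> \<le> gs (\<lambda>k. \<bar>fdiff e1 u k\<bar>) / real (snd N)
     + gs (\<lambda>k. \<bar>fdiff e2 u k\<bar>) / real (fst N) + 2 * gs (\<lambda>k. \<bar>fdiff e1 (fdiff e2 u) k\<bar>)"
    using osc_le_aux[of "fst k'" "fst l'" "snd k'" "snd l'" u] k' l' by (auto simp: grid_index_def)
  also have "\<dots> \<le> 2 * fst X * sqrt PC * B + 2 * snd X * sqrt PC * B + 2 * (4 * fst X * snd X * B)"
    using d1 d2 d12 by linarith
  also have "\<dots> = SC * B" by (simp add: sup_const_def algebra_simps)
  finally show ?thesis by (simp add: k' l')
qed

lemma abs_le_osc:
  assumes "u \<in> gridfuns N" "gs u = 0" "\<And>k l. \<bar>u k - u l\<bar> \<le> d"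
  shows "\<bar>u k\<bar> \<le> d"
proof -
  have "nn * u k = gs (\<lambda>l. u k - u l)" by (simp add: sum_subtractf assms(2) card_grid)
  then have "nn * \<bar>u k\<bar> = \<bar>gs (\<lambda>l. u k - u l)\<bar>" using nn_pos by (metis abs_mult abs_of_pos)
  also have "\<dots> \<le> gs (\<lambda>l. \<bar>u k - u l\<bar>)" by (rule sum_abs)
  also have "\<dots> \<le> gs (\<lambda>l. d)" by (intro sum_mono assms(3))
  also have "\<dots> = nn * d" by (simp add: card_grid)
  finally show ?thesis using nn_pos by (simp add: mult_le_cancel_left_pos)
qed

lemma sup_stability:
  assumes "u \<in> gridfuns N" "gs u = 0" "\<And>k. \<bar>Lh u k\<bar> \<le> B"
  shows "\<bar>u k\<bar> \<le> SC * B"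
  by (rule abs_le_osc[OF assms(1,2)]) (rule osc_stability[OF assms(1,3)])

section \<open>The discrete Poisson problem\<close>

lemma laplacian_h_lin: "Lh (\<lambda>k. a * u k + b * v k) k = a * Lh u k + b * Lh v k"
proof -
  have "sdiff e (\<lambda>k. a * u k + b * v k) k = a * sdiff e u k + b * sdiff e v k" for e
    by (simp add: sdiff_def algebra_simps)
  then show ?thesis by (simp add: laplacian_h_sdiff add_divide_distrib distrib_left)
qed

lemma laplacian_sq_le:
  assumes u: "u \<in> gridfuns N"
  shows "gs (\<lambda>k. (Lh u k)\<^sup>2) \<le> 8 * (1 / (h1 X N)\<^sup>2 + 1 / (h2 X N)\<^sup>2) * energy u"
proof -
  define a where "a = 1 / (h1 X N)\<^sup>2"
  define b where "b = 1 / (h2 X N)\<^sup>2"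
  have a0: "a > 0" "b > 0" using h1_pos h2_pos by (auto simp: a_def b_def)
  have S: "gs (\<lambda>k. (sdiff e u k)\<^sup>2) \<le> 4 * gs (\<lambda>k. (fdiff e u k)\<^sup>2)" for e
  proof -
    have "gs (\<lambda>k. (sdiff e u k)\<^sup>2) \<le> gs (\<lambda>k. 2 * (fdiff e u k)\<^sup>2 + 2 * (fdiff e u (k + - e))\<^sup>2)"
    proof (rule sum_mono)
      fix k
      have "sdiff e u k = fdiff e u k - fdiff e u (k + - e)" by (simp add: sdiff_def fdiff_def)
      moreover have "(x - y)\<^sup>2 \<le> 2 * x\<^sup>2 + 2 * y\<^sup>2" for x y :: real
        using sum_squares_ge_zero[of "x + y" 0] by (simp add: power2_eq_square algebra_simps)
      ultimately show "(sdiff e u k)\<^sup>2 \<le> 2 * (fdiff e u k)\<^sup>2 + 2 * (fdiff e u (k + - e))\<^sup>2" by simp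
    qed
    also have "\<dots> = 4 * gs (\<lambda>k. (fdiff e u k)\<^sup>2)"
      using sum_grid_shift[OF gridfuns_comp[OF gridfuns_fdiff[OF u, of e], of "\<lambda>x. x\<^sup>2"], of "-e"]
      by (simp add: sum.distrib sum_distrib_left[symmetric])
    finally show ?thesis .
  qed
  have "gs (\<lambda>k. (Lh u k)\<^sup>2) \<le> gs (\<lambda>k. 2 * a\<^sup>2 * (sdiff e1 u k)\<^sup>2 + 2 * b\<^sup>2 * (sdiff e2 u k)\<^sup>2)"
  proof (rule sum_mono)
    fix k
    have "Lh u k = a * sdiff e1 u k + b * sdiff e2 u k" by (simp add: laplacian_h_sdiff a_def b_def)
    moreover have "(x + y)\<^sup>2 \<le> 2 * x\<^sup>2 + 2 * y\<^sup>2" for x y :: real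
      using sum_squares_ge_zero[of "x - y" 0] by (simp add: power2_eq_square algebra_simps)
    ultimately have "(Lh u k)\<^sup>2 \<le> 2 * (a * sdiff e1 u k)\<^sup>2 + 2 * (b * sdiff e2 u k)\<^sup>2" by simp
    then show "(Lh u k)\<^sup>2 \<le> 2 * a\<^sup>2 * (sdiff e1 u k)\<^sup>2 + 2 * b\<^sup>2 * (sdiff e2 u k)\<^sup>2"
      by (simp add: power_mult_distrib)
  qed
  also have "\<dots> = 2 * a\<^sup>2 * gs (\<lambda>k. (sdiff e1 u k)\<^sup>2) + 2 * b\<^sup>2 * gs (\<lambda>k. (sdiff e2 u k)\<^sup>2)"
    by (simp add: sum.distrib sum_distrib_left[symmetric])
  also have "\<dots> \<le> 2 * a\<^sup>2 * (4 * gs (\<lambda>k. (fdiff e1 u k)\<^sup>2)) + 2 * b\<^sup>2 * (4 * gs (\<lambda>k. (fdiff e2 u k)\<^sup>2))"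
    by (intro add_mono mult_left_mono S) auto
  also have "\<dots> = 8 * a * (a * gs (\<lambda>k. (fdiff e1 u k)\<^sup>2)) + 8 * b * (b * gs (\<lambda>k. (fdiff e2 u k)\<^sup>2))"
    by (simp add: power2_eq_square)
  also have "\<dots> \<le> 8 * (a + b) * (a * gs (\<lambda>k. (fdiff e1 u k)\<^sup>2)) + 8 * (a + b) * (b * gs (\<lambda>k. (fdiff e2 u k)\<^sup>2))"
    using a0 by (intro add_mono mult_right_mono) (auto intro!: mult_nonneg_nonneg sum_nonneg)
  also have "\<dots> = 8 * (a + b) * energy u"
    by (simp add: energy_def a_def b_def algebra_simps)
  finally show ?thesis by (simp add: a_def b_def)
qed

text \<open>Solvability of the discrete Poisson problem, by the Richardson iteration \<open>v + c * Lh v\<close>. For small \<open>c\<close>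
it contracts the mean square norm of mean-zero grid functions, by the Poincare inequality, and
the sum of the iterates of \<open>g\<close> telescopes.\<close>

lemma poisson_h_ex:
  assumes g: "g \<in> gridfuns N" and g0: "gs g = 0"
  shows "\<exists>u\<in>gridfuns N. gs u = 0 \<and> (\<forall>k. - Lh u k = g k)"
proof -
  define s where "s = 8 * (1 / (h1 X N)\<^sup>2 + 1 / (h2 X N)\<^sup>2)"
  have s: "s > 0" using h1_pos h2_pos by (simp add: s_def add_pos_pos)
  define c where "c = 1 / s"
  have c: "c > 0" using s by (simp add: c_def)
  define A where "A v = (\<lambda>k. v k + c * Lh v k)" for v
  \<comment> \<open>the factor by which the iteration contracts the sum of the squares\<close>
  define r where "r = 1 - c / PC"
  have A_per: "A v \<in> gridfuns N" if "v \<in> gridfuns N" for v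
    using gridfuns_comp2[OF that gridfuns_laplacian_h[OF that], of "\<lambda>x y. x + c * y"] by (simp add: A_def)
  have A_0: "gs (A v) = 0" if "v \<in> gridfuns N" "gs v = 0" for v
    by (simp add: A_def sum.distrib that sum_distrib_left[symmetric] gs_laplacian)
  have A_le: "gs (\<lambda>k. (A v k)\<^sup>2) \<le> r * gs (\<lambda>k. (v k)\<^sup>2)" if v: "v \<in> gridfuns N" and v0: "gs v = 0" for v
  proof -
    have "gs (\<lambda>k. (A v k)\<^sup>2) = gs (\<lambda>k. (v k)\<^sup>2 + 2 * c * (Lh v k * v k) + c\<^sup>2 * (Lh v k)\<^sup>2)"
      by (rule sum.cong) (simp_all add: A_def power2_eq_square algebra_simps)
    also have "\<dots> = gs (\<lambda>k. (v k)\<^sup>2) - 2 * c * energy v + c\<^sup>2 * gs (\<lambda>k. (Lh v k)\<^sup>2)"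
      by (simp add: sum.distrib sum_distrib_left[symmetric] energy_eq[OF v])
    also have "c\<^sup>2 * gs (\<lambda>k. (Lh v k)\<^sup>2) \<le> c\<^sup>2 * (s * energy v)"
      using laplacian_sq_le[OF v] by (intro mult_left_mono) (auto simp: s_def)
    also have "c\<^sup>2 * (s * energy v) = c * energy v"
      using s by (simp add: c_def power2_eq_square)
    finally have 1: "gs (\<lambda>k. (A v k)\<^sup>2) \<le> gs (\<lambda>k. (v k)\<^sup>2) - c * energy v" by simp
    have "c * (gs (\<lambda>k. (v k)\<^sup>2) / PC) \<le> c * energy v"
      using poincare[OF v0] c PC_pos by (intro mult_left_mono) (auto simp: divide_le_eq mult.commute)
    then show ?thesis using 1 by (simp add: r_def algebra_simps)
  qed
  define a where "a m = (A ^^ m) g" for m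
  have a_per: "a m \<in> gridfuns N" and a_0: "gs (a m) = 0" for m
  proof -
    have "a m \<in> gridfuns N \<and> gs (a m) = 0"
      by (induction m) (auto simp: a_def g g0 A_per A_0)
    then show "a m \<in> gridfuns N" "gs (a m) = 0" by auto
  qed
  \<comment> \<open>a contraction factor that is also positive, as its square root is taken below\<close>
  define r' where "r' = max r (1/2)"
  have r': "0 < r'" "r' < 1" "r \<le> r'" using c PC_pos by (auto simp: r'_def r_def)
  have a_le: "gs (\<lambda>k. (a m k)\<^sup>2) \<le> r' ^ m * gs (\<lambda>k. (g k)\<^sup>2)" for m
  proof (induction m)
    case 0 then show ?case by (simp add: a_def)
  next
    case (Suc m)
    have "gs (\<lambda>k. (a (Suc m) k)\<^sup>2) = gs (\<lambda>k. (A (a m) k)\<^sup>2)" by (simp add: a_def)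
    also have "\<dots> \<le> r * gs (\<lambda>k. (a m k)\<^sup>2)" by (rule A_le[OF a_per a_0])
    also have "\<dots> \<le> r' * gs (\<lambda>k. (a m k)\<^sup>2)" using r' by (intro mult_right_mono) (auto intro: sum_nonneg)
    also have "\<dots> \<le> r' * (r' ^ m * gs (\<lambda>k. (g k)\<^sup>2))" using r' Suc by (intro mult_left_mono) auto
    finally show ?case by simp
  qed
  have a_bd: "\<bar>a m k\<bar> \<le> sqrt (gs (\<lambda>k. (g k)\<^sup>2)) * sqrt r' ^ m" for m k
  proof -
    obtain k' where k': "k' \<in> grid_index N" "a m k' = a m k" using grid_rep[of k] a_per by metis
    have "(a m k)\<^sup>2 \<le> gs (\<lambda>k. (a m k)\<^sup>2)"
      using member_le_sum[of k' "grid_index N" "\<lambda>k. (a m k)\<^sup>2"] k' by simp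
    also have "\<dots> \<le> r' ^ m * gs (\<lambda>k. (g k)\<^sup>2)" by (rule a_le)
    finally have "sqrt ((a m k)\<^sup>2) \<le> sqrt (r' ^ m * gs (\<lambda>k. (g k)\<^sup>2))" by (rule real_sqrt_le_mono)
    then show ?thesis unfolding real_sqrt_abs real_sqrt_mult by (simp add: mult.commute real_sqrt_power)
  qed
  have sm: "summable (\<lambda>m. a m k)" for k
  proof (rule summable_comparison_test)
    show "\<exists>N. \<forall>n\<ge>N. norm (a n k) \<le> sqrt (gs (\<lambda>k. (g k)\<^sup>2)) * sqrt r' ^ n"
      using a_bd by auto
    show "summable (\<lambda>n. sqrt (gs (\<lambda>k. (g k)\<^sup>2)) * sqrt r' ^ n)"
      by (intro summable_mult summable_geometric) (use r' in auto)
  qed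
  define w where "w k = (\<Sum>m. a m k)" for k
  have w: "(\<lambda>m. a m k) sums w k" for k using sm by (simp add: w_def summable_sums)
  define u where "u k = c * w k" for k
  have w_per: "w \<in> gridfuns N"
    using a_per unfolding gridfuns_def w_def by simp
  have "u \<in> gridfuns N" unfolding u_def by (rule gridfuns_comp[OF w_per])
  moreover have "gs u = 0"
  proof -
    have "(\<lambda>m. gs (a m)) sums gs w" by (rule sums_sum) (rule w)
    then have "gs w = 0" using sums_unique2[OF _ sums_zero] by (simp add: a_0)
    then show ?thesis by (simp add: u_def sum_distrib_left[symmetric])
  qed
  moreover have "- Lh u k = g k" for k
  proof -
    have "(\<lambda>m. c * Lh (a m) k) sums (c * Lh w k)"
      unfolding laplacian_h_sdiff sdiff_def
      by (intro sums_mult sums_add sums_diff sums_divide w)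
    moreover have "c * Lh (a m) k = a (Suc m) k - a m k" for m by (simp add: a_def A_def)
    moreover have "(\<lambda>m. a (Suc m) k - a m k) sums (0 - a 0 k)"
      by (rule telescope_sums) (rule summable_LIMSEQ_zero[OF sm])
    ultimately have "c * Lh w k = - g k" using sums_unique2 by (fastforce simp: a_def)
    moreover have "Lh u k = c * Lh w k"
      using laplacian_h_lin[of c w 0 w k] by (simp add: u_def[abs_def])
    ultimately show ?thesis by simp
  qed
  ultimately show ?thesis by blast
qed

lemma area_eq: "area X = 4 * fst X * snd X"
proof -
  have "area X = (\<Prod>b\<in>Basis. (X - (- X)) \<bullet> b)"
    unfolding area_def torus_def
    by (subst measure_lborel_cbox) (use X1 X2 in \<open>auto simp: Basis_prod_def inner_prod_def\<close>)
  also have "\<dots> = 4 * fst X * snd X"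
    by (cases X) (simp add: Basis_prod_def inner_prod_def)
  finally show ?thesis .
qed

lemma hh_nn: "h1 X N * h2 X N * nn = area X"
  using N1 N2 by (simp add: area_eq h1_def h2_def)

lemma area_pos: "area X > 0" using X1 X2 by (simp add: area_eq)

lemma inner_h_one: "inner_h X N g (\<lambda>_. 1) = area X * (gs g / nn)"
  using nn_pos by (simp add: inner_h_def hh_nn[symmetric])

lemma mean_h: "1 / area X * inner_h X N g (\<lambda>_. 1) = gs g / nn"
  using area_pos by (simp add: inner_h_one)

abbreviation invh where "invh \<equiv> inv_neg_laplacian_h X N"

lemma poisson_h_unique:
  assumes "u \<in> gridfuns N" "v \<in> gridfuns N" "gs u = 0" "gs v = 0" "\<And>k. Lh u k = Lh v k"
  shows "u = v"
proof
  fix k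
  have "\<bar>u k - v k\<bar> \<le> SC * 0"
  proof (rule sup_stability)
    show "(\<lambda>k. u k - v k) \<in> gridfuns N" by (rule gridfuns_comp2[OF assms(1,2)])
    show "gs (\<lambda>k. u k - v k) = 0" by (simp add: sum_subtractf assms)
    show "\<bar>Lh (\<lambda>k. u k - v k) k\<bar> \<le> 0" for k
      using laplacian_h_lin[of 1 u "-1" v k] assms(5)[of k] by simp
  qed
  then show "u k = v k" by simp
qed

lemma inv_h_eqI:
  assumes "u \<in> gridfuns N" "gs u = 0" "\<And>k. - Lh u k = g k - gs g / nn"
  shows "invh g = u"
  unfolding inv_neg_laplacian_h_def mean_h
proof (rule the_equality)
  show "u \<in> gridfuns N \<and> inner_h X N u (\<lambda>_. 1) = 0 \<and> (\<forall>k. - Lh u k = g k - gs g / nn)"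
    using assms by (simp add: inner_h_one)
  fix v assume v: "v \<in> gridfuns N \<and> inner_h X N v (\<lambda>_. 1) = 0 \<and> (\<forall>k. - Lh v k = g k - gs g / nn)"
  show "v = u"
  proof (rule poisson_h_unique)
    show "gs v = 0" using v area_pos nn_pos by (simp add: inner_h_one)
    show "Lh v k = Lh u k" for k using v assms(3)[of k] by (metis neg_equal_iff_equal)
  qed (use v assms in auto)
qed

lemma inv_h_props:
  assumes g: "g \<in> gridfuns N"
  shows "invh g \<in> gridfuns N" "gs (invh g) = 0" "\<And>k. Lh (invh g) k = gs g / nn - g k"
proof -
  have "(\<lambda>k. g k - gs g / nn) \<in> gridfuns N" by (rule gridfuns_comp[OF g])
  moreover have "gs (\<lambda>k. g k - gs g / nn) = 0" using nn_pos by (simp add: sum_subtractf card_grid)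
  ultimately obtain u where u: "u \<in> gridfuns N" "gs u = 0" "\<And>k. - Lh u k = g k - gs g / nn"
    using poisson_h_ex by blast
  have "invh g = u" by (rule inv_h_eqI[OF u])
  with u show "invh g \<in> gridfuns N" "gs (invh g) = 0" by auto
  show "Lh (invh g) k = gs g / nn - g k" for k
    using u(3)[of k] \<open>invh g = u\<close> by simp
qed

lemma inv_h_diff:
  assumes "g \<in> gridfuns N" "g' \<in> gridfuns N"
  shows "invh (\<lambda>k. g k - g' k) k = invh g k - invh g' k"
proof -
  have "invh (\<lambda>k. g k - g' k) = (\<lambda>k. invh g k - invh g' k)"
  proof (rule inv_h_eqI)
    show "(\<lambda>k. invh g k - invh g' k) \<in> gridfuns N" 
      by (rule gridfuns_comp2[OF inv_h_props(1)[OF assms(1)] inv_h_props(1)[OF assms(2)]])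
    show "gs (\<lambda>k. invh g k - invh g' k) = 0" by (simp add: sum_subtractf inv_h_props assms)
    show "- Lh (\<lambda>k. invh g k - invh g' k) k = g k - g' k - gs (\<lambda>k. g k - g' k) / nn" for k
      using laplacian_h_lin[of 1 "invh g" "-1" "invh g'" k]
      by (simp add: sum_subtractf inv_h_props assms diff_divide_distrib)
  qed
  then show ?thesis by simp
qed

lemma mean_abs_le:
  assumes "\<And>k. \<bar>g k\<bar> \<le> B"
  shows "\<bar>gs g / nn\<bar> \<le> B"
proof -
  have "\<bar>gs g\<bar> \<le> gs (\<lambda>k. \<bar>g k\<bar>)" by (rule sum_abs)
  also have "\<dots> \<le> gs (\<lambda>k. B)" by (intro sum_mono assms)
  also have "\<dots> = nn * B" by (simp add: card_grid)
  finally show ?thesis using nn_pos by (simp add: divide_le_eq mult.commute)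
qed

lemma inv_h_sup:
  assumes g: "g \<in> gridfuns N" and B: "\<And>k. \<bar>g k\<bar> \<le> B"
  shows "\<bar>invh g k\<bar> \<le> SC * (2 * B)"
proof (rule sup_stability)
  fix k
  show "\<bar>Lh (invh g) k\<bar> \<le> 2 * B"
    using mean_abs_le[of g B, OF B] B[of k] unfolding inv_h_props(3)[OF g] by linarith
qed (use inv_h_props g in auto)

text \<open>The discrete Laplacian of \<open>invh g\<close> is, up to sign, \<open>g\<close> minus its mean, and removing the mean decreases
the sum of the squares.\<close>

lemma inv_h_L2:
  assumes g: "g \<in> gridfuns N"
  shows "gs (\<lambda>k. (invh g k)\<^sup>2) \<le> PC\<^sup>2 * gs (\<lambda>k. (g k)\<^sup>2)"
proof -
  have "gs (\<lambda>k. (invh g k)\<^sup>2) \<le> PC\<^sup>2 * gs (\<lambda>k. (Lh (invh g) k)\<^sup>2)"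
    by (rule L2_stability) (use inv_h_props g in auto)
  also have "gs (\<lambda>k. (Lh (invh g) k)\<^sup>2) = gs (\<lambda>k. (g k)\<^sup>2) - (gs g)\<^sup>2 / nn"
  proof -
    have "gs (\<lambda>k. (Lh (invh g) k)\<^sup>2) = gs (\<lambda>k. (g k)\<^sup>2 - 2 * (gs g / nn) * g k + (gs g / nn)\<^sup>2)"
      by (rule sum.cong) (simp_all add: inv_h_props(3)[OF g] power2_eq_square algebra_simps)
    also have "\<dots> = gs (\<lambda>k. (g k)\<^sup>2) - 2 * (gs g / nn) * gs g + nn * (gs g / nn)\<^sup>2"
      unfolding sum.distrib sum_subtractf sum_distrib_left[symmetric] by (simp add: card_grid)
    also have "\<dots> = gs (\<lambda>k. (g k)\<^sup>2) - (gs g)\<^sup>2 / nn"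
      using nn_pos by (simp add: power2_eq_square field_simps)
    finally show ?thesis .
  qed
  also have "PC\<^sup>2 * (gs (\<lambda>k. (g k)\<^sup>2) - (gs g)\<^sup>2 / nn) \<le> PC\<^sup>2 * gs (\<lambda>k. (g k)\<^sup>2)"
    using nn_pos by (intro mult_left_mono) auto
  finally show ?thesis .
qed

text \<open>The value of \<open>invh F\<close> at 0 is a fixed finite linear combination of the values of \<open>F\<close>. Later \<open>F\<close> will be
the restriction of a smooth function to a translated grid, so that this formula can be differentiated with
respect to the translation.\<close>

lemma inv_h_kernel: "\<exists>G. \<forall>F\<in>gridfuns N. invh F 0 = gs (\<lambda>l. G l * F l)"
proof -
  define d :: "int \<times> int \<Rightarrow> gridfun" where "d m k = (if rep k = m then 1 else 0)" for m k
  have d: "d m \<in> gridfuns N" for m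
    using gridfuns_rep_fun[of "\<lambda>l. if l = m then 1 else 0"] by (simp add: d_def[abs_def])
  have "invh F 0 = gs (\<lambda>m. invh (d m) 0 * F m)" if F: "F \<in> gridfuns N" for F
  proof -
    have Fd: "gs (\<lambda>m. F m * d m k) = F k" for k
    proof -
      have "gs (\<lambda>m. F m * d m k) = gs (\<lambda>m. if rep k = m then F m else 0)"
        by (rule sum.cong) (auto simp: d_def)
      also have "\<dots> = F (rep k)" using rep_in_grid by (simp add: sum.delta')
      finally show ?thesis using gridfun_rep[OF F] by simp
    qed
    have "invh F = (\<lambda>k. gs (\<lambda>m. F m * invh (d m) k))"
    proof (rule inv_h_eqI)
      show "(\<lambda>k. gs (\<lambda>m. F m * invh (d m) k)) \<in> gridfuns N"
        using inv_h_props(1)[OF d] by (simp add: gridfuns_def)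
      show "gs (\<lambda>k. gs (\<lambda>m. F m * invh (d m) k)) = 0"
        by (subst sum.swap) (simp add: sum_distrib_left[symmetric] inv_h_props(2)[OF d])
      fix k
      have sd: "sdiff e (\<lambda>k. gs (\<lambda>m. F m * invh (d m) k)) k = gs (\<lambda>m. F m * sdiff e (invh (d m)) k)" for e
        by (simp add: sdiff_def sum_distrib_left sum.distrib sum_subtractf distrib_left right_diff_distrib
            mult.left_commute)
      have "Lh (\<lambda>k. gs (\<lambda>m. F m * invh (d m) k)) k = gs (\<lambda>m. F m * Lh (invh (d m)) k)"
        by (simp add: laplacian_h_sdiff sd sum_divide_distrib sum.distrib distrib_left)
      also have "\<dots> = gs (\<lambda>m. F m * (gs (d m) / nn) - F m * d m k)"
        by (rule sum.cong) (simp_all add: inv_h_props(3)[OF d] right_diff_distrib)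
      also have "\<dots> = gs (\<lambda>m. F m * gs (d m)) / nn - F k"
        unfolding sum_subtractf Fd times_divide_eq_right sum_divide_distrib[symmetric] ..
      also have "gs (\<lambda>m. F m * gs (d m)) = gs F"
        unfolding sum_distrib_left by (subst sum.swap) (simp add: Fd)
      finally show "- Lh (\<lambda>k. gs (\<lambda>m. F m * invh (d m) k)) k = F k - gs F / nn" by simp
    qed
    then show ?thesis by (simp add: mult.commute)
  qed
  then show ?thesis by (intro exI[of _ "\<lambda>m. invh (d m) 0"]) blast
qed

lemma inv_h_shift:
  assumes F: "F \<in> gridfuns N"
  shows "invh (\<lambda>l. F (l + k)) = (\<lambda>l. invh F (l + k))"
proof (rule inv_h_eqI)
  show "(\<lambda>l. invh F (l + k)) \<in> gridfuns N" by (rule gridfuns_shift[OF inv_h_props(1)[OF F]])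
  show "gs (\<lambda>l. invh F (l + k)) = 0" using sum_grid_shift[OF inv_h_props(1)[OF F]] inv_h_props(2)[OF F] by simp
  fix l
  have "sdiff e (\<lambda>l. invh F (l + k)) l = sdiff e (invh F) (l + k)" for e
    by (simp add: sdiff_def algebra_simps)
  then have "Lh (\<lambda>l. invh F (l + k)) l = Lh (invh F) (l + k)" by (simp add: laplacian_h_sdiff)
  then show "- Lh (\<lambda>l. invh F (l + k)) l = F (l + k) - gs (\<lambda>l. F (l + k)) / nn"
    using sum_grid_shift[OF F] inv_h_props(3)[OF F] by simp
qed

lemma norm_Linf_ge: "u \<in> gridfuns N \<Longrightarrow> \<bar>u k\<bar> \<le> norm_Linf_h N u"
  unfolding norm_Linf_h_def using rep_in_grid[of k] gridfun_rep[of u k]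
  by (intro Max_ge) (auto intro!: image_eqI[of _ _ "rep k"])

lemma grid_nonempty: "grid_index N \<noteq> {}"
  using rep_in_grid by auto

lemma norm_Linf_le: "(\<And>k. \<bar>u k\<bar> \<le> B) \<Longrightarrow> norm_Linf_h N u \<le> B"
  unfolding norm_Linf_h_def using grid_nonempty by (intro Max.boundedI) auto

text \<open>The infimum that defines the operator norm is attained.\<close>

lemma inv_h_norm:
  assumes g: "g \<in> gridfuns N" and B: "\<And>k. \<bar>g k\<bar> \<le> B"
  shows "\<bar>invh g k\<bar> \<le> norm_inv_neg_laplacian_h X N * B"
proof -
  define S where "S = {C. \<forall>g\<in>gridfuns N. norm_Linf_h N (invh g) \<le> C * norm_Linf_h N g}"
  have S_eq: "norm_inv_neg_laplacian_h X N = Inf S" by (simp add: norm_inv_neg_laplacian_h_def S_def)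
  have "SC * 2 \<in> S"
    unfolding S_def
  proof (intro CollectI ballI norm_Linf_le)
    fix g k assume g: "g \<in> gridfuns N"
    show "\<bar>invh g k\<bar> \<le> SC * 2 * norm_Linf_h N g"
      using inv_h_sup[OF g norm_Linf_ge[OF g], of k] by (simp only: mult.assoc)
  qed
  then have ne: "S \<noteq> {}" by auto
  have pos: "C \<ge> 0" if "C \<in> S" for C
  proof -
    have "norm_Linf_h N (invh (\<lambda>_. 1)) \<le> C * norm_Linf_h N (\<lambda>_. 1)"
      using that by (auto simp: S_def)
    moreover have "0 \<le> norm_Linf_h N (invh (\<lambda>_. 1))"
      using norm_Linf_ge[OF inv_h_props(1)[OF gridfuns_const], of 1 0] by linarith
    moreover have "norm_Linf_h N (\<lambda>_. 1) = 1"
      unfolding norm_Linf_h_def using grid_nonempty by simp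
    ultimately show ?thesis by simp
  qed
  have Inf0: "Inf S \<ge> 0" using ne pos by (intro cInf_greatest) auto
  define b where "b = norm_Linf_h N g"
  have b0: "b \<ge> 0" using norm_Linf_ge[OF g, of 0] by (simp add: b_def)
  have bB: "b \<le> B" unfolding b_def by (rule norm_Linf_le[OF B])
  have le: "\<bar>invh g k\<bar> \<le> C * b" if "C \<in> S" for C
    using that g norm_Linf_ge[OF inv_h_props(1)[OF g], of k] by (fastforce simp: S_def b_def)
  have "\<bar>invh g k\<bar> \<le> Inf S * b"
  proof (cases "b = 0")
    case True
    then show ?thesis using le ne by auto
  next
    case False
    then have "b > 0" using b0 by simp
    then have "\<bar>invh g k\<bar> / b \<le> Inf S"
      using le ne by (intro cInf_greatest) (auto simp: divide_le_eq)
    then show ?thesis using \<open>b > 0\<close> by (simp add: divide_le_eq)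
  qed
  also have "\<dots> \<le> Inf S * B" using Inf0 bB by (rule mult_left_mono[rotated])
  finally show ?thesis by (simp add: S_eq)
qed

section \<open>Maximum principle and mean square stability\<close>

lemma max_principle:
  assumes v: "v \<in> gridfuns N" and a: "a > 0" and e: "e > 0"
    and le: "\<And>k. a * v k - e * Lh v k \<le> a * c"
  shows "v k \<le> c"
proof -
  obtain m where m: "m \<in> grid_index N" "\<And>l. l \<in> grid_index N \<Longrightarrow> v l \<le> v m"
  proof -
    have "Max (v ` grid_index N) \<in> v ` grid_index N"
      using grid_nonempty by (intro Max_in) auto
    then obtain m where "m \<in> grid_index N" "v m = Max (v ` grid_index N)" by auto
    then show ?thesis using that by simp
  qed
  have max: "v l \<le> v m" for l using m(2)[OF rep_in_grid[of l]] gridfun_rep[OF v, of l] by simp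
  have "sdiff d v m \<le> 0" for d using max[of "m - d"] max[of "m + d"] by (simp add: sdiff_def)
  then have "Lh v m \<le> 0"
    unfolding laplacian_h_sdiff
    by (intro add_nonpos_nonpos divide_nonpos_nonneg) auto
  then have "e * Lh v m \<le> 0" using e by (simp add: mult_nonneg_nonpos)
  then have "a * v m \<le> a * c" using le[of m] by linarith
  then have "v m \<le> c" using a by simp
  then show ?thesis using max[of k] by linarith
qed

lemma min_principle:
  assumes v: "v \<in> gridfuns N" and a: "a > 0" and e: "e > 0"
    and ge: "\<And>k. a * v k - e * Lh v k \<ge> a * c"
  shows "v k \<ge> c"
proof -
  have "- v k \<le> - c"
  proof (rule max_principle[of "\<lambda>k. - v k" a e])
    show "(\<lambda>k. - v k) \<in> gridfuns N" by (rule gridfuns_comp[OF v])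
    show "a * - v k - e * Lh (\<lambda>k. - v k) k \<le> a * - c" for k
      using ge[of k] laplacian_h_lin[of "-1" v 0 v k] by simp
  qed (use a e in auto)
  then show ?thesis by simp
qed

abbreviation L2 :: "gridfun \<Rightarrow> real" where "L2 u \<equiv> L2_set u (grid_index N)"

lemma L2_square: "(L2 u)\<^sup>2 = gs (\<lambda>k. (u k)\<^sup>2)"
  by (simp add: L2_set_def sum_nonneg)

lemma norm_L2_h_eq: "norm_L2_h X N u = sqrt (h1 X N * h2 X N) * L2 u"
  by (simp add: norm_L2_h_def inner_h_def L2_set_def real_sqrt_mult power2_eq_square)

lemma L2_const: "L2 (\<lambda>_. c) = sqrt nn * \<bar>c\<bar>"
  by (simp add: L2_set_def card_grid real_sqrt_mult)

lemma L2_sup_le: "(\<And>k. \<bar>u k\<bar> \<le> B) \<Longrightarrow> L2 u \<le> sqrt nn * B"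
proof -
  assume B: "\<And>k. \<bar>u k\<bar> \<le> B"
  have B0: "B \<ge> 0" using B[of 0] by linarith
  have "L2 u \<le> L2 (\<lambda>_. B)"
    unfolding L2_set_def
    by (intro real_sqrt_le_mono sum_mono abs_le_square_iff[THEN iffD1]) (use B B0 in auto)
  then show ?thesis using B0 by (simp add: L2_const)
qed

lemma inv_h_L2_set: "g \<in> gridfuns N \<Longrightarrow> L2 (invh g) \<le> PC * L2 g"
  using inv_h_L2[of g] PC_pos
  by (intro power2_le_imp_le[of "L2 (invh g)"]) (auto simp: L2_square power_mult_distrib L2_set_nonneg)

text \<open>One implicit step with right-hand side \<open>b\<close>, tested with the new value; the Laplacian has a sign.\<close>

lemma step_stability:
  assumes e': "e' \<in> gridfuns N" and a: "a > 0" and c: "c \<ge> 0"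
    and eq: "\<And>k. a * (e' k - e k) = c * Lh e' k + b k"
  shows "a * L2 e' \<le> a * L2 e + L2 b"
proof -
  have "a * (L2 e')\<^sup>2 = gs (\<lambda>k. (a * e k + b k) * e' k) + c * gs (\<lambda>k. Lh e' k * e' k)"
  proof -
    have "a * (L2 e')\<^sup>2 = gs (\<lambda>k. (a * e k + b k) * e' k + c * (Lh e' k * e' k))"
      unfolding L2_square sum_distrib_left
    proof (rule sum.cong)
      fix k
      have "a * e' k = a * e k + b k + c * Lh e' k" using eq[of k] by (simp add: algebra_simps)
      then have "a * e' k * e' k = (a * e k + b k + c * Lh e' k) * e' k" by simp
      then show "a * (e' k)\<^sup>2 = (a * e k + b k) * e' k + c * (Lh e' k * e' k)"
        by (simp add: power2_eq_square algebra_simps)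
    qed simp
    then show ?thesis by (simp add: sum.distrib sum_distrib_left)
  qed
  also have "\<dots> \<le> gs (\<lambda>k. (a * e k + b k) * e' k)"
    using energy_eq[OF e'] energy_nonneg[of e'] c by simp
  also have "\<dots> \<le> gs (\<lambda>k. \<bar>a * e k + b k\<bar> * \<bar>e' k\<bar>)"
    by (intro sum_mono) (metis abs_ge_self abs_mult)
  also have "\<dots> \<le> L2 (\<lambda>k. a * e k + b k) * L2 e'" by (rule L2_set_mult_ineq)
  also have "\<dots> \<le> (a * L2 e + L2 b) * L2 e'"
  proof (rule mult_right_mono)
    have "L2 (\<lambda>k. a * e k + b k) \<le> L2 (\<lambda>k. a * e k) + L2 b" by (rule L2_set_triangle_ineq)
    also have "L2 (\<lambda>k. a * e k) = a * L2 e" using a by (simp add: L2_set_right_distrib)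
    finally show "L2 (\<lambda>k. a * e k + b k) \<le> a * L2 e + L2 b" .
  qed simp
  finally have *: "a * L2 e' * L2 e' \<le> (a * L2 e + L2 b) * L2 e'" by (simp add: power2_eq_square)
  show ?thesis
  proof (cases "L2 e' = 0")
    case True
    have "0 \<le> a * L2 e + L2 b" using a by (intro add_nonneg_nonneg mult_nonneg_nonneg) auto
    then show ?thesis using True by simp
  next
    case False
    then have "L2 e' > 0" by (simp add: order_less_le)
    then show ?thesis using * by simp
  qed
qed

end

section \<open>Preservation of the bounds 0 and 1\<close>

lemma deriv_W: "deriv W = (\<lambda>s. 36 * (s\<^sup>2 - s) * (2 * s - 1))"
proof
  fix s :: real
  have "(W has_real_derivative 36 * (s\<^sup>2 - s) * (2 * s - 1)) (at s)"
    unfolding W_def[abs_def] by (auto intro!: derivative_eq_intros simp: power2_eq_square algebra_simps)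
  then show "deriv W s = 36 * (s\<^sup>2 - s) * (2 * s - 1)" by (rule DERIV_imp_deriv)
qed

lemma deriv2_W: "deriv (deriv W) = (\<lambda>s. 216 * s\<^sup>2 - 216 * s + 36)"
proof
  fix s :: real
  have "((\<lambda>s. 36 * (s\<^sup>2 - s) * (2 * s - 1)) has_real_derivative 216 * s\<^sup>2 - 216 * s + 36) (at s)"
    by (auto intro!: derivative_eq_intros simp: power2_eq_square algebra_simps)
  then show "deriv (deriv W) s = 216 * s\<^sup>2 - 216 * s + 36"
    unfolding deriv_W by (rule DERIV_imp_deriv)
qed

lemma deriv_f: "deriv f = (\<lambda>s. 6 * s - 6 * s\<^sup>2)"
proof
  fix s :: real
  have "(f has_real_derivative 6 * s - 6 * s\<^sup>2) (at s)"
    unfolding f_def[abs_def] by (auto intro!: derivative_eq_intros simp: power2_eq_square algebra_simps)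
  then show "deriv f s = 6 * s - 6 * s\<^sup>2" by (rule DERIV_imp_deriv)
qed

lemma deriv2_f: "deriv (deriv f) = (\<lambda>s. 6 - 12 * s)"
proof
  fix s :: real
  have "((\<lambda>s. 6 * s - 6 * s\<^sup>2) has_real_derivative 6 - 12 * s) (at s)"
    by (auto intro!: derivative_eq_intros)
  then show "deriv (deriv f) s = 6 - 12 * s"
    unfolding deriv_f by (rule DERIV_imp_deriv)
qed

lemma Linf01_ge:
  assumes "continuous_on {0..1} g" "s \<in> {0..1}"
  shows "\<bar>g s\<bar> \<le> Linf01 g"
  unfolding Linf01_def
proof (rule cSUP_upper[OF assms(2)])
  have "compact ((\<lambda>s. \<bar>g s\<bar>) ` {0..1})"
    by (intro compact_continuous_image continuous_intros assms) auto
  then show "bdd_above ((\<lambda>s. \<bar>g s\<bar>) ` {0..1})" by (intro bounded_imp_bdd_above compact_imp_bounded)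
qed

lemma f_unit: "s \<in> {0..1} \<Longrightarrow> f s \<in> {0..1}"
proof -
  assume s: "s \<in> {0..1}"
  have "f s = s\<^sup>2 * (3 - 2 * s)" by (simp add: f_def power2_eq_square power3_eq_cube algebra_simps)
  moreover have "1 - f s = (1 - s)\<^sup>2 * (1 + 2 * s)" by (simp add: f_def power2_eq_square power3_eq_cube algebra_simps)
  ultimately show ?thesis using s
    by (smt (verit) atLeastAtMost_iff mult_nonneg_nonneg zero_le_power2)
qed

text \<open>The stabilization makes the explicit part of the scheme a nondecreasing function of the old value, for
every admissible size \<open>a\<close> of the nonlocal factor. As this function maps 0 to 0 and 1 to \<open>K\<close>, it maps
the unit interval into \<open>{0..K}\<close>.\<close>

lemma stabilized_monotone:
  assumes a: "\<bar>a\<bar> \<le> A" and s: "s \<in> {0..1}" and "e > 0"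
    and K: "K \<ge> Linf01 (deriv (deriv W)) / e + Linf01 (deriv (deriv f)) * A"
  shows "0 \<le> K * s - 1 / e * deriv W s - a * deriv f s" "K * s - 1 / e * deriv W s - a * deriv f s \<le> K"
proof -
  let ?g = "\<lambda>s. K * s - 1 / e * deriv W s - a * deriv f s"
  have mono: "?g x \<le> ?g y" if "0 \<le> x" "x \<le> y" "y \<le> 1" for x y
  proof (rule DERIV_nonneg_imp_nondecreasing[OF that(2)])
    fix t assume t: "x \<le> t" "t \<le> y"
    then have t01: "t \<in> {0..1}" using that by auto
    have "(?g has_real_derivative K - 1 / e * deriv (deriv W) t - a * deriv (deriv f) t) (at t)"
      using \<open>e > 0\<close> unfolding deriv2_W deriv2_f unfolding deriv_W deriv_f
      by (auto intro!: derivative_eq_intros simp: power2_eq_square algebra_simps)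
    moreover have "0 \<le> K - 1 / e * deriv (deriv W) t - a * deriv (deriv f) t"
    proof -
      have "1 / e * deriv (deriv W) t \<le> Linf01 (deriv (deriv W)) / e"
        using Linf01_ge[OF _ t01, of "deriv (deriv W)"] \<open>e > 0\<close>
        by (simp add: deriv2_W divide_right_mono continuous_intros)
      moreover have "a * deriv (deriv f) t \<le> Linf01 (deriv (deriv f)) * A"
      proof -
        have "a * deriv (deriv f) t \<le> \<bar>a\<bar> * \<bar>deriv (deriv f) t\<bar>" by (metis abs_ge_self abs_mult)
        also have "\<dots> \<le> A * Linf01 (deriv (deriv f))"
        proof (rule mult_mono[OF a])
          show "\<bar>deriv (deriv f) t\<bar> \<le> Linf01 (deriv (deriv f))"
            by (rule Linf01_ge[OF _ t01]) (auto simp: deriv2_f intro!: continuous_intros)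
        qed (use a in auto)
        finally show ?thesis by (simp add: mult.commute)
      qed
      ultimately show ?thesis using K by linarith
    qed
    ultimately show "\<exists>y. (?g has_real_derivative y) (at t) \<and> 0 \<le> y" by blast
  qed
  have "?g 0 = 0" "?g 1 = K" by (simp_all add: deriv_W deriv_f)
  then show "0 \<le> ?g s" "?g s \<le> K" using mono[of 0 s] mono[of s 1] s by auto
qed

context torus_grid begin

text \<open>The scheme preserves the bounds 0 and 1.\<close>

lemma scheme_bounds:
  assumes st: "scheme_step X N \<tau> \<kappa> \<epsilon> \<gamma> M \<omega> u v" and u: "u \<in> gridfuns N" and v: "v \<in> gridfuns N"
    and stab: "stabilizing X N \<kappa> \<epsilon> \<gamma> M \<omega>"
    and pos: "\<tau> > 0" "\<kappa> > 0" "\<epsilon> > 0" "\<gamma> > 0" "M > 0" "0 < \<omega>" "\<omega> < 1"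
    and u01: "\<And>k. u k \<in> {0..1}"
  shows "v k \<in> {0..1}"
proof -
  define w where "w = max \<omega> (1 - \<omega>)"
  define nL where "nL = norm_inv_neg_laplacian_h X N"
  define A where "A = (\<gamma> * nL + M * area X) * w"
  define g where "g l = f (u l) - \<omega>" for l
  define a where "a k = \<gamma> * invh g k + M * inner_h X N g (\<lambda>_. 1)" for k
  have g: "g \<in> gridfuns N" unfolding g_def by (rule gridfuns_comp[OF u])
  have gw: "\<bar>g l\<bar> \<le> w" for l using f_unit[OF u01[of l]] by (auto simp: g_def w_def)
  have w0: "w \<ge> 0" using gw[of 0] by linarith
  have aA: "\<bar>a k\<bar> \<le> A" for k
  proof -
    have "\<bar>\<gamma> * invh g k\<bar> \<le> \<gamma> * (nL * w)"
      using inv_h_norm[OF g gw, of k] pos by (simp add: abs_mult nL_def)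
    moreover have "\<bar>M * inner_h X N g (\<lambda>_. 1)\<bar> \<le> M * (area X * w)"
      using mult_left_mono[OF mean_abs_le[of g w, OF gw], of "M * area X"] pos area_pos
      unfolding inner_h_one abs_mult by (simp add: mult.assoc)
    ultimately show ?thesis unfolding a_def A_def by (simp add: algebra_simps)
  qed
  have A0: "A \<ge> 0" using aA[of 0] by linarith
  \<comment> \<open>follows from the nonnegative bound \<open>A\<close>, as \<open>w > 0\<close>\<close>
  have nLA: "\<gamma> * nL + M * area X \<ge> 0"
  proof (rule ccontr)
    assume "\<not> ?thesis"
    moreover have "w > 0" using pos by (simp add: w_def)
    ultimately have "A < 0" unfolding A_def by (simp add: mult_neg_pos)
    then show False using A0 by simp
  qed
  have K: "\<kappa> / \<epsilon> \<ge> Linf01 (deriv (deriv W)) / \<epsilon> + Linf01 (deriv (deriv f)) * A"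
  proof -
    have "0 \<le> (Linf01 (deriv f))\<^sup>2 * (\<gamma> * nL + M * area X)" using nLA by simp
    then show ?thesis using stab unfolding stabilizing_def A_def w_def[symmetric] nL_def[symmetric]
      by (simp add: algebra_simps)
  qed
  define q where "q k = \<kappa> / \<epsilon> * u k - 1 / \<epsilon> * deriv W (u k) - a k * deriv f (u k)" for k
  have q: "0 \<le> q k" "q k \<le> \<kappa> / \<epsilon>" for k
    using stabilized_monotone[OF aA u01 \<open>\<epsilon> > 0\<close> K] by (auto simp: q_def)
  have eq: "(1 / \<tau> + \<kappa> / \<epsilon>) * v k - \<epsilon> * Lh v k = u k / \<tau> + q k" for k
  proof -
    have "(1 / \<tau> + \<kappa> / \<epsilon>) * (v k - u k) =
        \<epsilon> * Lh v k - 1 / \<epsilon> * deriv W (u k) - a k * deriv f (u k)"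
      using st[unfolded scheme_step_def, rule_format, of k] unfolding a_def g_def by (simp add: algebra_simps)
    then show ?thesis unfolding q_def by (simp add: algebra_simps)
  qed
  have al: "1 / \<tau> + \<kappa> / \<epsilon> > 0" using pos by (simp add: add_pos_pos)
  have "v k \<le> 1"
  proof (rule max_principle[OF v al \<open>\<epsilon> > 0\<close>])
    fix k
    show "(1 / \<tau> + \<kappa> / \<epsilon>) * v k - \<epsilon> * Lh v k \<le> (1 / \<tau> + \<kappa> / \<epsilon>) * 1"
      unfolding eq using q[of k] u01[of k] pos by (simp add: add_mono divide_right_mono)
  qed
  moreover have "0 \<le> v k"
  proof (rule min_principle[OF v al \<open>\<epsilon> > 0\<close>])
    fix k
    show "(1 / \<tau> + \<kappa> / \<epsilon>) * v k - \<epsilon> * Lh v k \<ge> (1 / \<tau> + \<kappa> / \<epsilon>) * 0"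
      unfolding eq using q[of k] u01[of k] pos by simp
  qed
  ultimately show ?thesis by simp
qed

end

section \<open>Lipschitz continuity of the nonlinearity and convergence given consistency\<close>

text \<open>All terms of the right-hand side of the scheme except the Laplacian.\<close>

definition nonlin_h :: "real \<times> real \<Rightarrow> nat \<times> nat \<Rightarrow> real \<Rightarrow> real \<Rightarrow> real \<Rightarrow> real \<Rightarrow> gridfun \<Rightarrow> gridfun" where
  "nonlin_h X N \<epsilon> \<gamma> M \<omega> u k =
     - (1 / \<epsilon> * deriv W (u k)) - \<gamma> * inv_neg_laplacian_h X N (\<lambda>l. f (u l) - \<omega>) k * deriv f (u k)
     - M * inner_h X N (\<lambda>l. f (u l) - \<omega>) (\<lambda>_. 1) * deriv f (u k)"

text \<open>A Lipschitz constant of this nonlinearity, both in the mean square and in the supremum norm, on grid functions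
with values in an interval on which \<open>K\<close> is as in the locale \<open>nonlinearity\<close> below. It does not depend on the
mesh.\<close>

definition lip_const :: "real \<times> real \<Rightarrow> real \<Rightarrow> real \<Rightarrow> real \<Rightarrow> real \<Rightarrow> real" where
  "lip_const X \<epsilon> \<gamma> M K = K / \<epsilon>
     + \<gamma> * (poincare_const X * K * K + 2 * sup_const X * K * K + 2 * sup_const X * (K + 1) * K)
     + M * (area X * K * K + area X * (K + 1) * K)"

lemma poly_bounds:
  assumes B: "B \<ge> (1::real)"
  obtains K where "K \<ge> 0"
    "\<And>a. \<bar>a\<bar> \<le> B \<Longrightarrow> \<bar>f a\<bar> \<le> K" "\<And>a. \<bar>a\<bar> \<le> B \<Longrightarrow> \<bar>deriv f a\<bar> \<le> K"
    "\<And>a b. \<bar>a\<bar> \<le> B \<Longrightarrow> \<bar>b\<bar> \<le> B \<Longrightarrow> \<bar>deriv W a - deriv W b\<bar> \<le> K * \<bar>a - b\<bar>"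
    "\<And>a b. \<bar>a\<bar> \<le> B \<Longrightarrow> \<bar>b\<bar> \<le> B \<Longrightarrow> \<bar>f a - f b\<bar> \<le> K * \<bar>a - b\<bar>"
    "\<And>a b. \<bar>a\<bar> \<le> B \<Longrightarrow> \<bar>b\<bar> \<le> B \<Longrightarrow> \<bar>deriv f a - deriv f b\<bar> \<le> K * \<bar>a - b\<bar>"
proof -
  have pr: "\<bar>a * b\<bar> \<le> B\<^sup>2" if "\<bar>a\<bar> \<le> B" "\<bar>b\<bar> \<le> B" for a b
    using mult_mono[OF that] B by (simp add: abs_mult power2_eq_square)
  have BB: "B \<le> B\<^sup>2" "1 \<le> B\<^sup>2" "B\<^sup>2 \<le> B ^ 3"
    using B by (auto simp: self_le_power one_le_power power_increasing)
  have pr3: "\<bar>a * (a * a)\<bar> \<le> B ^ 3" if "\<bar>a\<bar> \<le> B" for a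
    using mult_mono[OF that pr[OF that that]] B by (simp add: abs_mult power2_eq_square power3_eq_cube)
  let ?K = "468 * B ^ 3"
  have q: "\<bar>(a - b) * c\<bar> \<le> ?K * \<bar>a - b\<bar>" if "\<bar>c\<bar> \<le> ?K" for a b c :: real
    using mult_left_mono[OF that, of "\<bar>a - b\<bar>"] by (simp add: abs_mult mult.commute)
  show ?thesis
  proof (rule that[of ?K])
    show "0 \<le> ?K" using B by simp
    fix a b :: real assume a: "\<bar>a\<bar> \<le> B"
    show "\<bar>f a\<bar> \<le> ?K"
      using pr[OF a a] pr3[OF a] BB zero_le_square[of a]
      unfolding f_def power2_eq_square power3_eq_cube mult.assoc abs_le_iff by linarith
    show "\<bar>deriv f a\<bar> \<le> ?K"
      using pr[OF a a] a BB zero_le_square[of a]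
      unfolding deriv_f power2_eq_square abs_le_iff by linarith
    assume b: "\<bar>b\<bar> \<le> B"
    note p = pr[OF a a] pr[OF a b] pr[OF b b] a b BB
    have "\<bar>72 * (a * a + a * b + b * b) - 108 * (a + b) + 36\<bar> \<le> ?K"
      by (rule abs_leI; use p in \<open>simp only: abs_le_iff distrib_left; linarith\<close>)
    from q[OF this, of a b] show "\<bar>deriv W a - deriv W b\<bar> \<le> ?K * \<bar>a - b\<bar>"
      by (simp add: deriv_W power2_eq_square algebra_simps)
    have "\<bar>3 * (a + b) - 2 * (a * a + a * b + b * b)\<bar> \<le> ?K"
      by (rule abs_leI; use p in \<open>simp only: abs_le_iff distrib_left; linarith\<close>)
    from q[OF this, of a b] show "\<bar>f a - f b\<bar> \<le> ?K * \<bar>a - b\<bar>"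
      by (simp add: f_def power2_eq_square power3_eq_cube algebra_simps)
    have "\<bar>6 - 6 * (a + b)\<bar> \<le> ?K"
      by (rule abs_leI; use p in \<open>simp only: abs_le_iff distrib_left; linarith\<close>)
    from q[OF this, of a b] show "\<bar>deriv f a - deriv f b\<bar> \<le> ?K * \<bar>a - b\<bar>"
      by (simp add: deriv_f power2_eq_square algebra_simps)
  qed
qed

text \<open>The parameters of the equation, with a bound \<open>B\<close> for the values considered and a constant \<open>K\<close> that bounds
\<open>f\<close>, its derivative and the Lipschitz constants of \<open>f\<close>, of its derivative and of the derivative of \<open>W\<close>
on \<open>{-B..B}\<close>.\<close>

locale nonlinearity = torus_grid +
  fixes \<epsilon> \<gamma> M \<omega> B K :: real
  assumes eps: "\<epsilon> > 0" and gam: "\<gamma> > 0" and Mpos: "M > 0" and om: "0 < \<omega>" "\<omega> < 1"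
    and K: "K \<ge> 0"
    and f_bd: "\<And>a. \<bar>a\<bar> \<le> B \<Longrightarrow> \<bar>f a\<bar> \<le> K" and df_bd: "\<And>a. \<bar>a\<bar> \<le> B \<Longrightarrow> \<bar>deriv f a\<bar> \<le> K"
    and dW_lip: "\<And>a b. \<bar>a\<bar> \<le> B \<Longrightarrow> \<bar>b\<bar> \<le> B \<Longrightarrow> \<bar>deriv W a - deriv W b\<bar> \<le> K * \<bar>a - b\<bar>"
    and f_lip: "\<And>a b. \<bar>a\<bar> \<le> B \<Longrightarrow> \<bar>b\<bar> \<le> B \<Longrightarrow> \<bar>f a - f b\<bar> \<le> K * \<bar>a - b\<bar>"
    and df_lip: "\<And>a b. \<bar>a\<bar> \<le> B \<Longrightarrow> \<bar>b\<bar> \<le> B \<Longrightarrow> \<bar>deriv f a - deriv f b\<bar> \<le> K * \<bar>a - b\<bar>"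
begin

abbreviation Fh where "Fh \<equiv> nonlin_h X N \<epsilon> \<gamma> M \<omega>"
abbreviation LC where "LC \<equiv> lip_const X \<epsilon> \<gamma> M K"

lemma LC_nonneg: "LC \<ge> 0"
  using eps gam Mpos K PC_pos SC_nonneg area_pos by (simp add: lip_const_def)

text \<open>The difference of two products is split so that the nonlocal factors are differenced against a bounded
local factor, and the local factors against a nonlocal factor that is bounded in the supremum norm. Only the
first kind depends on more than the pointwise difference of \<open>u\<close> and \<open>v\<close>.\<close>

lemma nonlin_pointwise:
  assumes u: "u \<in> gridfuns N" and v: "v \<in> gridfuns N"
    and uB: "\<And>k. \<bar>u k\<bar> \<le> B" and vB: "\<And>k. \<bar>v k\<bar> \<le> B"
  defines "g \<equiv> \<lambda>l. f (u l) - f (v l)"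
  shows "\<bar>Fh u k - Fh v k\<bar> \<le>
     (K / \<epsilon> + \<gamma> * (2 * SC * (K + 1) * K) + M * (area X * (K + 1) * K)) * \<bar>u k - v k\<bar>
     + \<gamma> * K * \<bar>invh g k\<bar> + M * K * (area X * \<bar>gs g / nn\<bar>)"
proof -
  let ?gu = "\<lambda>l. f (u l) - \<omega>" and ?gv = "\<lambda>l. f (v l) - \<omega>"
  have gu: "?gu \<in> gridfuns N" and gv: "?gv \<in> gridfuns N"
    using gridfuns_comp[OF u, of "\<lambda>x. f x - \<omega>"] gridfuns_comp[OF v, of "\<lambda>x. f x - \<omega>"] by auto
  have gvB: "\<bar>?gv l\<bar> \<le> K + 1" for l using f_bd[OF vB[of l]] om by linarith
  have I: "invh ?gu k = invh g k + invh ?gv k"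
    using inv_h_diff[OF gu gv, of k] by (simp add: g_def)
  have S: "inner_h X N ?gu (\<lambda>_. 1) = inner_h X N g (\<lambda>_. 1) + inner_h X N ?gv (\<lambda>_. 1)"
    by (simp add: g_def inner_h_def sum_subtractf algebra_simps)
  let ?d = "\<bar>u k - v k\<bar>"
  have a: "\<bar>1 / \<epsilon> * (deriv W (u k) - deriv W (v k))\<bar> \<le> K / \<epsilon> * ?d"
    using dW_lip[OF uB[of k] vB[of k]] eps by (simp add: abs_mult divide_right_mono)
  have b: "\<bar>invh g k * deriv f (u k)\<bar> \<le> \<bar>invh g k\<bar> * K"
    unfolding abs_mult by (intro mult_left_mono df_bd uB) auto
  have c: "\<bar>invh ?gv k * (deriv f (u k) - deriv f (v k))\<bar> \<le> SC * (2 * (K + 1)) * (K * ?d)"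
    unfolding abs_mult using SC_nonneg K
    by (intro mult_mono inv_h_sup[OF gv gvB] df_lip uB vB) auto
  have d: "\<bar>inner_h X N g (\<lambda>_. 1) * deriv f (u k)\<bar> \<le> area X * \<bar>gs g / nn\<bar> * K"
    unfolding abs_mult inner_h_one using area_pos
    by (intro mult_mono df_bd uB) auto
  have e: "\<bar>inner_h X N ?gv (\<lambda>_. 1) * (deriv f (u k) - deriv f (v k))\<bar> \<le> area X * (K + 1) * (K * ?d)"
  proof -
    have "\<bar>inner_h X N ?gv (\<lambda>_. 1)\<bar> \<le> area X * (K + 1)"
      using mult_left_mono[OF mean_abs_le[of ?gv, OF gvB], of "area X"] area_pos
      by (simp add: inner_h_one abs_mult)
    then show ?thesis unfolding abs_mult using K area_pos by (intro mult_mono df_lip uB vB) auto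
  qed
  have gb: "\<gamma> * \<bar>invh g k * deriv f (u k)\<bar> \<le> \<gamma> * (\<bar>invh g k\<bar> * K)"
    and gc: "\<gamma> * \<bar>invh ?gv k * (deriv f (u k) - deriv f (v k))\<bar> \<le> \<gamma> * (SC * (2 * (K + 1)) * (K * ?d))"
    and Md: "M * \<bar>inner_h X N g (\<lambda>_. 1) * deriv f (u k)\<bar> \<le> M * (area X * \<bar>gs g / nn\<bar> * K)"
    and Me: "M * \<bar>inner_h X N ?gv (\<lambda>_. 1) * (deriv f (u k) - deriv f (v k))\<bar> \<le> M * (area X * (K + 1) * (K * ?d))"
    using b c d e gam Mpos by (simp_all only: mult_left_mono less_imp_le)
  have eq: "Fh u k - Fh v k = - (1 / \<epsilon> * (deriv W (u k) - deriv W (v k)))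
     - \<gamma> * (invh g k * deriv f (u k)) - \<gamma> * (invh ?gv k * (deriv f (u k) - deriv f (v k)))
     - M * (inner_h X N g (\<lambda>_. 1) * deriv f (u k))
     - M * (inner_h X N ?gv (\<lambda>_. 1) * (deriv f (u k) - deriv f (v k)))"
    unfolding nonlin_h_def I S by (simp add: algebra_simps)
  have "\<bar>Fh u k - Fh v k\<bar> \<le> \<bar>1 / \<epsilon> * (deriv W (u k) - deriv W (v k))\<bar>
     + \<gamma> * \<bar>invh g k * deriv f (u k)\<bar> + \<gamma> * \<bar>invh ?gv k * (deriv f (u k) - deriv f (v k))\<bar>
     + M * \<bar>inner_h X N g (\<lambda>_. 1) * deriv f (u k)\<bar>
     + M * \<bar>inner_h X N ?gv (\<lambda>_. 1) * (deriv f (u k) - deriv f (v k))\<bar>"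
  proof -
    have "\<bar>- x - \<gamma> * y - \<gamma> * z - M * p - M * q\<bar> \<le> \<bar>x\<bar> + \<gamma> * \<bar>y\<bar> + \<gamma> * \<bar>z\<bar> + M * \<bar>p\<bar> + M * \<bar>q\<bar>" for x y z p q
    proof -
      have "\<bar>- x - y - z - p - q\<bar> \<le> \<bar>x\<bar> + \<bar>y\<bar> + \<bar>z\<bar> + \<bar>p\<bar> + \<bar>q\<bar>" for x y z p q :: real
        by linarith
      from this[of x "\<gamma> * y" "\<gamma> * z" "M * p" "M * q"] show ?thesis
        using gam Mpos by (simp only: abs_mult abs_of_pos)
    qed
    then show ?thesis unfolding eq .
  qed
  also have "\<dots> \<le> K / \<epsilon> * ?d + \<gamma> * (\<bar>invh g k\<bar> * K) + \<gamma> * (SC * (2 * (K + 1)) * (K * ?d))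
     + M * (area X * \<bar>gs g / nn\<bar> * K) + M * (area X * (K + 1) * (K * ?d))"
    by (intro add_mono a gb gc Md Me)
  also have "\<dots> = (K / \<epsilon> + \<gamma> * (2 * SC * (K + 1) * K) + M * (area X * (K + 1) * K)) * ?d
     + \<gamma> * K * \<bar>invh g k\<bar> + M * K * (area X * \<bar>gs g / nn\<bar>)"
  proof -
    have "x * d + \<gamma> * (p * K) + \<gamma> * (s * (2 * (K + 1)) * (K * d)) + M * (r * q * K) + M * (r * (K + 1) * (K * d))
       = (x + \<gamma> * (2 * s * (K + 1) * K) + M * (r * (K + 1) * K)) * d + \<gamma> * K * p + M * K * (r * q)"
      for x d p s r q :: real
      by (simp only: distrib_left distrib_right mult_ac add_ac)
    then show ?thesis .
  qed
  finally show ?thesis .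
qed

lemma nonlin_sup:
  assumes u: "u \<in> gridfuns N" and v: "v \<in> gridfuns N"
    and uB: "\<And>k. \<bar>u k\<bar> \<le> B" and vB: "\<And>k. \<bar>v k\<bar> \<le> B" and d: "\<And>k. \<bar>u k - v k\<bar> \<le> d"
  shows "\<bar>Fh u k - Fh v k\<bar> \<le> LC * d"
proof -
  let ?g = "\<lambda>l. f (u l) - f (v l)"
  have g: "?g \<in> gridfuns N" by (rule gridfuns_comp2[OF u v])
  have d0: "d \<ge> 0" using d[of 0] by linarith
  have gd: "\<bar>?g l\<bar> \<le> K * d" for l
    using f_lip[OF uB[of l] vB[of l]] mult_left_mono[OF d[of l] K] by linarith
  let ?c = "K / \<epsilon> + \<gamma> * (2 * SC * (K + 1) * K) + M * (area X * (K + 1) * K)"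
  have c: "?c \<ge> 0" using eps gam Mpos K SC_nonneg area_pos by simp
  have "\<bar>Fh u k - Fh v k\<bar> \<le> ?c * \<bar>u k - v k\<bar> + \<gamma> * K * \<bar>invh ?g k\<bar> + M * K * (area X * \<bar>gs ?g / nn\<bar>)"
    by (rule nonlin_pointwise[OF u v uB vB])
  also have "\<dots> \<le> ?c * d + \<gamma> * K * (SC * (2 * (K * d))) + M * K * (area X * (K * d))"
    using gam Mpos K c area_pos
    by (intro add_mono mult_left_mono d inv_h_sup[OF g gd] mean_abs_le[of ?g, OF gd]) auto
  also have "\<dots> = LC * d - \<gamma> * PC * K * K * d"
    by (simp add: lip_const_def algebra_simps)
  also have "\<dots> \<le> LC * d" using gam PC_pos K d0 by simp
  finally show ?thesis .
qed

lemma mean_le_L2: "sqrt nn * \<bar>gs g / nn\<bar> \<le> L2 g"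
proof -
  have "\<bar>gs g\<bar> \<le> gs (\<lambda>k. \<bar>1\<bar> * \<bar>g k\<bar>)" by (simp add: sum_abs)
  also have "\<dots> \<le> L2 (\<lambda>_. 1) * L2 g" by (rule L2_set_mult_ineq)
  finally have "\<bar>gs g\<bar> \<le> sqrt nn * L2 g" by (simp add: L2_const)
  then have "sqrt nn * \<bar>gs g\<bar> \<le> sqrt nn * (sqrt nn * L2 g)"
    by (rule mult_left_mono) simp
  also have "\<dots> = nn * L2 g" by (simp add: mult.assoc[symmetric])
  finally show ?thesis using nn_pos by (simp add: divide_le_eq mult.commute)
qed

lemma nonlin_L2:
  assumes u: "u \<in> gridfuns N" and v: "v \<in> gridfuns N"
    and uB: "\<And>k. \<bar>u k\<bar> \<le> B" and vB: "\<And>k. \<bar>v k\<bar> \<le> B"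
  shows "L2 (\<lambda>k. Fh u k - Fh v k) \<le> LC * L2 (\<lambda>k. u k - v k)"
proof -
  let ?g = "\<lambda>l. f (u l) - f (v l)"
  let ?d = "\<lambda>k. u k - v k"
  have g: "?g \<in> gridfuns N" by (rule gridfuns_comp2[OF u v])
  have abs: "L2 (\<lambda>k. \<bar>w k\<bar>) = L2 w" for w by (simp add: L2_set_def)
  have gL: "L2 ?g \<le> K * L2 ?d"
  proof -
    have "L2 ?g = L2 (\<lambda>k. \<bar>?g k\<bar>)" by (simp add: abs)
    also have "\<dots> \<le> L2 (\<lambda>k. K * \<bar>?d k\<bar>)"
      by (rule L2_set_mono) (use f_lip uB vB in auto)
    also have "\<dots> = K * L2 ?d" 
      by (subst L2_set_right_distrib[OF K, symmetric]) (simp only: abs)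
    finally show ?thesis .
  qed
  let ?c = "K / \<epsilon> + \<gamma> * (2 * SC * (K + 1) * K) + M * (area X * (K + 1) * K)"
  have c: "?c \<ge> 0" using eps gam Mpos K SC_nonneg area_pos by simp
  have "L2 (\<lambda>k. Fh u k - Fh v k) = L2 (\<lambda>k. \<bar>Fh u k - Fh v k\<bar>)" by (simp add: abs)
  also have "\<dots> \<le> L2 (\<lambda>k. (?c * \<bar>?d k\<bar> + \<gamma> * K * \<bar>invh ?g k\<bar>) + M * K * (area X * \<bar>gs ?g / nn\<bar>))"
    by (rule L2_set_mono) (use nonlin_pointwise[OF u v uB vB] in auto)
  also have "\<dots> \<le> (L2 (\<lambda>k. ?c * \<bar>?d k\<bar>) + L2 (\<lambda>k. \<gamma> * K * \<bar>invh ?g k\<bar>))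
      + L2 (\<lambda>k. M * K * (area X * \<bar>gs ?g / nn\<bar>))"
    by (rule order_trans[OF L2_set_triangle_ineq add_right_mono[OF L2_set_triangle_ineq]])
  also have "L2 (\<lambda>k. ?c * \<bar>?d k\<bar>) = ?c * L2 ?d"
    by (subst L2_set_right_distrib[OF c, symmetric]) (simp only: abs)
  also have "L2 (\<lambda>k. \<gamma> * K * \<bar>invh ?g k\<bar>) = \<gamma> * K * L2 (invh ?g)"
    by (subst L2_set_right_distrib[symmetric]) (use gam K in \<open>simp_all only: abs mult_nonneg_nonneg less_imp_le\<close>)
  also have "L2 (\<lambda>k. M * K * (area X * \<bar>gs ?g / nn\<bar>)) = M * K * area X * (sqrt nn * \<bar>gs ?g / nn\<bar>)"
    using Mpos K area_pos by (simp add: L2_const abs_mult)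
  also have "?c * L2 ?d + \<gamma> * K * L2 (invh ?g) + M * K * area X * (sqrt nn * \<bar>gs ?g / nn\<bar>)
      \<le> ?c * L2 ?d + \<gamma> * K * (PC * (K * L2 ?d)) + M * K * area X * (K * L2 ?d)"
  proof (intro add_mono mult_left_mono order_refl)
    show "L2 (invh ?g) \<le> PC * (K * L2 ?d)"
      using inv_h_L2_set[OF g] mult_left_mono[OF gL, of PC] PC_pos by linarith
    show "sqrt nn * \<bar>gs ?g / nn\<bar> \<le> K * L2 ?d" using mean_le_L2[of ?g] gL by linarith
  qed (use gam Mpos K area_pos c in auto)
  also have "\<dots> = LC * L2 ?d - \<gamma> * (2 * SC * K * K) * L2 ?d"
    by (simp add: lip_const_def algebra_simps)
  also have "\<dots> \<le> LC * L2 ?d" using gam SC_nonneg K by simp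
  finally show ?thesis .
qed

text \<open>Grid functions \<open>P n\<close> that satisfy the scheme up to a residual \<open>r\<close> stay close to the numerical solution.\<close>

lemma discrete_convergence:
  assumes pos: "\<tau> > 0" "\<kappa> > 0" and B1: "B \<ge> 1"
    and P: "\<And>n. n \<le> Nt \<Longrightarrow> P n \<in> gridfuns N" and PB: "\<And>n k. n \<le> Nt \<Longrightarrow> \<bar>P n k\<bar> \<le> B"
    and P01: "\<And>k. P 0 k \<in> {0..1}" and init: "\<Phi> 0 = P 0"
    and \<Phi>: "\<And>n. n \<in> {1..Nt} \<Longrightarrow> \<Phi> n \<in> gridfuns N"
    and scheme: "\<And>n. n < Nt \<Longrightarrow> scheme_step X N \<tau> \<kappa> \<epsilon> \<gamma> M \<omega> (\<Phi> n) (\<Phi> (Suc n))"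
    and stab: "stabilizing X N \<kappa> \<epsilon> \<gamma> M \<omega>"
    and resid: "\<And>n k. n < Nt \<Longrightarrow>
      \<bar>(1 / \<tau> + \<kappa> / \<epsilon>) * (P (Suc n) k - P n k) - \<epsilon> * Lh (P (Suc n)) k - Fh (P n) k\<bar> \<le> r"
    and n: "n \<le> Nt"
  shows "norm_L2_h X N (\<lambda>k. P n k - \<Phi> n k) \<le> sqrt (area X) * (real n * \<tau> * exp (LC * (real n * \<tau>)) * r)"
proof (cases "Nt = 0")
  case True
  then show ?thesis using n init by (simp add: norm_L2_h_def inner_h_def)
next
  case False
  then have r0: "r \<ge> 0" using resid[of 0 0] by linarith
  have \<Phi>_per: "\<Phi> n \<in> gridfuns N" if "n \<le> Nt" for n
    using \<Phi>[of n] P[of 0] init that by (cases "n = 0") auto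
  have \<Phi>01: "\<Phi> n k \<in> {0..1}" if "n \<le> Nt" for n k
    using that
  proof (induction n arbitrary: k)
    case 0 then show ?case using P01 init by simp
  next
    case (Suc n)
    then show ?case
      using scheme_bounds[OF scheme[of n] \<Phi>_per \<Phi>_per stab pos eps gam Mpos om] by simp
  qed
  have \<Phi>B: "\<bar>\<Phi> n k\<bar> \<le> B" if "n \<le> Nt" for n k using \<Phi>01[OF that, of k] B1 by auto
  define E where "E n = L2 (\<lambda>k. P n k - \<Phi> n k)" for n
  define \<rho> where "\<rho> = sqrt nn * r"
  define a where "a = 1 / \<tau> + \<kappa> / \<epsilon>"
  have a: "a > 0" "1 / a \<le> \<tau>"
  proof -
    show "a > 0" using pos eps by (simp add: a_def add_pos_pos)
    have "1 / \<tau> \<le> a" using pos eps by (simp add: a_def)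
    then show "1 / a \<le> \<tau>" using pos \<open>a > 0\<close> by (simp add: field_simps)
  qed
  have step: "E (Suc n) \<le> E n + \<tau> * (LC * E n + \<rho>)" if n: "n < Nt" for n
  proof -
    let ?b = "\<lambda>k. (Fh (P n) k - Fh (\<Phi> n) k)
       + (a * (P (Suc n) k - P n k) - \<epsilon> * Lh (P (Suc n)) k - Fh (P n) k)"
    have "a * L2 (\<lambda>k. P (Suc n) k - \<Phi> (Suc n) k) \<le> a * L2 (\<lambda>k. P n k - \<Phi> n k) + L2 ?b"
    proof (rule step_stability[OF _ a(1)])
      show "(\<lambda>k. P (Suc n) k - \<Phi> (Suc n) k) \<in> gridfuns N"
        using n by (intro gridfuns_comp2[OF P \<Phi>_per]) auto
      show "0 \<le> \<epsilon>" using eps by simp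
      fix k
      have s: "a * (\<Phi> (Suc n) k - \<Phi> n k) = \<epsilon> * Lh (\<Phi> (Suc n)) k + Fh (\<Phi> n) k"
        using scheme[OF n, unfolded scheme_step_def, rule_format, of k]
        by (simp add: a_def nonlin_h_def)
      have l: "Lh (\<lambda>k. P (Suc n) k - \<Phi> (Suc n) k) k = Lh (P (Suc n)) k - Lh (\<Phi> (Suc n)) k"
        using laplacian_h_lin[of 1 "P (Suc n)" "-1" "\<Phi> (Suc n)" k] by simp
      show "a * (P (Suc n) k - \<Phi> (Suc n) k - (P n k - \<Phi> n k)) =
         \<epsilon> * Lh (\<lambda>k. P (Suc n) k - \<Phi> (Suc n) k) k + ?b k"
        unfolding l using s by (simp add: algebra_simps)
    qed
    moreover have "L2 ?b \<le> LC * E n + \<rho>"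
    proof -
      have "L2 ?b \<le> L2 (\<lambda>k. Fh (P n) k - Fh (\<Phi> n) k)
         + L2 (\<lambda>k. a * (P (Suc n) k - P n k) - \<epsilon> * Lh (P (Suc n)) k - Fh (P n) k)"
        by (rule L2_set_triangle_ineq)
      also have "\<dots> \<le> LC * L2 (\<lambda>k. P n k - \<Phi> n k) + sqrt nn * r"
        using n by (intro add_mono nonlin_L2 L2_sup_le P PB \<Phi>_per \<Phi>B resid[OF n, folded a_def]) auto
      finally show ?thesis by (simp add: E_def \<rho>_def)
    qed
    ultimately have "a * E (Suc n) \<le> a * E n + (LC * E n + \<rho>)" unfolding E_def by linarith
    then have "E (Suc n) \<le> E n + 1 / a * (LC * E n + \<rho>)" using a by (simp add: field_simps)
    also have "1 / a * (LC * E n + \<rho>) \<le> \<tau> * (LC * E n + \<rho>)"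
      using a(2) LC_nonneg r0 nn_pos by (intro mult_right_mono add_nonneg_nonneg) (auto simp: E_def \<rho>_def)
    finally show ?thesis by simp
  qed
  have \<rho>0: "\<rho> \<ge> 0" using r0 by (simp add: \<rho>_def)
  have tL: "\<tau> * LC \<ge> 0" using pos LC_nonneg by simp
  have E: "E n \<le> real n * \<tau> * \<rho> * (1 + \<tau> * LC) ^ n" if "n \<le> Nt" for n
    using that
  proof (induction n)
    case 0 then show ?case by (simp add: E_def init L2_set_def)
  next
    case (Suc n)
    have "E (Suc n) \<le> (1 + \<tau> * LC) * E n + \<tau> * \<rho>" using step[of n] Suc by (simp add: algebra_simps)
    also have "\<dots> \<le> (1 + \<tau> * LC) * (real n * \<tau> * \<rho> * (1 + \<tau> * LC) ^ n) + \<tau> * \<rho> * (1 + \<tau> * LC) ^ Suc n"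
    proof (intro add_mono mult_left_mono)
      show "E n \<le> real n * \<tau> * \<rho> * (1 + \<tau> * LC) ^ n" using Suc by simp
      have "1 \<le> (1 + \<tau> * LC) ^ Suc n" using tL by (intro one_le_power) simp
      then show "\<tau> * \<rho> \<le> \<tau> * \<rho> * (1 + \<tau> * LC) ^ Suc n"
        using pos \<rho>0 mult_left_mono[of 1 "(1 + \<tau> * LC) ^ Suc n" "\<tau> * \<rho>"] by simp
    qed (use tL in auto)
    also have "\<dots> = real (Suc n) * \<tau> * \<rho> * (1 + \<tau> * LC) ^ Suc n" by (simp add: algebra_simps)
    finally show ?case .
  qed
  have "(1 + \<tau> * LC) ^ n \<le> exp (\<tau> * LC) ^ n"
    using tL exp_ge_add_one_self[of "\<tau> * LC"] by (intro power_mono) auto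
  also have "\<dots> = exp (LC * (real n * \<tau>))" by (simp add: exp_of_nat_mult[symmetric] mult_ac)
  finally have ex: "(1 + \<tau> * LC) ^ n \<le> exp (LC * (real n * \<tau>))" .
  have "E n \<le> real n * \<tau> * \<rho> * exp (LC * (real n * \<tau>))"
    using E[OF n] mult_left_mono[OF ex, of "real n * \<tau> * \<rho>"] pos \<rho>0 by simp
  then have "sqrt (h1 X N * h2 X N) * E n \<le> sqrt (h1 X N * h2 X N) * (real n * \<tau> * \<rho> * exp (LC * (real n * \<tau>)))"
    by (rule mult_left_mono) (use h1_pos h2_pos in auto)
  also have "\<dots> = sqrt (h1 X N * h2 X N * nn) * (real n * \<tau> * exp (LC * (real n * \<tau>)) * r)"
    by (simp add: \<rho>_def real_sqrt_mult)
  finally show ?thesis unfolding norm_L2_h_eq E_def hh_nn .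
qed

end

section \<open>Partial derivatives\<close>

text \<open>The partial derivative in the direction \<open>e\<close>. For the two unit vectors, collected in \<open>dirs\<close>, it is \<open>pd1\<close>
and \<open>pd2\<close>; the common notation allows both to be treated at once.\<close>

definition pd :: "real \<times> real \<Rightarrow> (real \<times> real \<Rightarrow> real) \<Rightarrow> real \<times> real \<Rightarrow> real" where
  "pd e u p = deriv (\<lambda>s. u (p + s *\<^sub>R e)) 0"

definition dirs :: "(real \<times> real) set" where "dirs = {(1, 0), (0, 1)}"

lemma deriv_shift: "deriv (\<lambda>s. F (x + s)) 0 = deriv F (x::real)"
  unfolding deriv_def using DERIV_shift[of F _ 0 x] by (simp add: add.commute)

lemma pd1_eq: "pd1 u = pd (1, 0) u"
  by (rule ext) (auto simp: pd1_def pd_def deriv_shift[of "\<lambda>s. u (s, _)"])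

lemma pd2_eq: "pd2 u = pd (0, 1) u"
  by (rule ext) (auto simp: pd2_def pd_def deriv_shift[of "\<lambda>s. u (_, s)"])

lemma differentiable_shift:
  "(\<lambda>s. F (x + s)) differentiable (at (0::real)) \<longleftrightarrow> F differentiable (at (x::real))" for F :: "real \<Rightarrow> real"
  unfolding real_differentiable_def using DERIV_shift[of F _ 0 x] by (simp add: add.commute)

lemma Ck_Suc_dirs:
  "Ck (Suc k) u \<longleftrightarrow> (\<forall>e\<in>dirs. (\<forall>p. (\<lambda>s. u (p + s *\<^sub>R e)) differentiable (at 0)) \<and> Ck k (pd e u))"
proof -
  have "(\<lambda>s. u ((x, y) + s *\<^sub>R (1, 0))) differentiable (at 0) \<longleftrightarrow> (\<lambda>s. u (s, y)) differentiable (at x)" for x y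
    using differentiable_shift[of "\<lambda>s. u (s, y)" x] by simp
  moreover have "(\<lambda>s. u ((x, y) + s *\<^sub>R (0, 1))) differentiable (at 0) \<longleftrightarrow> (\<lambda>s. u (x, s)) differentiable (at y)" for x y
    using differentiable_shift[of "\<lambda>s. u (x, s)" y] by simp
  ultimately show ?thesis by (auto simp: dirs_def pd1_eq pd2_eq split_paired_all simp del: add_Pair scaleR_Pair)
qed

declare Ck.simps(2) [simp del]

lemma Ck_pd: "Ck (Suc k) u \<Longrightarrow> e \<in> dirs \<Longrightarrow> Ck k (pd e u)"
  by (simp add: Ck_Suc_dirs)

lemma Ck_DERIV:
  assumes "Ck (Suc k) u" "e \<in> dirs"
  shows "((\<lambda>s. u (p + s *\<^sub>R e)) has_real_derivative pd e u (p + s *\<^sub>R e)) (at s)"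
proof -
  let ?q = "p + s *\<^sub>R e"
  have "(\<lambda>r. u (?q + r *\<^sub>R e)) differentiable (at 0)" using assms unfolding Ck_Suc_dirs by blast
  then have "((\<lambda>r. u (?q + r *\<^sub>R e)) has_real_derivative pd e u ?q) (at 0)"
    unfolding pd_def real_differentiable_def by (auto simp del: add_Pair dest: DERIV_imp_deriv)
  moreover have "(\<lambda>r. u (?q + r *\<^sub>R e)) = (\<lambda>r. u (p + (r + s) *\<^sub>R e))"
    by (simp add: algebra_simps)
  ultimately show ?thesis
    using DERIV_shift[of "\<lambda>s. u (p + s *\<^sub>R e)" "pd e u ?q" 0 s] by simp
qed

lemma Ck_SucI:
  assumes "\<And>e p. e \<in> dirs \<Longrightarrow> ((\<lambda>s. u (p + s *\<^sub>R e)) has_real_derivative v e p) (at 0)"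
    and "\<And>e. e \<in> dirs \<Longrightarrow> Ck k (v e)"
  shows "Ck (Suc k) u" "\<And>e. e \<in> dirs \<Longrightarrow> pd e u = v e"
proof -
  show eq: "pd e u = v e" if "e \<in> dirs" for e
    by (rule ext) (simp add: pd_def DERIV_imp_deriv[OF assms(1)[OF that]])
  show "Ck (Suc k) u"
    unfolding Ck_Suc_dirs real_differentiable_def
  proof (intro ballI conjI allI)
    fix e assume e: "e \<in> dirs"
    show "\<exists>D. ((\<lambda>s. u (p + s *\<^sub>R e)) has_real_derivative D) (at 0)" for p
      using assms(1)[OF e] by blast
    show "Ck k (pd e u)" using eq assms(2) e by simp
  qed
qed

lemma pd_eqI:
  "(\<And>p. ((\<lambda>s. u (p + s *\<^sub>R e)) has_real_derivative v p) (at 0)) \<Longrightarrow> pd e u = v"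
  by (rule ext) (simp add: pd_def DERIV_imp_deriv)

lemma Ck_DERIV0:
  assumes "Ck (Suc k) u" "e \<in> dirs"
  shows "((\<lambda>s. u (p + s *\<^sub>R e)) has_real_derivative pd e u p) (at 0)"
  using Ck_DERIV[OF assms, of p 0] by simp

text \<open>Continuous partial derivatives give total differentiability.\<close>

lemma Ck1_continuous:
  assumes u: "Ck (Suc 0) u"
  shows "continuous_on UNIV u"
proof -
  have "(u has_derivative (\<lambda>(tx, ty). tx * pd (1, 0) u p + ty * pd (0, 1) u p)) (at p)" for p
  proof (cases p)
    case (Pair x y)
    have "((\<lambda>(x, y). u (x, y)) has_derivative (\<lambda>(tx, ty). tx * pd (1, 0) u (x, y) + blinfun_scaleR_left (pd (0, 1) u (x, y)) ty)) (at (x, y) within UNIV \<times> UNIV)"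
    proof (rule has_derivative_partialsI)
      show "((\<lambda>x. u (x, y)) has_derivative (\<lambda>tx. tx * pd (1, 0) u (x, y))) (at x within UNIV)"
        using Ck_DERIV[OF u, of "(1, 0)" "(0, y)" x]
        by (simp add: dirs_def has_field_derivative_def mult.commute[of "pd _ _ _"] mult_commute_abs)
      show "((\<lambda>y. u (x', y)) has_derivative blinfun_apply (blinfun_scaleR_left (pd (0, 1) u (x', y')))) (at y' within UNIV)"
        for x' y'
        using Ck_DERIV[OF u, of "(0, 1)" "(x', 0)" y']
        by (simp add: dirs_def has_field_derivative_def mult.commute[of "pd _ _ _"] mult_commute_abs)
      have "continuous_on UNIV (\<lambda>p. blinfun_scaleR_left (pd (0, 1) u p))"
        using Ck_pd[OF u, of "(0, 1)"] by (intro continuous_intros) (auto simp: dirs_def)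
      then show "continuous (at (x, y) within UNIV \<times> UNIV) (\<lambda>(x, y). blinfun_scaleR_left (pd (0, 1) u (x, y)))"
        by (simp add: continuous_on_eq_continuous_at split_def)
    qed auto
    then show ?thesis by (simp add: Pair)
  qed
  then show ?thesis
    by (meson continuous_at_imp_continuous_on has_derivative_continuous)
qed

lemma Ck_SucD: "Ck (Suc k) u \<Longrightarrow> Ck k u"
proof (induction k arbitrary: u)
  case 0 then show ?case using Ck1_continuous by simp
next
  case (Suc k)
  then show ?case unfolding Ck_Suc_dirs[of "Suc k"] Ck_Suc_dirs[of k u] by blast
qed

lemma Ck_mono: "j \<le> k \<Longrightarrow> Ck k u \<Longrightarrow> Ck j u"
  by (induction k arbitrary: j) (auto simp: le_Suc_eq dest: Ck_SucD)

lemma Ck_continuous: "Ck k u \<Longrightarrow> continuous_on S u"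
  using Ck_mono[of 0 k u] by (auto intro: continuous_on_subset)

lemma Ck_const: "Ck k (\<lambda>_. c)"
proof (induction k arbitrary: c)
  case (Suc k)
  show ?case by (rule Ck_SucI(1)[where v = "\<lambda>_ _. 0"]) (auto intro!: derivative_eq_intros Suc)
qed simp

lemma pd_add: "Ck (Suc k) u \<Longrightarrow> Ck (Suc k) v \<Longrightarrow> e \<in> dirs \<Longrightarrow>
    pd e (\<lambda>p. u p + v p) = (\<lambda>p. pd e u p + pd e v p)"
  by (rule pd_eqI, rule DERIV_add; rule Ck_DERIV0)

lemma Ck_add: "Ck k u \<Longrightarrow> Ck k v \<Longrightarrow> Ck k (\<lambda>p. u p + v p)"
proof (induction k arbitrary: u v)
  case 0 then show ?case by (auto intro: continuous_intros)
next
  case (Suc k)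
  show ?case
    by (rule Ck_SucI(1)[where v = "\<lambda>e p. pd e u p + pd e v p"])
      (use Suc in \<open>auto intro!: DERIV_add Ck_DERIV0 Ck_pd\<close>)
qed

lemma pd_mult:
  assumes "Ck (Suc k) u" "Ck (Suc k) v" "e \<in> dirs"
  shows "pd e (\<lambda>p. u p * v p) = (\<lambda>p. pd e u p * v p + pd e v p * u p)"
proof (rule pd_eqI)
  fix p
  show "((\<lambda>s. u (p + s *\<^sub>R e) * v (p + s *\<^sub>R e)) has_real_derivative pd e u p * v p + pd e v p * u p) (at 0)"
    using DERIV_mult[OF Ck_DERIV0[OF assms(1,3), of p] Ck_DERIV0[OF assms(2,3), of p]] by simp
qed

lemma Ck_mult: "Ck k u \<Longrightarrow> Ck k v \<Longrightarrow> Ck k (\<lambda>p. u p * v p)"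
proof (induction k arbitrary: u v)
  case 0 then show ?case by (auto intro: continuous_intros)
next
  case (Suc k)
  show ?case
  proof (rule Ck_SucI(1)[where v = "\<lambda>e p. pd e u p * v p + pd e v p * u p"])
    fix e p assume "e \<in> dirs"
    then show "((\<lambda>s. u (p + s *\<^sub>R e) * v (p + s *\<^sub>R e)) has_real_derivative pd e u p * v p + pd e v p * u p) (at 0)"
      using DERIV_mult[OF Ck_DERIV0[OF Suc.prems(1), of e p] Ck_DERIV0[OF Suc.prems(2), of e p]] by simp
  next
    fix e assume e: "e \<in> dirs"
    show "Ck k (\<lambda>p. pd e u p * v p + pd e v p * u p)"
      by (intro Ck_add Suc.IH Ck_pd[OF _ e] Suc.prems Ck_SucD[OF Suc.prems(1)] Ck_SucD[OF Suc.prems(2)])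
  qed
qed

lemma Ck_cmult: "Ck k u \<Longrightarrow> Ck k (\<lambda>p. c * u p)"
  by (rule Ck_mult[OF Ck_const])

lemma pd_cmult: "Ck (Suc k) u \<Longrightarrow> e \<in> dirs \<Longrightarrow> pd e (\<lambda>p. c * u p) = (\<lambda>p. c * pd e u p)"
  by (rule pd_eqI, rule DERIV_cmult, rule Ck_DERIV0)

lemma Ck_diff: "Ck k u \<Longrightarrow> Ck k v \<Longrightarrow> Ck k (\<lambda>p. u p - v p)"
  using Ck_add[OF _ Ck_cmult[of k v "-1"], of u] by simp

lemma pd_diff: "Ck (Suc k) u \<Longrightarrow> Ck (Suc k) v \<Longrightarrow> e \<in> dirs \<Longrightarrow>
    pd e (\<lambda>p. u p - v p) = (\<lambda>p. pd e u p - pd e v p)"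
  by (rule pd_eqI, rule DERIV_diff; rule Ck_DERIV0)

lemma pd_const: "pd e (\<lambda>_. c) = (\<lambda>_. 0)"
  by (rule pd_eqI) simp

lemma pd_diff_const: "Ck (Suc k) u \<Longrightarrow> e \<in> dirs \<Longrightarrow> pd e (\<lambda>p. u p - c) = pd e u"
  using pd_diff[of k u "\<lambda>_. c" e] Ck_const[of "Suc k" c] by (simp add: pd_const)

lemma pd_shift: "pd e (\<lambda>p. u (p + q)) = (\<lambda>p. pd e u (p + q))"
  by (rule ext) (simp add: pd_def add.assoc add.commute add.left_commute)

lemma Ck_shift: "Ck k u \<Longrightarrow> Ck k (\<lambda>p. u (p + q))"
proof (induction k arbitrary: u)
  case 0
  then show ?case by (auto intro!: continuous_on_compose2[of UNIV u UNIV] continuous_intros)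
next
  case (Suc k)
  show ?case
  proof (rule Ck_SucI(1)[where v = "\<lambda>e p. pd e u (p + q)"])
    fix e p assume "e \<in> dirs"
    then show "((\<lambda>s. u (p + s *\<^sub>R e + q)) has_real_derivative pd e u (p + q)) (at 0)"
      using Ck_DERIV0[OF Suc.prems, of e "p + q"] by (simp add: add.assoc add.commute add.left_commute)
  qed (use Suc in \<open>auto intro: Ck_pd\<close>)
qed

lemma Ck_sum: "finite A \<Longrightarrow> (\<And>i. i \<in> A \<Longrightarrow> Ck k (u i)) \<Longrightarrow> Ck k (\<lambda>p. \<Sum>i\<in>A. u i p)"
  by (induction A rule: finite_induct) (auto intro: Ck_const Ck_add)

lemma pd_sum:
  assumes "\<And>i. i \<in> A \<Longrightarrow> Ck (Suc k) (u i)" "e \<in> dirs"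
  shows "pd e (\<lambda>p. \<Sum>i\<in>A. u i p) = (\<lambda>p. \<Sum>i\<in>A. pd e (u i) p)"
proof (rule pd_eqI)
  fix p
  show "((\<lambda>s. \<Sum>i\<in>A. u i (p + s *\<^sub>R e)) has_real_derivative (\<Sum>i\<in>A. pd e (u i) p)) (at 0)"
    by (rule DERIV_sum) (rule Ck_DERIV0[OF assms])
qed

lemma Ck_pd_pow: "Ck (k + j) u \<Longrightarrow> e \<in> dirs \<Longrightarrow> Ck k ((pd e ^^ j) u)"
proof (induction j arbitrary: k)
  case (Suc j)
  then have "Ck (Suc k) ((pd e ^^ j) u)" by simp
  then show ?case using Suc Ck_pd by simp
qed simp

section \<open>Periodic functions\<close>

lemma periodic_shift:
  assumes "periodic X u"
  shows "u (p + (2 * of_int m1 * fst X, 2 * of_int m2 * snd X)) = u p"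
proof -
  have p1: "u (x + 2 * fst X, y) = u (x, y)" and p2: "u (x, y + 2 * snd X) = u (x, y)" for x y
    using assms unfolding periodic_def by blast+
  have 1: "u (x + 2 * of_int m * fst X, y) = u (x, y)" for x y and m :: int
  proof (induction m arbitrary: x rule: int_induct[of _ 0])
    case (step1 i)
    have eq: "x + 2 * of_int (i + 1) * fst X = (x + 2 * of_int i * fst X) + 2 * fst X" by (simp add: algebra_simps)
    show ?case unfolding eq p1 by (rule step1)
  next
    case (step2 i)
    have eq: "x + 2 * of_int i * fst X = (x + 2 * of_int (i - 1) * fst X) + 2 * fst X" by (simp add: algebra_simps)
    show ?case using step2(2)[of x] unfolding eq p1 .
  qed simp
  have 2: "u (x, y + 2 * of_int m * snd X) = u (x, y)" for x y and m :: int
  proof (induction m arbitrary: y rule: int_induct[of _ 0])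
    case (step1 i)
    have eq: "y + 2 * of_int (i + 1) * snd X = (y + 2 * of_int i * snd X) + 2 * snd X" by (simp add: algebra_simps)
    show ?case unfolding eq p2 by (rule step1)
  next
    case (step2 i)
    have eq: "y + 2 * of_int i * snd X = (y + 2 * of_int (i - 1) * snd X) + 2 * snd X" by (simp add: algebra_simps)
    show ?case using step2(2)[of y] unfolding eq p2 .
  qed simp
  show ?thesis by (cases p) (simp add: 1 2)
qed

lemma torus_eq: "torus X = cbox (- fst X, - snd X) (fst X, snd X)"
  by (cases X) (simp add: torus_def)

lemma torus_iff:
  "q \<in> torus X \<longleftrightarrow> - fst X \<le> fst q \<and> fst q \<le> fst X \<and> - snd X \<le> snd q \<and> snd q \<le> snd X"
  by (cases X; cases q) (auto simp: torus_def)

lemma real_mod_interval: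
  assumes "L > (0::real)"
  obtains m :: int where "- L \<le> x + 2 * of_int m * L" "x + 2 * of_int m * L < L"
proof -
  define m where "m = \<lfloor>(x + L) / (2 * L)\<rfloor>"
  have "of_int m \<le> (x + L) / (2 * L)" "(x + L) / (2 * L) < of_int m + 1"
    by (auto simp: m_def)
  then have "of_int m * (2 * L) \<le> x + L" "x + L < (of_int m + 1) * (2 * L)"
    using assms by (auto simp: le_divide_eq divide_less_eq)
  then show ?thesis by (intro that[of "- m"]) (auto simp: algebra_simps)
qed

text \<open>Every point is congruent to a point of the closed box.\<close>

lemma torus_rep:
  assumes "fst X > 0" "snd X > 0"
  obtains q where "q \<in> torus X" "\<And>u. periodic X u \<Longrightarrow> u q = u p"
proof -
  obtain m1 where m1: "- fst X \<le> fst p + 2 * of_int m1 * fst X" "fst p + 2 * of_int m1 * fst X < fst X"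
    using real_mod_interval[OF assms(1)] by blast
  obtain m2 where m2: "- snd X \<le> snd p + 2 * of_int m2 * snd X" "snd p + 2 * of_int m2 * snd X < snd X"
    using real_mod_interval[OF assms(2)] by blast
  let ?q = "p + (2 * of_int m1 * fst X, 2 * of_int m2 * snd X)"
  have "?q \<in> torus X" using m1 m2 by (cases p) (simp add: torus_iff)
  moreover have "u ?q = u p" if "periodic X u" for u by (rule periodic_shift[OF that])
  ultimately show ?thesis using that by blast
qed

lemma periodic_alt:
  "periodic X u \<longleftrightarrow> (\<forall>p. u (p + (2 * fst X, 0)) = u p \<and> u (p + (0, 2 * snd X)) = u p)"
  by (auto simp: periodic_def)

lemma periodic_pd: "periodic X u \<Longrightarrow> periodic X (pd e u)"
proof -
  assume "periodic X u"
  then have "(\<lambda>p. u (p + (2 * fst X, 0))) = u" "(\<lambda>p. u (p + (0, 2 * snd X))) = u"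
    by (auto simp: periodic_alt fun_eq_iff)
  then show ?thesis
    unfolding periodic_alt
    using fun_cong[OF pd_shift[of e u "(2 * fst X, 0)"]] fun_cong[OF pd_shift[of e u "(0, 2 * snd X)"]]
    by metis
qed

lemma periodic_pd_pow: "periodic X u \<Longrightarrow> periodic X ((pd e ^^ j) u)"
  by (induction j) (auto simp: periodic_pd)

lemma periodic_comp: "periodic X u \<Longrightarrow> periodic X (\<lambda>p. F (u p))"
  by (simp add: periodic_def)

lemma periodic_comp2: "periodic X u \<Longrightarrow> periodic X v \<Longrightarrow> periodic X (\<lambda>p. F (u p) (v p))"
  by (simp add: periodic_def)

lemma periodic_bounded:
  assumes "fst X > 0" "snd X > 0" "periodic X u" "continuous_on UNIV u"
  obtains B where "\<And>p. \<bar>u p\<bar> \<le> B"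
proof -
  have "compact (u ` torus X)"
    unfolding torus_def by (intro compact_continuous_image continuous_on_subset[OF assms(4)]) auto
  then have "bounded (u ` torus X)" by (rule compact_imp_bounded)
  then obtain B where B: "\<And>q. q \<in> torus X \<Longrightarrow> \<bar>u q\<bar> \<le> B"
    by (auto simp: bounded_iff)
  have "\<bar>u p\<bar> \<le> B" for p
    using torus_rep[OF assms(1,2), of p] B assms(3) by metis
  then show ?thesis using that by blast
qed

section \<open>Taylor estimates\<close>

lemma pd_lipschitz:
  assumes u: "Ck (Suc 0) u" and e: "e \<in> dirs" and K: "\<And>p. \<bar>pd e u p\<bar> \<le> K"
  shows "\<bar>u (p + t *\<^sub>R e) - u p\<bar> \<le> K * \<bar>t\<bar>"
proof -
  have "norm (u (p + t *\<^sub>R e) - u (p + 0 *\<^sub>R e)) \<le> K * norm (t - 0)"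
    by (rule field_differentiable_bound[of UNIV _ "\<lambda>s. pd e u (p + s *\<^sub>R e)"])
      (use Ck_DERIV[OF u e] K in auto)
  then show ?thesis by simp
qed

lemma first_difference:
  assumes u: "Ck 2 u" and e: "e \<in> dirs" and K: "\<And>p. \<bar>pd e (pd e u) p\<bar> \<le> K" and h: "h > 0"
  shows "\<bar>u (p + h *\<^sub>R e) - u p - h * pd e u p\<bar> \<le> K * h\<^sup>2 / 2"
proof -
  define D where "D m s = (pd e ^^ m) u (p + s *\<^sub>R e)" for m s
  have "\<exists>t::real. 0 < t \<and> t < h \<and>
    u (p + h *\<^sub>R e) = (\<Sum>m<2. (D m 0 / fact m) * (h - 0)^m) + (D 2 t / fact 2) * (h - 0)^2"
  proof (rule Taylor_up[of 2 D "\<lambda>s. u (p + s *\<^sub>R e)" 0 h 0])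
    show "\<forall>m t. m < 2 \<and> 0 \<le> t \<and> t \<le> h \<longrightarrow> DERIV (D m) t :> D (Suc m) t"
    proof (intro allI impI)
      fix m t assume "m < (2::nat) \<and> 0 \<le> t \<and> t \<le> h"
      then have "Ck (Suc 0) ((pd e ^^ m) u)"
        by (intro Ck_pd_pow[OF _ e] Ck_mono[OF _ u]) auto
      then show "DERIV (D m) t :> D (Suc m) t"
        unfolding D_def using Ck_DERIV[OF _ e] by simp
    qed
  qed (use h in \<open>auto simp: D_def\<close>)
  then obtain t where "u (p + h *\<^sub>R e) = u p + pd e u p * h + D 2 t / 2 * h\<^sup>2"
    by (auto simp: D_def numeral_2_eq_2)
  then have "\<bar>u (p + h *\<^sub>R e) - u p - h * pd e u p\<bar> = \<bar>D 2 t\<bar> * h\<^sup>2 / 2" by (simp add: abs_mult)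
  also have "\<dots> \<le> K * h\<^sup>2 / 2"
    using K[of "p + t *\<^sub>R e"] by (intro divide_right_mono mult_right_mono) (auto simp: D_def numeral_2_eq_2)
  finally show ?thesis .
qed

text \<open>If a function is small and its second derivative is bounded, then the first derivative is small: choose
\<open>h\<close> of the order of the square root of \<open>d\<close>.\<close>

lemma pd_interpolation:
  assumes u: "Ck 2 u" and e: "e \<in> dirs" and K: "\<And>p. \<bar>pd e (pd e u) p\<bar> \<le> K" and h: "h > 0"
    and d: "\<And>p. \<bar>u p\<bar> \<le> d"
  shows "\<bar>pd e u p\<bar> \<le> 2 * d / h + K * h / 2"
proof -
  have "\<bar>h * pd e u p\<bar> \<le> 2 * d + K * h\<^sup>2 / 2"
    using first_difference[OF u e K h, of p] d[of p] d[of "p + h *\<^sub>R e"] by linarith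
  then have "h * \<bar>pd e u p\<bar> \<le> h * (2 * d / h + K * h / 2)"
    using h by (simp add: abs_mult algebra_simps power2_eq_square)
  then show ?thesis using h by simp
qed

lemma second_difference:
  assumes u: "Ck 4 u" and e: "e \<in> dirs" and K: "\<And>p. \<bar>(pd e ^^ 4) u p\<bar> \<le> K" and h: "h > 0"
  shows "\<bar>(u (p - h *\<^sub>R e) - 2 * u p + u (p + h *\<^sub>R e)) / h\<^sup>2 - pd e (pd e u) p\<bar> \<le> K * h\<^sup>2"
proof -
  define D where "D m s = (pd e ^^ m) u (p + s *\<^sub>R e)" for m s
  have der: "\<forall>m t. m < 4 \<and> -h \<le> t \<and> t \<le> h \<longrightarrow> DERIV (D m) t :> D (Suc m) t"
  proof (intro allI impI)
    fix m t assume "m < (4::nat) \<and> -h \<le> t \<and> t \<le> h"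
    then have "Ck (Suc 0) ((pd e ^^ m) u)"
      by (intro Ck_pd_pow[OF _ e] Ck_mono[OF _ u]) auto
    then show "DERIV (D m) t :> D (Suc m) t"
      unfolding D_def using Ck_DERIV[OF _ e] by simp
  qed
  have DK: "\<bar>D 4 t\<bar> \<le> K" for t using K by (simp add: D_def)
  have D0: "D 0 = (\<lambda>s. u (p + s *\<^sub>R e))" by (rule ext) (simp add: D_def)
  obtain t where t: "u (p + h *\<^sub>R e) = (\<Sum>m<4. (D m 0 / fact m) * (h - 0)^m) + (D 4 t / fact 4) * (h - 0)^4"
    using Taylor_up[OF _ D0 der, of 0] h by auto
  obtain s where s: "u (p + (-h) *\<^sub>R e) = (\<Sum>m<4. (D m 0 / fact m) * (-h - 0)^m) + (D 4 s / fact 4) * (-h - 0)^4"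
    using Taylor_down[OF _ D0 der, of 0] h by auto
  have D2: "D 2 0 = pd e (pd e u) p" by (simp add: D_def numeral_2_eq_2)
  have "u (p + h *\<^sub>R e) + u (p + (-h) *\<^sub>R e) = 2 * u p + pd e (pd e u) p * h\<^sup>2 + (D 4 t + D 4 s) / 24 * h ^ 4"
    unfolding t s D2[symmetric] by (simp add: eval_nat_numeral D0 algebra_simps)
  then have "(u (p - h *\<^sub>R e) - 2 * u p + u (p + h *\<^sub>R e)) / h\<^sup>2 - pd e (pd e u) p = (D 4 t + D 4 s) / 24 * h\<^sup>2"
    using h by (simp add: field_simps power2_eq_square eval_nat_numeral)
  also have "\<bar>\<dots>\<bar> \<le> K * h\<^sup>2"
    unfolding abs_mult using DK[of t] DK[of s] by (intro mult_mono) auto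
  finally show ?thesis .
qed

lemma laplacian_pd: "laplacian u p = pd (1, 0) (pd (1, 0) u) p + pd (0, 1) (pd (0, 1) u) p"
  by (simp add: laplacian_def pd1_eq pd2_eq)

section \<open>The discrete Green operator on translated grids\<close>

text \<open>The grid point with index \<open>k\<close>.\<close>

definition gpt :: "real \<times> real \<Rightarrow> nat \<times> nat \<Rightarrow> int \<times> int \<Rightarrow> real \<times> real" where
  "gpt X N k = (of_int (fst k) * h1 X N, of_int (snd k) * h2 X N)"

lemma gpt_add: "gpt X N (k + l) = gpt X N k + gpt X N l"
  by (simp add: gpt_def algebra_simps)

lemma gpt_diff: "gpt X N (k - l) = gpt X N k - gpt X N l"
  by (simp add: gpt_def algebra_simps)

lemma gpt_e: "gpt X N e1 = h1 X N *\<^sub>R (1, 0)" "gpt X N e2 = h2 X N *\<^sub>R (0, 1)" "gpt X N 0 = 0"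
  by (simp_all add: gpt_def zero_prod_def)

lemma on_grid_gpt: "on_grid X N u = (\<lambda>k. u (gpt X N k))"
  by (auto simp: on_grid_def gpt_def)

lemma pd_lipschitz2:
  assumes u: "Ck (Suc 0) u" and K: "\<And>e p. e \<in> dirs \<Longrightarrow> \<bar>pd e u p\<bar> \<le> K"
  shows "\<bar>u (p + (s, t)) - u p\<bar> \<le> K * (\<bar>s\<bar> + \<bar>t\<bar>)"
proof -
  have "\<bar>u (p + s *\<^sub>R (1, 0)) - u p\<bar> \<le> K * \<bar>s\<bar>"
    by (rule pd_lipschitz[OF u _ K]) (auto simp: dirs_def)
  moreover have "\<bar>u (p + s *\<^sub>R (1, 0) + t *\<^sub>R (0, 1)) - u (p + s *\<^sub>R (1, 0))\<bar> \<le> K * \<bar>t\<bar>"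
    by (rule pd_lipschitz[OF u _ K]) (auto simp: dirs_def)
  moreover have "p + (s, t) = p + s *\<^sub>R (1, 0) + t *\<^sub>R (0, 1)" by (cases p) simp
  ultimately show ?thesis by (simp add: algebra_simps del: add_Pair scaleR_Pair)
qed

context torus_grid begin

text \<open>The values of \<open>u\<close> on the grid translated by \<open>x\<close>.\<close>

abbreviation trace where "trace u x \<equiv> (\<lambda>k. u (x + gpt X N k))"

lemma trace_gridfun:
  assumes "periodic X u"
  shows "trace u x \<in> gridfuns N"
proof -
  have "u (x + gpt X N (k1 + m1 * int (fst N), k2 + m2 * int (snd N))) = u (x + gpt X N (k1, k2))" for k1 k2 m1 m2
  proof -
    have eq: "x + gpt X N (k1 + m1 * int (fst N), k2 + m2 * int (snd N))
      = x + gpt X N (k1, k2) + (2 * of_int m1 * fst X, 2 * of_int m2 * snd X)"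
    proof -
      have "of_int (k1 + m1 * int (fst N)) * h1 X N = of_int k1 * h1 X N + of_int m1 * (h1 X N * real (fst N))"
        "of_int (k2 + m2 * int (snd N)) * h2 X N = of_int k2 * h2 X N + of_int m2 * (h2 X N * real (snd N))"
        by (simp_all add: algebra_simps)
      then show ?thesis unfolding h1N h2N by (cases x) (simp add: gpt_def)
    qed
    show ?thesis unfolding eq by (rule periodic_shift[OF assms])
  qed
  then show ?thesis by (simp add: gridfuns_def)
qed

lemma laplacian_consistency:
  assumes u: "Ck 4 u" and K: "\<And>e p. e \<in> dirs \<Longrightarrow> \<bar>(pd e ^^ 4) u p\<bar> \<le> K"
  shows "\<bar>Lh (trace u x) k - laplacian u (x + gpt X N k)\<bar> \<le> K * ((h1 X N)\<^sup>2 + (h2 X N)\<^sup>2)"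
proof -
  let ?q = "x + gpt X N k"
  have d: "(1, 0) \<in> dirs" "(0, 1) \<in> dirs" by (auto simp: dirs_def)
  have a: "\<bar>sdiff e1 (trace u x) k / (h1 X N)\<^sup>2 - pd (1, 0) (pd (1, 0) u) ?q\<bar> \<le> K * (h1 X N)\<^sup>2"
    using second_difference[OF u d(1) K[OF d(1)] h1_pos, of ?q]
    by (simp add: sdiff_def gpt_add gpt_diff gpt_e add.assoc add_diff_eq del: add_Pair scaleR_Pair diff_Pair)
  have b: "\<bar>sdiff e2 (trace u x) k / (h2 X N)\<^sup>2 - pd (0, 1) (pd (0, 1) u) ?q\<bar> \<le> K * (h2 X N)\<^sup>2"
    using second_difference[OF u d(2) K[OF d(2)] h2_pos, of ?q]
    by (simp add: sdiff_def gpt_add gpt_diff gpt_e add.assoc add_diff_eq del: add_Pair scaleR_Pair diff_Pair)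
  show ?thesis
    using a b unfolding laplacian_h_sdiff laplacian_pd distrib_left by linarith
qed

text \<open>The kernel of the discrete inverse Laplacian, and the operator that it defines on functions on the plane.
By construction \<open>Q g\<close> solves the discrete Poisson problem, with data \<open>g\<close> minus its mean, on every
translate of the grid at the same time. It is a finite linear combination of translates of \<open>g\<close>; hence it is as smooth
as \<open>g\<close>, commutes with differentiation, and inherits bounds for all derivatives with the mesh-independent
constant of the sup estimate.\<close>

definition kern :: gridfun where
  "kern = (SOME G. \<forall>F\<in>gridfuns N. invh F 0 = gs (\<lambda>l. G l * F l))"

lemma kern: "F \<in> gridfuns N \<Longrightarrow> gs (\<lambda>l. kern l * F l) = invh F 0"
  using someI_ex[OF inv_h_kernel] unfolding kern_def by simp

definition Q :: "(real \<times> real \<Rightarrow> real) \<Rightarrow> real \<times> real \<Rightarrow> real" where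
  "Q g x = gs (\<lambda>l. kern l * g (x + gpt X N l))"

lemma Q_eq: "periodic X g \<Longrightarrow> Q g x = invh (trace g x) 0"
  unfolding Q_def by (rule kern[OF trace_gridfun])

lemma Ck_Q: "Ck k g \<Longrightarrow> Ck k (Q g)"
  unfolding Q_def[abs_def] by (intro Ck_sum Ck_cmult Ck_shift) auto

lemma pd_Q: "Ck (Suc k) g \<Longrightarrow> e \<in> dirs \<Longrightarrow> pd e (Q g) = Q (pd e g)"
  unfolding Q_def[abs_def]
  by (subst pd_sum[of _ k]) (auto simp: pd_cmult[of k] pd_shift Ck_cmult Ck_shift)

lemma pd_pow_Q: "Ck (k + j) g \<Longrightarrow> e \<in> dirs \<Longrightarrow> (pd e ^^ j) (Q g) = Q ((pd e ^^ j) g)"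
proof (induction j arbitrary: k)
  case (Suc j)
  then have "(pd e ^^ j) (Q g) = Q ((pd e ^^ j) g)" using Suc.IH[of "Suc k"] by simp
  moreover have "Ck (Suc k) ((pd e ^^ j) g)" by (rule Ck_pd_pow) (use Suc in auto)
  ultimately show ?case using pd_Q[OF _ Suc.prems(2)] by simp
qed simp

lemma periodic_Q: "periodic X g \<Longrightarrow> periodic X (Q g)"
proof -
  assume g: "periodic X g"
  have "Q g (p + c) = Q g p" if c: "\<And>q. g (q + c) = g q" for p c
  proof -
    have "p + c + q = p + q + c" for q by (simp only: add.assoc add.commute add.left_commute)
    then show ?thesis unfolding Q_def by (simp only: c)
  qed
  then show ?thesis using g unfolding periodic_alt by blast
qed

lemma Q_bound: "periodic X g \<Longrightarrow> (\<And>p. \<bar>g p\<bar> \<le> B) \<Longrightarrow> \<bar>Q g x\<bar> \<le> SC * (2 * B)"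
  unfolding Q_eq by (rule inv_h_sup[OF trace_gridfun])

lemma Q_trace:
  assumes "periodic X g"
  shows "trace (Q g) x = invh (trace g x)"
proof
  fix k
  have "Q g (x + gpt X N k) = invh (\<lambda>l. trace g x (l + k)) 0"
    unfolding Q_eq[OF assms] by (simp add: gpt_add add.assoc add.commute add.left_commute)
  also have "\<dots> = invh (trace g x) k"
    using inv_h_shift[OF trace_gridfun[OF assms]] by simp
  finally show "Q g (x + gpt X N k) = invh (trace g x) k" .
qed

text \<open>The mean of \<open>g\<close> over the grid translated by \<open>x\<close>.\<close>

definition gmean :: "(real \<times> real \<Rightarrow> real) \<Rightarrow> real \<times> real \<Rightarrow> real" where
  "gmean g x = gs (trace g x) / nn"

lemma Lh_Q: "periodic X g \<Longrightarrow> Lh (trace (Q g) x) k = gmean g x - g (x + gpt X N k)"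
  by (simp add: Q_trace inv_h_props(3)[OF trace_gridfun] gmean_def)

lemma gmean_shift: "periodic X g \<Longrightarrow> gmean g (x + gpt X N k) = gmean g x"
  using sum_grid_shift[OF trace_gridfun, of g x k]
  by (simp add: gmean_def gpt_add add.assoc add.commute add.left_commute)

lemma grid_near:
  obtains k s t where "y = x + gpt X N k + (s, t)" "\<bar>s\<bar> \<le> h1 X N" "\<bar>t\<bar> \<le> h2 X N"
proof -
  have near: "\<exists>m::int. \<bar>a - of_int m * h\<bar> \<le> h" if "h > 0" for a h :: real
  proof -
    have "of_int \<lfloor>a / h\<rfloor> \<le> a / h" "a / h < of_int \<lfloor>a / h\<rfloor> + 1" by auto
    then have "of_int \<lfloor>a / h\<rfloor> * h \<le> a" "a < (of_int \<lfloor>a / h\<rfloor> + 1) * h"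
      using that by (simp_all only: pos_le_divide_eq pos_divide_less_eq)
    then have "\<bar>a - of_int \<lfloor>a / h\<rfloor> * h\<bar> \<le> h" by (simp add: algebra_simps abs_le_iff)
    then show ?thesis ..
  qed
  obtain m1 where m1: "\<bar>fst y - fst x - of_int m1 * h1 X N\<bar> \<le> h1 X N" using near[OF h1_pos] by blast
  obtain m2 where m2: "\<bar>snd y - snd x - of_int m2 * h2 X N\<bar> \<le> h2 X N" using near[OF h2_pos] by blast
  show ?thesis
    by (rule that[OF _ m1 m2, of "(m1, m2)"]) (simp add: gpt_def prod_eq_iff)
qed

text \<open>The mean depends on the translation only modulo the mesh, and so hardly at all.\<close>

lemma gmean_osc:
  assumes g: "periodic X g" "Ck (Suc 0) g" and K: "\<And>e p. e \<in> dirs \<Longrightarrow> \<bar>pd e g p\<bar> \<le> K"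
  shows "\<bar>gmean g x - gmean g y\<bar> \<le> K * (h1 X N + h2 X N)"
proof -
  obtain k s t where y: "y = x + gpt X N k + (s, t)" and st: "\<bar>s\<bar> \<le> h1 X N" "\<bar>t\<bar> \<le> h2 X N"
    by (rule grid_near)
  have K0: "K \<ge> 0" using K[of "(1, 0)" 0] by (auto simp: dirs_def)
  let ?z = "x + gpt X N k"
  have "gmean g ?z - gmean g y = gs (\<lambda>l. g (?z + gpt X N l) - g (y + gpt X N l)) / nn"
    by (simp add: gmean_def sum_subtractf diff_divide_distrib)
  also have "\<bar>\<dots>\<bar> \<le> K * (h1 X N + h2 X N)"
  proof (rule mean_abs_le)
    fix l
    have "\<bar>g (?z + gpt X N l + (s, t)) - g (?z + gpt X N l)\<bar> \<le> K * (\<bar>s\<bar> + \<bar>t\<bar>)"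
      by (rule pd_lipschitz2[OF g(2) K])
    also have "\<dots> \<le> K * (h1 X N + h2 X N)" using st K0 by (intro mult_left_mono) auto
    finally show "\<bar>g (?z + gpt X N l) - g (y + gpt X N l)\<bar> \<le> K * (h1 X N + h2 X N)"
      by (simp add: y add.assoc add.commute add.left_commute abs_minus_commute)
  qed
  finally show ?thesis by (simp add: gmean_shift[OF g(1)])
qed

text \<open>Only the oscillation of the Laplacian matters: its value at a point is nearly its mean, up to the oscillation
and the consistency error, because the discrete Laplacian has mean zero.\<close>

lemma grid_oscillation:
  assumes w: "periodic X w" "Ck 4 w" and K: "\<And>e p. e \<in> dirs \<Longrightarrow> \<bar>(pd e ^^ 4) w p\<bar> \<le> K"
    and d: "\<And>x y. \<bar>laplacian w x - laplacian w y\<bar> \<le> d"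
  shows "\<bar>w (x + gpt X N k) - w (x + gpt X N l)\<bar> \<le> SC * (2 * (d + K * ((h1 X N)\<^sup>2 + (h2 X N)\<^sup>2)))"
proof -
  define b where "b = d + K * ((h1 X N)\<^sup>2 + (h2 X N)\<^sup>2)"
  define c where "c = laplacian w x"
  have Lc: "\<bar>Lh (trace w x) m - c\<bar> \<le> b" for m
    using laplacian_consistency[OF w(2) K, of x m] d[of "x + gpt X N m" x] unfolding c_def b_def by linarith
  have "gs (\<lambda>m. Lh (trace w x) m - c) / nn = - c"
    using nn_pos gs_laplacian[OF trace_gridfun[OF w(1)]] by (simp add: sum_subtractf card_grid)
  then have "\<bar>c\<bar> \<le> b" using mean_abs_le[of "\<lambda>m. Lh (trace w x) m - c", OF Lc] by simp
  then have "\<bar>Lh (trace w x) m\<bar> \<le> 2 * b" for m using Lc[of m] by linarith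
  then show ?thesis using osc_stability[OF trace_gridfun[OF w(1)]] unfolding b_def by blast
qed

end

section \<open>Existence for the Poisson problem on the torus\<close>

text \<open>The box alone. Here the mesh is refined: \<open>n\<close> stands for the grid with \<open>n + 1\<close> intervals in each direction.\<close>

locale torus_box =
  fixes X :: "real \<times> real"
  assumes X1: "fst X > 0" and X2: "snd X > 0"
begin

lemma grid: "n > 0 \<Longrightarrow> torus_grid X (n, n)"
  by unfold_locales (auto simp: X1 X2)

abbreviation SC where "SC \<equiv> sup_const X"

lemma h_tendsto: "(\<lambda>n. h1 X (Suc n, Suc n)) \<longlonglongrightarrow> 0" "(\<lambda>n. h2 X (Suc n, Suc n)) \<longlonglongrightarrow> 0"
  unfolding h1_def h2_def fst_conv snd_conv
  using LIMSEQ_inverse_real_of_nat[THEN tendsto_mult_left, of "2 * fst X"]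
    LIMSEQ_inverse_real_of_nat[THEN tendsto_mult_left, of "2 * snd X"]
  by (auto simp: divide_inverse)

lemma dirs_bounded:
  assumes "\<And>e. e \<in> dirs \<Longrightarrow> periodic X (F e)" "\<And>e. e \<in> dirs \<Longrightarrow> Ck 0 (F e)"
  obtains K where "\<And>e p. e \<in> dirs \<Longrightarrow> \<bar>F e p\<bar> \<le> K"
proof -
  obtain K1 where K1: "\<And>p. \<bar>F (1, 0) p\<bar> \<le> K1"
    using periodic_bounded[OF X1 X2, of "F (1, 0)"] assms[of "(1, 0)"] by (auto simp: dirs_def)
  obtain K2 where K2: "\<And>p. \<bar>F (0, 1) p\<bar> \<le> K2"
    using periodic_bounded[OF X1 X2, of "F (0, 1)"] assms[of "(0, 1)"] by (auto simp: dirs_def)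
  show ?thesis
    by (rule that[of "max K1 K2"]) (use K1 K2 in \<open>auto simp: dirs_def le_max_iff_disj\<close>)
qed

text \<open>The discrete estimate passes to the limit of vanishing mesh size and yields the same estimate for the
Laplacian on the torus.\<close>

lemma osc_bound:
  assumes w: "periodic X w" "Ck 4 w"
    and d: "\<And>x y. \<bar>laplacian w x - laplacian w y\<bar> \<le> d"
  shows "\<bar>w x - w y\<bar> \<le> SC * (2 * d)"
proof -
  have w1: "Ck (Suc 0) w" by (rule Ck_mono[OF _ w(2)]) simp
  obtain K where K: "\<And>e p. e \<in> dirs \<Longrightarrow> \<bar>(pd e ^^ 4) w p\<bar> \<le> K"
    by (rule dirs_bounded[of "\<lambda>e. (pd e ^^ 4) w"])
      (use periodic_pd_pow[OF w(1)] Ck_pd_pow[of 0 4 w] w(2) in auto)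
  obtain K1 where K1: "\<And>e p. e \<in> dirs \<Longrightarrow> \<bar>pd e w p\<bar> \<le> K1"
    by (rule dirs_bounded[of "\<lambda>e. pd e w"])
      (use periodic_pd[OF w(1)] Ck_pd[OF w1] in auto)
  have K10: "K1 \<ge> 0" using K1[of "(1, 0)" 0] by (auto simp: dirs_def)
  define b where "b n = SC * (2 * (d + K * ((h1 X (Suc n, Suc n))\<^sup>2 + (h2 X (Suc n, Suc n))\<^sup>2)))
     + K1 * (h1 X (Suc n, Suc n) + h2 X (Suc n, Suc n))" for n
  have "\<bar>w x - w y\<bar> \<le> b n" for n
  proof -
    interpret g: torus_grid X "(Suc n, Suc n)" by (rule grid) simp
    obtain k s t where y: "y = x + gpt X (Suc n, Suc n) k + (s, t)"
      and st: "\<bar>s\<bar> \<le> h1 X (Suc n, Suc n)" "\<bar>t\<bar> \<le> h2 X (Suc n, Suc n)"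
      by (rule g.grid_near)
    have "\<bar>w (x + gpt X (Suc n, Suc n) 0) - w (x + gpt X (Suc n, Suc n) k)\<bar>
      \<le> SC * (2 * (d + K * ((h1 X (Suc n, Suc n))\<^sup>2 + (h2 X (Suc n, Suc n))\<^sup>2)))"
      by (rule g.grid_oscillation[OF w K d])
    moreover have "\<bar>w y - w (x + gpt X (Suc n, Suc n) k)\<bar> \<le> K1 * (\<bar>s\<bar> + \<bar>t\<bar>)"
      unfolding y by (rule pd_lipschitz2[OF w1 K1])
    moreover have "K1 * (\<bar>s\<bar> + \<bar>t\<bar>) \<le> K1 * (h1 X (Suc n, Suc n) + h2 X (Suc n, Suc n))"
      using st K10 by (intro mult_left_mono) auto
    ultimately show ?thesis unfolding b_def gpt_e(3) by simp
  qed
  moreover have "b \<longlonglongrightarrow> SC * (2 * (d + K * (0\<^sup>2 + 0\<^sup>2))) + K1 * (0 + 0)"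
    unfolding b_def[abs_def] by (intro tendsto_intros h_tendsto)
  ultimately show ?thesis by (intro LIMSEQ_le_const[of b]) auto
qed

end

text \<open>Uniform convergence passes to the derivatives when the next derivatives are uniformly bounded.\<close>

lemma uniformly_Cauchy_pd:
  assumes V: "\<And>n. Ck 2 (V n)" and e: "e \<in> dirs" and K: "\<And>n p. \<bar>pd e (pd e (V n)) p\<bar> \<le> K"
    and c: "uniformly_Cauchy_on UNIV V"
  shows "uniformly_Cauchy_on UNIV (\<lambda>n. pd e (V n))"
  unfolding uniformly_Cauchy_on_def
proof (intro allI impI)
  fix r :: real assume r: "r > 0"
  have K0: "K \<ge> 0" using K[of 0 0] by linarith
  \<comment> \<open>makes the second term of the interpolation inequality at most half of \<open>r\<close>\<close>
  define h where "h = r / (2 * (K + 1))"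
  have h: "h > 0" "K * h < r / 2" using r K0 by (auto simp: h_def field_simps)
  define d where "d = r * h / 8"
  have d: "d > 0" using r h by (simp add: d_def)
  obtain m0 where m0: "\<And>m n p. m \<ge> m0 \<Longrightarrow> n \<ge> m0 \<Longrightarrow> dist (V m p) (V n p) < d"
    using c d unfolding uniformly_Cauchy_on_def by blast
  have "dist (pd e (V m) p) (pd e (V n) p) < r" if mn: "m \<ge> m0" "n \<ge> m0" for m n p
  proof -
    let ?w = "\<lambda>p. V m p - V n p"
    have w2: "Ck 2 ?w" by (intro Ck_diff V)
    have V2: "Ck (Suc (Suc 0)) (V m)" for m using V[of m] by (simp only: numeral_2_eq_2)
    have pw: "pd e ?w = (\<lambda>p. pd e (V m) p - pd e (V n) p)"
      by (rule pd_diff[OF V2 V2 e])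
    have ppw: "pd e (pd e ?w) = (\<lambda>p. pd e (pd e (V m)) p - pd e (pd e (V n)) p)"
      unfolding pw by (rule pd_diff[OF Ck_pd[OF V2 e] Ck_pd[OF V2 e] e])
    have "\<bar>pd e ?w p\<bar> \<le> 2 * d / h + (2 * K) * h / 2"
    proof (rule pd_interpolation[OF w2 e _ h(1)])
      show "\<bar>pd e (pd e ?w) p\<bar> \<le> 2 * K" for p unfolding ppw using K[of m p] K[of n p] by simp
      show "\<bar>?w p\<bar> \<le> d" for p using m0[OF mn, of p] by (simp add: dist_real_def)
    qed
    also have "\<dots> < r" using h r by (simp add: d_def)
    finally show ?thesis unfolding pw by (simp add: dist_real_def)
  qed
  then show "\<exists>M. \<forall>x\<in>UNIV. \<forall>m\<ge>M. \<forall>n\<ge>M. dist (pd e (V m) x) (pd e (V n) x) < r" by blast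
qed

lemma DERIV_uniform_limit:
  assumes V: "\<And>n. Ck (Suc 0) (V n)" and e: "e \<in> dirs"
    and l: "\<And>p. (\<lambda>n. V n p) \<longlonglongrightarrow> v p" and u: "uniform_limit UNIV (\<lambda>n. pd e (V n)) v' sequentially"
  shows "((\<lambda>s. v (p + s *\<^sub>R e)) has_real_derivative v' p) (at 0)"
proof -
  have "\<exists>g. \<forall>s\<in>UNIV. (\<lambda>n. V n (p + s *\<^sub>R e)) \<longlonglongrightarrow> g s \<and> (g has_derivative (\<lambda>h. v' (p + s *\<^sub>R e) * h)) (at s within UNIV)"
  proof (rule has_derivative_sequence[of UNIV "\<lambda>n s. V n (p + s *\<^sub>R e)" "\<lambda>n s h. pd e (V n) (p + s *\<^sub>R e) * h"
      "\<lambda>s h. v' (p + s *\<^sub>R e) * h" 0 "v p"])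
    show "((\<lambda>s. V n (p + s *\<^sub>R e)) has_derivative (\<lambda>h. pd e (V n) (p + s *\<^sub>R e) * h)) (at s within UNIV)" for n s
      using Ck_DERIV[OF V e, of n p s] by (simp add: has_field_derivative_def)
    show "(\<lambda>n. V n (p + 0 *\<^sub>R e)) \<longlonglongrightarrow> v p" using l by simp
    fix r :: real assume r: "r > 0"
    have "\<forall>\<^sub>F n in sequentially. \<forall>q\<in>UNIV. dist (pd e (V n) q) (v' q) < r"
      using u r unfolding uniform_limit_iff by blast
    then show "\<forall>\<^sub>F n in sequentially. \<forall>s\<in>UNIV. \<forall>h.
        norm (pd e (V n) (p + s *\<^sub>R e) * h - v' (p + s *\<^sub>R e) * h) \<le> r * norm h"
    proof eventually_elim
      case (elim n)
      show ?case
      proof (intro ballI allI)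
        fix s h
        have "\<bar>pd e (V n) (p + s *\<^sub>R e) - v' (p + s *\<^sub>R e)\<bar> \<le> r"
          using elim[rule_format, of "p + s *\<^sub>R e"] by (simp add: dist_real_def)
        then show "norm (pd e (V n) (p + s *\<^sub>R e) * h - v' (p + s *\<^sub>R e) * h) \<le> r * norm h"
          unfolding left_diff_distrib[symmetric] norm_mult by (intro mult_right_mono) auto
      qed
    qed
  qed auto
  then obtain g where g: "\<And>s. (\<lambda>n. V n (p + s *\<^sub>R e)) \<longlonglongrightarrow> g s"
    "\<And>s. (g has_derivative (\<lambda>h. v' (p + s *\<^sub>R e) * h)) (at s)" by auto
  have "g = (\<lambda>s. v (p + s *\<^sub>R e))" using LIMSEQ_unique[OF g(1) l] by auto
  then show ?thesis using g(2)[of 0] by (simp add: has_field_derivative_def)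
qed

lemma laplacian_diff:
  assumes "Ck 2 u" "Ck 2 v"
  shows "laplacian (\<lambda>p. u p - v p) p = laplacian u p - laplacian v p"
proof -
  have u: "Ck (Suc (Suc 0)) u" and v: "Ck (Suc (Suc 0)) v" using assms by (simp_all only: numeral_2_eq_2)
  have "pd e (pd e (\<lambda>p. u p - v p)) = (\<lambda>p. pd e (pd e u) p - pd e (pd e v) p)" if e: "e \<in> dirs" for e
    unfolding pd_diff[OF u v e] by (rule pd_diff[OF Ck_pd[OF u e] Ck_pd[OF v e] e])
  then show ?thesis by (simp add: laplacian_pd dirs_def)
qed

lemma laplacian_diff_const: "Ck 2 u \<Longrightarrow> laplacian (\<lambda>p. u p - c) p = laplacian u p"
  using laplacian_diff[OF _ Ck_const, of u c p]
  by (simp add: laplacian_pd pd_const)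

context torus_box begin

text \<open>The operator \<open>Q\<close> of the grid with \<open>n + 1\<close> intervals in each direction.\<close>

definition Qn :: "nat \<Rightarrow> (real \<times> real \<Rightarrow> real) \<Rightarrow> real \<times> real \<Rightarrow> real" where
  "Qn n = torus_grid.Q X (Suc n, Suc n)"

abbreviation hh :: "nat \<Rightarrow> real" where
  "hh n \<equiv> (h1 X (Suc n, Suc n))\<^sup>2 + (h2 X (Suc n, Suc n))\<^sup>2"

lemma gridn: "torus_grid X (Suc n, Suc n)" by (rule grid) simp

lemma Ck_Qn: "Ck k g \<Longrightarrow> Ck k (Qn n g)"
  unfolding Qn_def by (rule torus_grid.Ck_Q[OF gridn])

lemma pd_Qn: "Ck (Suc k) g \<Longrightarrow> e \<in> dirs \<Longrightarrow> pd e (Qn n g) = Qn n (pd e g)"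
  unfolding Qn_def by (rule torus_grid.pd_Q[OF gridn])

lemma pd_pow_Qn: "Ck (k + j) g \<Longrightarrow> e \<in> dirs \<Longrightarrow> (pd e ^^ j) (Qn n g) = Qn n ((pd e ^^ j) g)"
  unfolding Qn_def by (rule torus_grid.pd_pow_Q[OF gridn])

lemma periodic_Qn: "periodic X g \<Longrightarrow> periodic X (Qn n g)"
  unfolding Qn_def by (rule torus_grid.periodic_Q[OF gridn])

lemma Qn_bound: "periodic X g \<Longrightarrow> (\<And>p. \<bar>g p\<bar> \<le> B) \<Longrightarrow> \<bar>Qn n g x\<bar> \<le> SC * (2 * B)"
  unfolding Qn_def by (rule torus_grid.Q_bound[OF gridn])

lemma SC_nonneg: "SC \<ge> 0"
  by (rule torus_grid.SC_nonneg[OF gridn])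

lemma laplacian_Qn:
  assumes g: "periodic X g" "Ck 4 g"
    and K: "\<And>e p. e \<in> dirs \<Longrightarrow> \<bar>(pd e ^^ 4) g p\<bar> \<le> K"
    and K1: "\<And>e p. e \<in> dirs \<Longrightarrow> \<bar>pd e g p\<bar> \<le> K1"
  shows "\<bar>(laplacian (Qn n g) x + g x) - (laplacian (Qn n g) y + g y)\<bar>
     \<le> K1 * (h1 X (Suc n, Suc n) + h2 X (Suc n, Suc n)) + 2 * (SC * (2 * K) * hh n)"
proof -
  interpret G: torus_grid X "(Suc n, Suc n)" by (rule gridn)
  have Q4: "Ck 4 (Qn n g)" by (rule Ck_Qn[OF g(2)])
  have QK: "\<bar>(pd e ^^ 4) (Qn n g) p\<bar> \<le> SC * (2 * K)" if e: "e \<in> dirs" for e p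
    using pd_pow_Qn[of 0 4 g e n] g e Qn_bound[OF periodic_pd_pow[OF g(1)] K[OF e]] by simp
  have a: "\<bar>(G.gmean g x - g x) - laplacian (Qn n g) x\<bar> \<le> SC * (2 * K) * hh n" for x
    using G.laplacian_consistency[OF Q4 QK, of x 0] G.Lh_Q[OF g(1), of x 0]
    by (simp add: Qn_def gpt_e)
  have b: "\<bar>G.gmean g x - G.gmean g y\<bar> \<le> K1 * (h1 X (Suc n, Suc n) + h2 X (Suc n, Suc n))"
    by (rule G.gmean_osc[OF g(1) Ck_mono[OF _ g(2)] K1]) auto
  show ?thesis using a[of x] a[of y] b by linarith
qed

lemma uniform_limit_pd_Qn:
  assumes V: "\<And>n. Ck 2 (V n)" and pV: "\<And>n. pd e (V n) = Qn n v" and e: "e \<in> dirs"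
    and v: "Ck 1 v" "periodic X v" and c: "uniformly_Cauchy_on UNIV V"
  shows "uniformly_Cauchy_on UNIV (\<lambda>n. Qn n v)"
    and "\<exists>v'. uniform_limit UNIV (\<lambda>n. Qn n v) v' sequentially"
proof -
  have v1: "Ck (Suc 0) v" using v by simp
  obtain K where K: "\<And>p. \<bar>pd e v p\<bar> \<le> K"
    using periodic_bounded[OF X1 X2 periodic_pd[OF v(2), of e]] Ck_pd[OF v1 e] unfolding Ck.simps by blast
  have "\<bar>pd e (pd e (V n)) p\<bar> \<le> SC * (2 * K)" for n p
    unfolding pV pd_Qn[OF v1 e] by (rule Qn_bound[OF periodic_pd[OF v(2)] K])
  from uniformly_Cauchy_pd[OF V e this c]
  show c': "uniformly_Cauchy_on UNIV (\<lambda>n. Qn n v)" by (simp add: pV)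
  show "\<exists>v'. uniform_limit UNIV (\<lambda>n. Qn n v) v' sequentially"
    using Cauchy_uniformly_convergent[OF c'] by (auto simp: uniformly_convergent_on_def)
qed

text \<open>Existence for the Poisson problem on the torus. The functions \<open>Q g\<close> for finer and finer grids, normalized
to vanish at 0, solve the problem up to an error that tends to 0 and up to a constant, so that by \<open>osc_bound\<close>
they are uniformly Cauchy. Their derivatives up to order two converge as well, since those of higher order
are bounded. The approximations \<open>U n\<close> are part of the conclusion because they carry the bound of the fourth
derivatives that the limit \<open>u\<close>, being shown to be of class C2 only, cannot be asked for. The constant \<open>c\<close> is
identified later by integration.\<close>

lemma poisson_limit:
  assumes g: "periodic X g" "Ck 4 g"
  obtains U u c where "\<And>n. periodic X (U n)" "\<And>n. Ck 4 (U n)"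
    "\<And>K n e p. (\<And>e p. e \<in> dirs \<Longrightarrow> \<bar>(pd e ^^ 4) g p\<bar> \<le> K) \<Longrightarrow> e \<in> dirs \<Longrightarrow> \<bar>(pd e ^^ 4) (U n) p\<bar> \<le> SC * (2 * K)"
    "uniform_limit UNIV U u sequentially" "\<And>p. (\<lambda>n. laplacian (U n) p) \<longlonglongrightarrow> laplacian u p"
    "periodic X u" "Ck 2 u" "\<And>p. - laplacian u p = g p - c"
proof -
  obtain K where K: "\<And>e p. e \<in> dirs \<Longrightarrow> \<bar>(pd e ^^ 4) g p\<bar> \<le> K"
    by (rule dirs_bounded[of "\<lambda>e. (pd e ^^ 4) g"])
      (use periodic_pd_pow[OF g(1)] Ck_pd_pow[of 0 4 g] g(2) in auto)
  have gS: "Ck (Suc 3) g" "Ck (Suc 0) g" using g(2) Ck_mono[of "Suc 0" 4 g] by simp_all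
  obtain K1 where K1: "\<And>e p. e \<in> dirs \<Longrightarrow> \<bar>pd e g p\<bar> \<le> K1"
    by (rule dirs_bounded[of "\<lambda>e. pd e g"])
      (use periodic_pd[OF g(1)] Ck_pd[OF gS(2)] in auto)
  \<comment> \<open>vanishing at 0 turns the bound on the oscillation of differences into a bound on their size\<close>
  define U where "U n = (\<lambda>p. Qn n g p - Qn n g 0)" for n
  have U4: "Ck 4 (U n)" for n unfolding U_def by (intro Ck_diff Ck_const Ck_Qn g)
  have Uper: "periodic X (U n)" for n
    unfolding U_def by (rule periodic_comp[OF periodic_Qn[OF g(1)], of "\<lambda>x. x - Qn n g 0"])
  have pU: "pd e (U n) = Qn n (pd e g)" if "e \<in> dirs" for e n
    unfolding U_def using pd_diff_const[OF Ck_Qn[OF gS(1)] that] pd_Qn[OF gS(1) that] by simp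
  have U2: "Ck 2 (U n)" for n by (rule Ck_mono[OF _ U4]) simp
  have lapU: "laplacian (U n) p = laplacian (Qn n g) p" for n p
    unfolding U_def by (rule laplacian_diff_const[OF Ck_Qn[OF Ck_mono[OF _ g(2)]]]) simp
  have UK: "\<bar>(pd e ^^ 4) (U n) p\<bar> \<le> SC * (2 * K)"
    if K: "\<And>e p. e \<in> dirs \<Longrightarrow> \<bar>(pd e ^^ 4) g p\<bar> \<le> K" and e: "e \<in> dirs" for K n e p
  proof -
    have 4: "(4::nat) = Suc 3" by simp
    have "(pd e ^^ 4) (U n) = (pd e ^^ 3) (Qn n (pd e g))"
      unfolding 4 funpow_Suc_right comp_apply pU[OF e] ..
    also have "\<dots> = Qn n ((pd e ^^ 3) (pd e g))"
      by (rule pd_pow_Qn[of 0]) (use Ck_pd[OF gS(1) e] e in auto)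
    also have "(pd e ^^ 3) (pd e g) = (pd e ^^ 4) g"
      unfolding 4 funpow_Suc_right comp_apply ..
    finally show ?thesis using Qn_bound[OF periodic_pd_pow[OF g(1)] K[OF e]] by simp
  qed
  define d where "d n = K1 * (h1 X (Suc n, Suc n) + h2 X (Suc n, Suc n)) + 2 * (SC * (2 * K) * hh n)" for n
  have lap_osc: "\<bar>(laplacian (U n) x + g x) - (laplacian (U n) y + g y)\<bar> \<le> d n" for n x y
    unfolding lapU d_def by (rule laplacian_Qn[OF g K K1])
  have d0: "d \<longlonglongrightarrow> 0"
  proof -
    have "d \<longlonglongrightarrow> K1 * (0 + 0) + 2 * (SC * (2 * K) * (0\<^sup>2 + 0\<^sup>2))"
      unfolding d_def[abs_def] by (intro tendsto_intros h_tendsto)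
    then show ?thesis by simp
  qed
  have diff: "\<bar>U n x - U m x\<bar> \<le> SC * (2 * (d n + d m))" for n m x
  proof -
    have "\<bar>(U n x - U m x) - (U n 0 - U m 0)\<bar> \<le> SC * (2 * (d n + d m))"
    proof (rule osc_bound[of "\<lambda>p. U n p - U m p"])
      show "periodic X (\<lambda>p. U n p - U m p)" by (rule periodic_comp2[OF Uper Uper])
      show "Ck 4 (\<lambda>p. U n p - U m p)" by (intro Ck_diff U4)
      show "\<bar>laplacian (\<lambda>p. U n p - U m p) x - laplacian (\<lambda>p. U n p - U m p) y\<bar> \<le> d n + d m" for x y
        using lap_osc[of n x y] lap_osc[of m x y] unfolding laplacian_diff[OF U2 U2] by linarith
    qed
    then show ?thesis by (simp add: U_def)
  qed
  have cU: "uniformly_Cauchy_on UNIV U"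
    unfolding uniformly_Cauchy_on_def
  proof (intro allI impI)
    fix r :: real assume r: "r > 0"
    define s where "s = r / (4 * (SC + 1))"
    have s: "s > 0" "SC * (4 * s) < r" using r SC_nonneg by (auto simp: s_def field_simps)
    have "\<forall>\<^sub>F n in sequentially. d n < s" using order_tendstoD(2)[OF d0 s(1)] .
    then obtain m0 where m0: "\<And>n. n \<ge> m0 \<Longrightarrow> d n < s" by (auto simp: eventually_sequentially)
    have "dist (U m x) (U n x) < r" if mn: "m \<ge> m0" "n \<ge> m0" for m n x
    proof -
      have "\<bar>U m x - U n x\<bar> \<le> SC * (2 * (d m + d n))" by (rule diff)
      also have "\<dots> \<le> SC * (4 * s)" using m0[OF mn(1)] m0[OF mn(2)] SC_nonneg by (intro mult_left_mono) auto
      also have "\<dots> < r" by (rule s)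
      finally show ?thesis by (simp add: dist_real_def)
    qed
    then show "\<exists>M. \<forall>x\<in>UNIV. \<forall>m\<ge>M. \<forall>n\<ge>M. dist (U m x) (U n x) < r" by blast
  qed
  obtain u where u: "uniform_limit UNIV U u sequentially"
    using Cauchy_uniformly_convergent[OF cU] by (auto simp: uniformly_convergent_on_def)
  have ge: "Ck 3 (pd e g)" "periodic X (pd e g)" if "e \<in> dirs" for e
    using Ck_pd[OF gS(1) that] periodic_pd[OF g(1)] by auto
  have gee: "Ck 2 (pd e' (pd e g))" "periodic X (pd e' (pd e g))" if "e \<in> dirs" "e' \<in> dirs" for e e'
    using Ck_pd[of 2 "pd e g" e'] ge(1)[OF that(1)] that periodic_pd[OF ge(2)[OF that(1)]]
    by (auto simp: numeral_3_eq_3 numeral_2_eq_2)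
  have c1: "uniformly_Cauchy_on UNIV (\<lambda>n. Qn n (pd e g))"
    and l1: "\<exists>v'. uniform_limit UNIV (\<lambda>n. Qn n (pd e g)) v' sequentially" if e: "e \<in> dirs" for e
    by (rule uniform_limit_pd_Qn[OF U2 pU[OF e] e Ck_mono[OF _ ge(1)[OF e]] ge(2)[OF e] cU]; simp)+
  have l2: "\<exists>v'. uniform_limit UNIV (\<lambda>n. Qn n (pd e' (pd e g))) v' sequentially"
    if e: "e \<in> dirs" and e': "e' \<in> dirs" for e e'
  proof (rule uniform_limit_pd_Qn(2)[OF _ _ e' _ _ c1[OF e]])
    show "Ck 2 (Qn n (pd e g))" for n by (rule Ck_Qn[OF Ck_mono[OF _ ge(1)[OF e]]]) simp
    show "pd e' (Qn n (pd e g)) = Qn n (pd e' (pd e g))" for n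
      by (rule pd_Qn[of 2, OF _ e']) (use ge(1)[OF e] in simp)
    show "Ck 1 (pd e' (pd e g))" by (rule Ck_mono[OF _ gee(1)[OF e e']]) simp
  qed (rule gee(2)[OF e e'])
  obtain ue where ue: "\<And>e. e \<in> dirs \<Longrightarrow> uniform_limit UNIV (\<lambda>n. Qn n (pd e g)) (ue e) sequentially"
    using l1 by metis
  obtain uee where uee: "\<And>e e'. e \<in> dirs \<Longrightarrow> e' \<in> dirs \<Longrightarrow>
      uniform_limit UNIV (\<lambda>n. Qn n (pd e' (pd e g))) (uee e e') sequentially"
    using l2 by metis
  have lim: "(\<lambda>n. V n p) \<longlonglongrightarrow> v p" if "uniform_limit UNIV V v sequentially"
    for V :: "nat \<Rightarrow> real \<times> real \<Rightarrow> real" and v p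
    by (rule tendsto_uniform_limitI[OF that]) simp
  have du: "((\<lambda>s. u (p + s *\<^sub>R e)) has_real_derivative ue e p) (at 0)" if e: "e \<in> dirs" for e p
  proof (rule DERIV_uniform_limit[OF _ e lim[OF u]])
    show "Ck (Suc 0) (U n)" for n by (rule Ck_mono[OF _ U4]) simp
    show "uniform_limit UNIV (\<lambda>n. pd e (U n)) (ue e) sequentially" unfolding pU[OF e] by (rule ue[OF e])
  qed
  have due: "((\<lambda>s. ue e (p + s *\<^sub>R e')) has_real_derivative uee e e' p) (at 0)"
    if e: "e \<in> dirs" and e': "e' \<in> dirs" for e e' p
  proof (rule DERIV_uniform_limit[OF _ e' lim[OF ue[OF e]]])
    show "Ck (Suc 0) (Qn n (pd e g))" for n by (rule Ck_Qn[OF Ck_mono[OF _ ge(1)[OF e]]]) simp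
    have "pd e' (Qn n (pd e g)) = Qn n (pd e' (pd e g))" for n
      by (rule pd_Qn[of 2, OF _ e']) (use ge(1)[OF e] in simp)
    then show "uniform_limit UNIV (\<lambda>n. pd e' (Qn n (pd e g))) (uee e e') sequentially"
      using uee[OF e e'] by simp
  qed
  have cont: "Ck 0 (uee e e')" if e: "e \<in> dirs" and e': "e' \<in> dirs" for e e'
  proof -
    have "continuous_on UNIV (Qn n (pd e' (pd e g)))" for n
      by (rule Ck_continuous[OF Ck_Qn[OF gee(1)[OF e e']]])
    then have "\<forall>\<^sub>F n in sequentially. continuous_on UNIV (Qn n (pd e' (pd e g)))" by simp
    then show ?thesis unfolding Ck.simps by (rule uniform_limit_theorem[OF _ uee[OF e e']]) simp
  qed
  have ue1: "Ck (Suc 0) (ue e)" and pue: "\<And>e'. e' \<in> dirs \<Longrightarrow> pd e' (ue e) = uee e e'" if e: "e \<in> dirs" for e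
    by (rule Ck_SucI[OF due[OF e] cont[OF e]]; assumption)+
  have u2': "Ck (Suc (Suc 0)) u" and pu: "\<And>e. e \<in> dirs \<Longrightarrow> pd e u = ue e"
    by (rule Ck_SucI[OF du ue1]; assumption)+
  have u2: "Ck 2 u" using u2' by (simp only: numeral_2_eq_2)
  have pper: "periodic X u"
    unfolding periodic_alt
  proof (intro allI conjI)
    have "u (p + q) = u p" if "\<And>n p. U n (p + q) = U n p" for p q
      using LIMSEQ_unique[OF lim[OF u, of "p + q"]] lim[OF u, of p] that by simp
    then show "u (p + (2 * fst X, 0)) = u p" "u (p + (0, 2 * snd X)) = u p" for p
      using Uper unfolding periodic_alt by blast+
  qed
  have dd: "(1, 0) \<in> dirs" "(0, 1) \<in> dirs" by (auto simp: dirs_def)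
  have lapl: "(\<lambda>n. laplacian (U n) p) \<longlonglongrightarrow> laplacian u p" for p
  proof -
    have "pd e (pd e (U n)) = Qn n (pd e (pd e g))" if e: "e \<in> dirs" for e n
      unfolding pU[OF e] by (rule pd_Qn[of 2, OF _ e]) (use ge(1)[OF e] in simp)
    then have "laplacian (U n) p = Qn n (pd (1, 0) (pd (1, 0) g)) p + Qn n (pd (0, 1) (pd (0, 1) g)) p" for n
      using dd by (simp add: laplacian_pd)
    moreover have "laplacian u p = uee (1, 0) (1, 0) p + uee (0, 1) (0, 1) p"
      using dd by (simp add: laplacian_pd pu pue)
    ultimately show ?thesis using tendsto_add[OF lim[OF uee[OF dd(1) dd(1)]] lim[OF uee[OF dd(2) dd(2)]]] by simp
  qed
  have const: "laplacian u x + g x = laplacian u y + g y" for x y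
  proof -
    have "(\<lambda>n. \<bar>(laplacian (U n) x + g x) - (laplacian (U n) y + g y)\<bar>)
       \<longlonglongrightarrow> \<bar>(laplacian u x + g x) - (laplacian u y + g y)\<bar>"
      by (intro tendsto_intros lapl)
    then have "\<bar>(laplacian u x + g x) - (laplacian u y + g y)\<bar> \<le> 0"
      by (rule LIMSEQ_le[OF _ d0]) (use lap_osc in auto)
    then show ?thesis by simp
  qed
  show ?thesis
  proof (rule that[of U u "laplacian u 0 + g 0"])
    show "- laplacian u p = g p - (laplacian u 0 + g 0)" for p using const[of p 0] by simp
  qed (fact Uper U4 UK u lapl pper u2)+
qed

section \<open>Uniqueness for the Poisson problem on the torus\<close>

lemma integrable_torus: "continuous_on UNIV F \<Longrightarrow> F integrable_on torus X" for F :: "real \<times> real \<Rightarrow> real"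
  unfolding torus_def by (rule integrable_continuous[OF continuous_on_subset]) auto

lemma integral_pd:
  assumes v: "Ck (Suc 0) v" "periodic X v" and e: "e \<in> dirs"
  shows "integral (torus X) (pd e v) = 0"
proof -
  have cont: "continuous_on UNIV (pd e v)" using Ck_pd[OF v(1) e] by simp
  have sub: "continuous_on (cbox (- fst X, - snd X) (fst X, snd X)) (\<lambda>(x, y). pd e v (x, y))"
    using continuous_on_subset[OF cont] by simp
  have per: "v (fst X, y) = v (- fst X, y)" "v (x, snd X) = v (x, - snd X)" for x y
  proof -
    have "v (- fst X + 2 * fst X, y) = v (- fst X, y)" "v (x, - snd X + 2 * snd X) = v (x, - snd X)"
      using v(2) unfolding periodic_def by blast+
    then show "v (fst X, y) = v (- fst X, y)" "v (x, snd X) = v (x, - snd X)" by simp_all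
  qed
  have F: "integral (torus X) (pd e v) =
      integral (cbox (- fst X) (fst X)) (\<lambda>x. integral (cbox (- snd X) (snd X)) (\<lambda>y. pd e v (x, y)))"
    using integral_prod_continuous[OF sub] unfolding torus_eq by simp
  consider "e = (1, 0)" | "e = (0, 1)" using e by (auto simp: dirs_def)
  then show ?thesis
  proof cases
    case 1
    have "((\<lambda>x. pd e v (x, y)) has_integral v (fst X, y) - v (- fst X, y)) {- fst X..fst X}" for y
    proof (rule fundamental_theorem_of_calculus)
      fix x
      have "((\<lambda>s. v (s, y)) has_real_derivative pd e v (x, y)) (at x)"
        using Ck_DERIV[OF v(1) e, of "(0, y)" x] 1 by simp
      then show "((\<lambda>s. v (s, y)) has_vector_derivative pd e v (x, y)) (at x within {- fst X..fst X})"
        by (simp add: has_real_derivative_iff_has_vector_derivative[symmetric] has_field_derivative_at_within)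
    qed (use X1 in simp)
    then have "integral (cbox (- fst X) (fst X)) (\<lambda>x. pd e v (x, y)) = 0" for y
      by (simp add: integral_unique per)
    then show ?thesis
      unfolding F using integral_swap_continuous[OF sub] by simp
  next
    case 2
    have "((\<lambda>y. pd e v (x, y)) has_integral v (x, snd X) - v (x, - snd X)) {- snd X..snd X}" for x
    proof (rule fundamental_theorem_of_calculus)
      fix y
      have "((\<lambda>s. v (x, s)) has_real_derivative pd e v (x, y)) (at y)"
        using Ck_DERIV[OF v(1) e, of "(x, 0)" y] 2 by simp
      then show "((\<lambda>s. v (x, s)) has_vector_derivative pd e v (x, y)) (at y within {- snd X..snd X})"
        by (simp add: has_real_derivative_iff_has_vector_derivative[symmetric] has_field_derivative_at_within)
    qed (use X2 in simp)
    then have "integral (cbox (- snd X) (snd X)) (\<lambda>y. pd e v (x, y)) = 0" for x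
      by (simp add: integral_unique per)
    then show ?thesis unfolding F by simp
  qed
qed

lemma Ck2_pd: "Ck 2 u \<Longrightarrow> e \<in> dirs \<Longrightarrow> Ck (Suc 0) (pd e u)"
  using Ck_pd[of "Suc 0"] by (simp add: numeral_2_eq_2)

lemma Ck2_pd_pd: "Ck 2 u \<Longrightarrow> e \<in> dirs \<Longrightarrow> e' \<in> dirs \<Longrightarrow> continuous_on UNIV (pd e' (pd e u))"
  using Ck_pd[OF Ck2_pd] by simp

lemma dirs12: "(1, 0) \<in> dirs" "(0, 1) \<in> dirs" by (auto simp: dirs_def)

lemma continuous_laplacian: "Ck 2 u \<Longrightarrow> continuous_on UNIV (laplacian u)"
  unfolding laplacian_pd[abs_def] by (intro continuous_intros Ck2_pd_pd dirs12)

lemma periodic_laplacian: "periodic X u \<Longrightarrow> periodic X (laplacian u)"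
  unfolding laplacian_pd[abs_def] by (intro periodic_comp2[of X _ _ "(+)"] periodic_pd)

lemma integral_laplacian:
  assumes u: "Ck 2 u" "periodic X u"
  shows "integral (torus X) (laplacian u) = 0"
  unfolding laplacian_pd[abs_def]
  by (subst integral_add)
    (auto intro!: integrable_torus Ck2_pd_pd u dirs12
      simp: integral_pd[OF Ck2_pd[OF u(1) dirs12(1)] periodic_pd[OF u(2)] dirs12(1)]
        integral_pd[OF Ck2_pd[OF u(1) dirs12(2)] periodic_pd[OF u(2)] dirs12(2)])

lemma area_eq: "area X = 4 * fst X * snd X" and area_pos: "area X > 0"
  using torus_grid.area_eq[OF gridn] torus_grid.area_pos[OF gridn] by auto

lemma integral_const: "integral (torus X) (\<lambda>_. c) = area X * c"
  unfolding area_def torus_def by (simp add: measure_lborel_cbox_eq content_cbox_if)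

text \<open>Uniqueness by the energy method: \<open>w\<close> times its Laplacian is a divergence minus the squared gradient.\<close>

lemma harmonic_const:
  assumes w: "Ck 2 w" "periodic X w" and h: "\<And>p. laplacian w p = 0"
  shows "w p = w q"
proof -
  let ?V = "\<lambda>e p. w p * pd e w p"
  have w1: "Ck (Suc 0) w" by (rule Ck_mono[OF _ w(1)]) simp
  have V1: "Ck (Suc 0) (?V e)" if "e \<in> dirs" for e by (intro Ck_mult w1 Ck2_pd[OF w(1) that])
  have pV: "pd e (?V e) = (\<lambda>p. (pd e w p)\<^sup>2 + pd e (pd e w) p * w p)" if e: "e \<in> dirs" for e
    using pd_mult[OF w1 Ck2_pd[OF w(1) e] e] by (simp add: power2_eq_square)
  have Vper: "periodic X (?V e)" for e by (rule periodic_comp2[OF w(2) periodic_pd[OF w(2)]])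
  have Vint: "integral (torus X) (pd e (?V e)) = 0" if e: "e \<in> dirs" for e
    by (rule integral_pd[OF V1[OF e] Vper e])
  have Vcont: "continuous_on UNIV (pd e (?V e))" if e: "e \<in> dirs" for e
    using Ck_pd[OF V1[OF e] e] by simp
  let ?E = "\<lambda>p. (pd (1, 0) w p)\<^sup>2 + (pd (0, 1) w p)\<^sup>2"
  have E_eq: "?E = (\<lambda>p. pd (1, 0) (?V (1, 0)) p + pd (0, 1) (?V (0, 1)) p)"
  proof
    fix p
    have "pd (1, 0) (pd (1, 0) w) p = - pd (0, 1) (pd (0, 1) w) p"
      using h[of p] by (simp add: laplacian_pd)
    then show "?E p = pd (1, 0) (?V (1, 0)) p + pd (0, 1) (?V (0, 1)) p"
      unfolding pV[OF dirs12(1)] pV[OF dirs12(2)] by simp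
  qed
  have int0: "integral (torus X) ?E = 0"
    unfolding E_eq by (subst integral_add) (auto intro!: integrable_torus Vcont dirs12 simp: Vint dirs12)
  have Econt: "continuous_on UNIV ?E"
    unfolding E_eq by (intro continuous_intros Vcont dirs12)
  have "box (- fst X, - snd X) (fst X, snd X) \<noteq> {}"
  proof -
    have "(0, 0) \<in> box (- fst X, - snd X) (fst X, snd X)"
      using X1 X2 by (simp add: mem_box Basis_prod_def inner_prod_def)
    then show ?thesis by blast
  qed
  then have "\<forall>p\<in>torus X. ?E p = 0"
    using integral_cbox_eq_0_iff[of "(- fst X, - snd X)" "(fst X, snd X)" ?E] int0
      continuous_on_subset[OF Econt] unfolding torus_eq by auto
  then have E0: "\<And>p. p \<in> torus X \<Longrightarrow> pd (1, 0) w p = 0 \<and> pd (0, 1) w p = 0"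
    by (simp add: sum_power2_eq_zero_iff)
  have "\<bar>pd e w p\<bar> \<le> 0" if e: "e \<in> dirs" for e p
  proof -
    obtain q where q: "q \<in> torus X" "\<And>u. periodic X u \<Longrightarrow> u q = u p"
      by (rule torus_rep[OF X1 X2]) blast
    have "pd e w p = pd e w q" using q(2)[OF periodic_pd[OF w(2)]] by simp
    then show ?thesis using E0[OF q(1)] e by (auto simp: dirs_def)
  qed
  from pd_lipschitz2[OF w1 this, of q "fst p - fst q" "snd p - snd q"]
  show ?thesis by (cases p; cases q) simp
qed

lemma inv_neg_laplacian_eqI:
  assumes u: "periodic X u" "Ck 2 u" "integral (torus X) u = 0"
    and eq: "\<And>p. - laplacian u p = g p - 1 / area X * integral (torus X) g"
  shows "inv_neg_laplacian X g = u"
  unfolding inv_neg_laplacian_def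
proof (rule the_equality)
  show "periodic X u \<and> Ck 2 u \<and> integral (torus X) u = 0 \<and>
     (\<forall>x. - laplacian u x = g x - 1 / area X * integral (torus X) g)"
    using assms by blast
  fix v assume v: "periodic X v \<and> Ck 2 v \<and> integral (torus X) v = 0 \<and>
     (\<forall>x. - laplacian v x = g x - 1 / area X * integral (torus X) g)"
  have lap: "laplacian v p = laplacian u p" for p
  proof -
    have "- laplacian v p = - laplacian u p" unfolding eq using v by blast
    then show ?thesis by simp
  qed
  have const: "v p - u p = v 0 - u 0" for p
  proof (rule harmonic_const[of "\<lambda>p. v p - u p"])
    show "Ck 2 (\<lambda>p. v p - u p)" by (rule Ck_diff) (use v u in auto)
    show "periodic X (\<lambda>p. v p - u p)" by (rule periodic_comp2) (use v u in auto)
    show "laplacian (\<lambda>p. v p - u p) p = 0" for p using laplacian_diff[of v u p] v u lap by simp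
  qed
  have "integral (torus X) (\<lambda>p. v p - u p) = 0"
    by (subst integral_diff) (use v u in \<open>auto intro!: integrable_torus Ck_continuous[of 2]\<close>)
  moreover have "(\<lambda>p. v p - u p) = (\<lambda>_. v 0 - u 0)" using const by (intro ext)
  ultimately have "area X * (v 0 - u 0) = 0" by (simp only: integral_const)
  then have "v 0 - u 0 = 0" using area_pos by simp
  then show "v = u" using const by (auto simp: fun_eq_iff)
qed

text \<open>Integration identifies the constant in \<open>poisson_limit\<close> as the mean of \<open>g\<close>, so that the limit,
corrected by its own mean, is the inverse Laplacian of \<open>g\<close>.\<close>

lemma poisson_solution:
  assumes g: "periodic X g" "Ck 4 g"
  obtains U u0 where "\<And>n. periodic X (U n)" "\<And>n. Ck 4 (U n)"
    "\<And>K n e p. (\<And>e p. e \<in> dirs \<Longrightarrow> \<bar>(pd e ^^ 4) g p\<bar> \<le> K) \<Longrightarrow> e \<in> dirs \<Longrightarrow> \<bar>(pd e ^^ 4) (U n) p\<bar> \<le> SC * (2 * K)"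
    "uniform_limit UNIV U u0 sequentially" "\<And>p. (\<lambda>n. laplacian (U n) p) \<longlonglongrightarrow> laplacian u0 p"
    "periodic X u0" "Ck 2 u0" "\<And>p. - laplacian u0 p = g p - 1 / area X * integral (torus X) g"
    "inv_neg_laplacian X g = (\<lambda>p. u0 p - integral (torus X) u0 / area X)"
proof -
  obtain U u0 c where U: "\<And>n. periodic X (U n)" "\<And>n. Ck 4 (U n)"
    "\<And>K n e p. (\<And>e p. e \<in> dirs \<Longrightarrow> \<bar>(pd e ^^ 4) g p\<bar> \<le> K) \<Longrightarrow> e \<in> dirs \<Longrightarrow> \<bar>(pd e ^^ 4) (U n) p\<bar> \<le> SC * (2 * K)"
    "uniform_limit UNIV U u0 sequentially" "\<And>p. (\<lambda>n. laplacian (U n) p) \<longlonglongrightarrow> laplacian u0 p"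
    and u0: "periodic X u0" "Ck 2 u0" "\<And>p. - laplacian u0 p = g p - c"
    by (rule poisson_limit[OF g]) blast
  have "c = 1 / area X * integral (torus X) g"
  proof -
    have "(\<lambda>p. g p - c) = (\<lambda>p. - laplacian u0 p)" using u0(3) by simp
    then have "integral (torus X) (\<lambda>p. g p - c) = 0"
      using integral_laplacian[OF u0(2,1)] by simp
    moreover have "integral (torus X) (\<lambda>p. g p - c) = integral (torus X) g - area X * c"
      by (subst integral_diff) (auto intro!: integrable_torus Ck_continuous[OF g(2)] simp: integral_const)
    ultimately show ?thesis using area_pos by (simp add: field_simps)
  qed
  with u0(3) have eq: "- laplacian u0 p = g p - 1 / area X * integral (torus X) g" for p by simp
  let ?m = "integral (torus X) u0 / area X"
  have "inv_neg_laplacian X g = (\<lambda>p. u0 p - ?m)"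
  proof (rule inv_neg_laplacian_eqI)
    show "periodic X (\<lambda>p. u0 p - ?m)" by (rule periodic_comp[OF u0(1)])
    show "Ck 2 (\<lambda>p. u0 p - ?m)" by (intro Ck_diff Ck_const u0)
    show "integral (torus X) (\<lambda>p. u0 p - ?m) = 0"
      using area_pos
      by (subst integral_diff) (auto intro!: integrable_torus Ck_continuous[OF u0(2)] simp: integral_const)
    show "- laplacian (\<lambda>p. u0 p - ?m) p = g p - 1 / area X * integral (torus X) g" for p
      using eq laplacian_diff_const[OF u0(2)] by simp
  qed
  with U u0 eq that show ?thesis by blast
qed

lemma inv_neg_laplacian_regular:
  assumes g: "periodic X g" "Ck 4 g"
  shows "periodic X (inv_neg_laplacian X g)" "continuous_on UNIV (inv_neg_laplacian X g)"
proof -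
  obtain u0 where "periodic X u0" "Ck 2 u0"
    "inv_neg_laplacian X g = (\<lambda>p. u0 p - integral (torus X) u0 / area X)"
    by (rule poisson_solution[OF g]) blast
  then show "periodic X (inv_neg_laplacian X g)" "continuous_on UNIV (inv_neg_laplacian X g)"
    by (auto intro!: periodic_comp[of X u0] continuous_intros Ck_continuous[of 2 u0])
qed

end

context torus_grid begin

lemma box: "torus_box X"
  by unfold_locales (rule X1 X2)+

section \<open>Consistency of quadrature and of the discrete inverse Laplacian\<close>

text \<open>The discrete Laplacian is consistent of second order on every limit of functions with uniformly bounded fourth
derivatives.\<close>

lemma poisson_consistency:
  assumes U: "\<And>n. Ck 4 (U n)" "\<And>n e p. e \<in> dirs \<Longrightarrow> \<bar>(pd e ^^ 4) (U n) p\<bar> \<le> K"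
    and lim: "uniform_limit UNIV U u sequentially" "\<And>p. (\<lambda>n. laplacian (U n) p) \<longlonglongrightarrow> laplacian u p"
  shows "\<bar>Lh (trace u x) k - laplacian u (x + gpt X N k)\<bar> \<le> K * ((h1 X N)\<^sup>2 + (h2 X N)\<^sup>2)"
proof -
  have l: "(\<lambda>n. U n p) \<longlonglongrightarrow> u p" for p by (rule tendsto_uniform_limitI[OF lim(1)]) simp
  have "(\<lambda>n. \<bar>Lh (trace (U n) x) k - laplacian (U n) (x + gpt X N k)\<bar>)
     \<longlonglongrightarrow> \<bar>Lh (trace u x) k - laplacian u (x + gpt X N k)\<bar>"
    unfolding laplacian_h_sdiff sdiff_def
    by (intro tendsto_intros l lim) (use h1_pos h2_pos in auto)
  then show ?thesis
    by (rule LIMSEQ_le_const2) (use laplacian_consistency[OF U] in auto)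
qed

text \<open>The error of the trapezoidal rule is of second order. The solution of the Poisson problem with data \<open>g\<close>
transfers it to the consistency error of the discrete Laplacian, because the Laplacian and the discrete
Laplacian both have mean zero.\<close>

lemma quadrature:
  assumes g: "periodic X g" "Ck 4 g"
    and K: "\<And>e p. e \<in> dirs \<Longrightarrow> \<bar>(pd e ^^ 4) g p\<bar> \<le> K"
  shows "\<bar>gmean g x - integral (torus X) g / area X\<bar> \<le> SC * (2 * K) * ((h1 X N)\<^sup>2 + (h2 X N)\<^sup>2)"
proof -
  obtain U u0 where U: "\<And>n. Ck 4 (U n)"
    "\<And>K n e p. (\<And>e p. e \<in> dirs \<Longrightarrow> \<bar>(pd e ^^ 4) g p\<bar> \<le> K) \<Longrightarrow> e \<in> dirs \<Longrightarrow> \<bar>(pd e ^^ 4) (U n) p\<bar> \<le> SC * (2 * K)"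
    "uniform_limit UNIV U u0 sequentially" "\<And>p. (\<lambda>n. laplacian (U n) p) \<longlonglongrightarrow> laplacian u0 p"
    and u0: "periodic X u0" "\<And>p. - laplacian u0 p = g p - 1 / area X * integral (torus X) g"
    by (rule torus_box.poisson_solution[OF box g]) blast
  let ?r = "\<lambda>k. Lh (trace u0 x) k - laplacian u0 (x + gpt X N k)"
  have r: "\<bar>?r k\<bar> \<le> SC * (2 * K) * ((h1 X N)\<^sup>2 + (h2 X N)\<^sup>2)" for k
    by (rule poisson_consistency[OF U(1) U(2)[OF K] U(3,4)])
  have "gs ?r = gs (\<lambda>k. Lh (trace u0 x) k + (trace g x k - integral (torus X) g / area X))"
  proof (rule sum.cong)
    show "?r k = Lh (trace u0 x) k + (trace g x k - integral (torus X) g / area X)" for k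
      using u0(2)[of "x + gpt X N k"] by simp
  qed simp
  then have "gs ?r / nn = gmean g x - integral (torus X) g / area X"
    using nn_pos gs_laplacian[OF trace_gridfun[OF u0(1)]]
    by (simp add: sum.distrib sum_subtractf card_grid gmean_def diff_divide_distrib)
  then show ?thesis using mean_abs_le[of ?r, OF r] by simp
qed

text \<open>The discrete and the continuous inverse Laplacian differ by an error of second order. The discrete Laplacian
of the difference is a consistency error, so the oscillation is small, and the mean is a quadrature error of the
approximations \<open>U n\<close>.\<close>

lemma inv_laplacian_consistency:
  assumes g: "periodic X g" "Ck 4 g"
    and K: "\<And>e p. e \<in> dirs \<Longrightarrow> \<bar>(pd e ^^ 4) g p\<bar> \<le> K"
  shows "\<bar>inv_neg_laplacian X g (x + gpt X N k) - invh (trace g x) k\<bar>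
    \<le> 8 * SC * (SC * K) * ((h1 X N)\<^sup>2 + (h2 X N)\<^sup>2)"
proof -
  obtain U u0 where U: "\<And>n. periodic X (U n)" "\<And>n. Ck 4 (U n)"
    "\<And>K n e p. (\<And>e p. e \<in> dirs \<Longrightarrow> \<bar>(pd e ^^ 4) g p\<bar> \<le> K) \<Longrightarrow> e \<in> dirs \<Longrightarrow> \<bar>(pd e ^^ 4) (U n) p\<bar> \<le> SC * (2 * K)"
    "uniform_limit UNIV U u0 sequentially" "\<And>p. (\<lambda>n. laplacian (U n) p) \<longlonglongrightarrow> laplacian u0 p"
    and u0: "periodic X u0" "Ck 2 u0" "\<And>p. - laplacian u0 p = g p - 1 / area X * integral (torus X) g"
    and inv: "inv_neg_laplacian X g = (\<lambda>p. u0 p - integral (torus X) u0 / area X)"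
    by (rule torus_box.poisson_solution[OF box g]) blast
  define H where "H = (h1 X N)\<^sup>2 + (h2 X N)\<^sup>2"
  have UK: "\<bar>(pd e ^^ 4) (U n) p\<bar> \<le> SC * (2 * K)" if "e \<in> dirs" for n e p
    by (rule U(3)[OF K that])
  have r: "\<bar>Lh (trace u0 x) k - laplacian u0 (x + gpt X N k)\<bar> \<le> SC * (2 * K) * H" for k
    unfolding H_def by (rule poisson_consistency[OF U(2) UK U(4,5)])
  let ?m = "integral (torus X) u0 / area X"
  have mean_u: "\<bar>gmean u0 x - ?m\<bar> \<le> SC * (2 * (SC * (2 * K))) * H"
  proof -
    have l: "(\<lambda>n. U n p) \<longlonglongrightarrow> u0 p" for p by (rule tendsto_uniform_limitI[OF U(4)]) simp
    have "uniform_limit (cbox (- X) X) U u0 sequentially"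
      by (rule uniform_limit_on_subset[OF U(4)]) simp
    then obtain I J where I: "\<And>n. (U n has_integral I n) (cbox (- X) X)"
      "(u0 has_integral J) (cbox (- X) X)" "I \<longlonglongrightarrow> J"
      by (rule uniform_limit_integral_cbox) (auto intro!: Ck_continuous[OF U(2)])
    then have int: "(\<lambda>n. integral (torus X) (U n)) \<longlonglongrightarrow> integral (torus X) u0"
      by (simp add: torus_def integral_unique[OF I(1)] integral_unique[OF I(2)])
    have "(\<lambda>n. \<bar>gmean (U n) x - integral (torus X) (U n) / area X\<bar>) \<longlonglongrightarrow> \<bar>gmean u0 x - ?m\<bar>"
      unfolding gmean_def using area_pos nn_pos by (intro tendsto_intros l int) auto
    then show ?thesis
      by (rule LIMSEQ_le_const2) (use quadrature[OF U(1,2) UK] in \<open>auto simp: H_def\<close>)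
  qed
  define d where "d = (\<lambda>k. inv_neg_laplacian X g (x + gpt X N k) - invh (trace g x) k)"
  have tg: "trace g x \<in> gridfuns N" by (rule trace_gridfun[OF g(1)])
  have d_per: "d \<in> gridfuns N"
  proof -
    have "trace (inv_neg_laplacian X g) x \<in> gridfuns N"
      by (rule trace_gridfun[OF torus_box.inv_neg_laplacian_regular(1)[OF box g]])
    then show ?thesis unfolding d_def by (rule gridfuns_comp2[OF _ inv_h_props(1)[OF tg]])
  qed
  have Ld: "Lh d k = (Lh (trace u0 x) k - laplacian u0 (x + gpt X N k)) - (gmean g x - integral (torus X) g / area X)" for k
  proof -
    have "sdiff e d k = sdiff e (trace u0 x) k - sdiff e (invh (trace g x)) k" for e
      by (simp add: sdiff_def d_def inv)
    then have "Lh d k = Lh (trace u0 x) k - Lh (invh (trace g x)) k"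
      by (simp add: laplacian_h_sdiff diff_divide_distrib)
    also have "Lh (invh (trace g x)) k = gmean g x - g (x + gpt X N k)"
      by (simp add: inv_h_props(3)[OF tg] gmean_def)
    finally show ?thesis using u0(3)[of "x + gpt X N k"] by simp
  qed
  have "\<bar>Lh d k\<bar> \<le> 2 * (SC * (2 * K) * H)" for k
    unfolding Ld using r[of k] quadrature[OF g K, of x, folded H_def] by linarith
  from osc_stability[OF d_per this] have osc: "\<bar>d k - d l\<bar> \<le> SC * (2 * (SC * (2 * K) * H))" for k l .
  have dm: "gs d / nn = gmean u0 x - ?m"
    using nn_pos inv_h_props(2)[OF tg] by (simp add: d_def inv sum_subtractf card_grid gmean_def diff_divide_distrib)
  have "\<bar>d k - gs d / nn\<bar> \<le> SC * (2 * (SC * (2 * K) * H))"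
  proof (rule abs_le_osc)
    show "(\<lambda>k. d k - gs d / nn) \<in> gridfuns N" by (rule gridfuns_comp[OF d_per])
    show "gs (\<lambda>k. d k - gs d / nn) = 0" using nn_pos by (simp add: sum_subtractf card_grid)
  qed (use osc in simp)
  then have "\<bar>d k\<bar> \<le> SC * (2 * (SC * (2 * K) * H)) + SC * (2 * (SC * (2 * K))) * H"
    using mean_u unfolding dm by linarith
  then show ?thesis by (simp add: d_def H_def algebra_simps)
qed

end

section \<open>Consistency in space of the right-hand side\<close>

lemma pd_pow_add: "Ck n u \<Longrightarrow> Ck n v \<Longrightarrow> e \<in> dirs \<Longrightarrow>
    (pd e ^^ n) (\<lambda>p. u p + v p) = (\<lambda>p. (pd e ^^ n) u p + (pd e ^^ n) v p)"
proof (induction n arbitrary: u v)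
  case (Suc n)
  then show ?case
    unfolding funpow_Suc_right comp_apply pd_add[OF Suc.prems]
    by (intro Suc.IH Ck_pd)
qed simp

lemma pd_pow_mult_bound:
  assumes "Ck n u" "Ck n v" "e \<in> dirs"
    and "\<And>j p. j \<le> n \<Longrightarrow> \<bar>(pd e ^^ j) u p\<bar> \<le> C" "\<And>j p. j \<le> n \<Longrightarrow> \<bar>(pd e ^^ j) v p\<bar> \<le> D"
  shows "\<bar>(pd e ^^ n) (\<lambda>p. u p * v p) p\<bar> \<le> 2 ^ n * (C * D)"
  using assms
proof (induction n arbitrary: u v C D)
  case 0
  have "\<bar>u p\<bar> \<le> C" "\<bar>v p\<bar> \<le> D" using 0(4)[of 0 p] 0(5)[of 0 p] by simp_all
  then show ?case by (simp add: abs_mult mult_mono)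
next
  case (Suc n)
  let ?u = "pd e u" and ?v = "pd e v"
  have u: "Ck n u" "Ck n ?u" and v: "Ck n v" "Ck n ?v"
    by (rule Ck_SucD Ck_pd; fact)+
  have sh: "(pd e ^^ j) (pd e w) = (pd e ^^ Suc j) w" for j w
    unfolding funpow_Suc_right comp_apply ..
  have ub: "\<bar>(pd e ^^ j) ?u p\<bar> \<le> C" and vb: "\<bar>(pd e ^^ j) ?v p\<bar> \<le> D" if "j \<le> n" for j p
    unfolding sh using Suc.prems(4)[of "Suc j" p] Suc.prems(5)[of "Suc j" p] that by (simp_all del: funpow.simps)
  have ub': "\<bar>(pd e ^^ j) u p\<bar> \<le> C" and vb': "\<bar>(pd e ^^ j) v p\<bar> \<le> D" if "j \<le> n" for j p
    using Suc.prems(4)[of j p] Suc.prems(5)[of j p] that by simp_all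
  have "(pd e ^^ Suc n) (\<lambda>p. u p * v p) p
     = (pd e ^^ n) (\<lambda>p. ?u p * v p) p + (pd e ^^ n) (\<lambda>p. ?v p * u p) p"
    unfolding funpow_Suc_right comp_apply pd_mult[OF Suc.prems(1-3)]
    by (subst pd_pow_add[OF Ck_mult[OF u(2) v(1)] Ck_mult[OF v(2) u(1)] Suc.prems(3)]) simp
  moreover have "\<bar>(pd e ^^ n) (\<lambda>p. ?u p * v p) p\<bar> \<le> 2 ^ n * (C * D)"
    by (rule Suc.IH[OF u(2) v(1) Suc.prems(3) ub vb'])
  moreover have "\<bar>(pd e ^^ n) (\<lambda>p. ?v p * u p) p\<bar> \<le> 2 ^ n * (D * C)"
    by (rule Suc.IH[OF v(2) u(1) Suc.prems(3) vb ub'])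
  ultimately show ?case by (simp add: algebra_simps)
qed

lemma pd_pow_mult_bound':
  assumes "Ck n u" "Ck n v" "e \<in> dirs" "j \<le> n"
    and "\<And>j p. j \<le> n \<Longrightarrow> \<bar>(pd e ^^ j) u p\<bar> \<le> C" "\<And>j p. j \<le> n \<Longrightarrow> \<bar>(pd e ^^ j) v p\<bar> \<le> D"
  shows "\<bar>(pd e ^^ j) (\<lambda>p. u p * v p) p\<bar> \<le> 2 ^ n * (C * D)"
proof -
  have "0 \<le> C" "0 \<le> D" using assms(5)[of 0 0] assms(6)[of 0 0] by simp_all
  have "\<bar>(pd e ^^ j) (\<lambda>p. u p * v p) p\<bar> \<le> 2 ^ j * (C * D)"
    by (rule pd_pow_mult_bound[OF Ck_mono[OF assms(4,1)] Ck_mono[OF assms(4,2)] assms(3)])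
      (use assms(4-6) in auto)
  also have "\<dots> \<le> 2 ^ n * (C * D)"
    using assms(4) \<open>0 \<le> C\<close> \<open>0 \<le> D\<close> by (intro mult_right_mono power_increasing) auto
  finally show ?thesis .
qed

text \<open>Periodic functions of class C4 whose pure partial derivatives up to order 4 are bounded by \<open>B\<close>. Mixed
derivatives need no bound, as their size enters no estimate.\<close>

definition bounded_C4 :: "real \<times> real \<Rightarrow> real \<Rightarrow> (real \<times> real \<Rightarrow> real) \<Rightarrow> bool" where
  "bounded_C4 X B v \<longleftrightarrow> periodic X v \<and> Ck 4 v \<and> (\<forall>e\<in>dirs. \<forall>j\<le>4. \<forall>p. \<bar>(pd e ^^ j) v p\<bar> \<le> B)"

text \<open>A bound for the pure fourth derivatives of \<open>f (v p)\<close> in terms of the bound \<open>B\<close> for those of \<open>v\<close>, obtained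
by applying the Leibniz bound twice to the factorization \<open>f s = s * s * (3 - 2 * s)\<close>.\<close>

definition f_const :: "real \<Rightarrow> real" where
  "f_const B = 2 ^ 4 * (2 ^ 4 * (B * B) * (3 + 2 * B))"

lemma bounded_C4_f:
  assumes v: "bounded_C4 X B v"
  shows "periodic X (\<lambda>p. f (v p) - \<omega>)" "Ck 4 (\<lambda>p. f (v p) - \<omega>)"
    "\<And>e p. e \<in> dirs \<Longrightarrow> \<bar>(pd e ^^ 4) (\<lambda>p. f (v p) - \<omega>) p\<bar> \<le> f_const B"
proof -
  have per: "periodic X v" and v4: "Ck 4 v"
    and vB: "\<And>e j p. e \<in> dirs \<Longrightarrow> j \<le> 4 \<Longrightarrow> \<bar>(pd e ^^ j) v p\<bar> \<le> B"
    using v by (auto simp: bounded_C4_def)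
  have B0: "B \<ge> 0" using vB[of "(1, 0)" 0 0] by (simp add: dirs_def)
  show "periodic X (\<lambda>p. f (v p) - \<omega>)" by (rule periodic_comp[OF per])
  have eq: "(\<lambda>p. f (v p) - \<omega>) = (\<lambda>p. v p * v p * (3 + (- 2) * v p) + (- \<omega>))"
    by (simp add: f_def power2_eq_square power3_eq_cube algebra_simps)
  have vv: "Ck 4 (\<lambda>p. v p * v p)" by (intro Ck_mult v4)
  have lin: "Ck 4 (\<lambda>p. 3 + (- 2) * v p)" by (intro Ck_add Ck_const Ck_cmult v4)
  show "Ck 4 (\<lambda>p. f (v p) - \<omega>)" unfolding eq by (intro Ck_add Ck_mult vv lin Ck_const)
  fix e p assume e: "e \<in> dirs"
  have pc: "(pd e ^^ j) (\<lambda>_. c) = (\<lambda>_. if j = 0 then c else 0)" for j c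
    by (induction j) (auto simp: pd_const)
  have pcm: "Ck j v \<Longrightarrow> (pd e ^^ j) (\<lambda>p. c * v p) = (\<lambda>p. c * (pd e ^^ j) v p)" for j c v
  proof (induction j arbitrary: v)
    case (Suc j)
    then show ?case unfolding funpow_Suc_right comp_apply pd_cmult[OF Suc.prems e] using Ck_pd[OF Suc.prems e] by blast
  qed simp
  have vj: "Ck j v" if "j \<le> 4" for j using Ck_mono[OF that v4] .
  have linB: "\<bar>(pd e ^^ j) (\<lambda>p. 3 + (- 2) * v p) p\<bar> \<le> 3 + 2 * B" if j: "j \<le> 4" for j p
  proof -
    have "(pd e ^^ j) (\<lambda>p. 3 + (- 2) * v p) = (\<lambda>p. (if j = 0 then 3 else 0) + (- 2) * (pd e ^^ j) v p)"
      by (subst pd_pow_add[OF Ck_const Ck_cmult[OF vj[OF j]] e]) (simp only: pc pcm[OF vj[OF j]])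
    then show ?thesis using vB[OF e j, of p] by (auto simp: abs_le_iff)
  qed
  have "(pd e ^^ 4) (\<lambda>p. f (v p) - \<omega>) p = (pd e ^^ 4) (\<lambda>p. v p * v p * (3 + (- 2) * v p)) p"
    unfolding eq by (subst pd_pow_add[OF Ck_mult[OF vv lin] Ck_const e]) (simp add: pc)
  also have "\<bar>\<dots>\<bar> \<le> 2 ^ 4 * (2 ^ 4 * (B * B) * (3 + 2 * B))"
    by (rule pd_pow_mult_bound'[OF vv lin e order_refl _ linB])
      (rule pd_pow_mult_bound'[OF v4 v4 e _ vB[OF e] vB[OF e]])
  finally show "\<bar>(pd e ^^ 4) (\<lambda>p. f (v p) - \<omega>) p\<bar> \<le> f_const B" by (simp add: f_const_def)
qed

lemma bounded_C4_abs_le: "bounded_C4 X B v \<Longrightarrow> \<bar>v p\<bar> \<le> B"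
proof -
  assume "bounded_C4 X B v"
  then have "\<forall>j\<le>4. \<forall>p. \<bar>(pd (1, 0) ^^ j) v p\<bar> \<le> B" unfolding bounded_C4_def dirs_def by blast
  from this[rule_format, of 0 p] show ?thesis by simp
qed

lemma bounded_C4_laplacian:
  assumes "bounded_C4 X B v"
  shows "\<bar>laplacian v p\<bar> \<le> 2 * B"
proof -
  have "\<bar>(pd e ^^ 2) v p\<bar> \<le> B" if "e \<in> dirs" for e
  proof -
    have "\<forall>j\<le>4. \<forall>p. \<bar>(pd e ^^ j) v p\<bar> \<le> B" using assms that unfolding bounded_C4_def by blast
    from this[rule_format, of 2 p] show ?thesis by simp
  qed
  from this[of "(1, 0)"] this[of "(0, 1)"] show ?thesis
    by (simp add: laplacian_pd dirs_def numeral_2_eq_2)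
qed

text \<open>The constant of the spatial consistency error of the right-hand side of the equation.\<close>

definition consistency_const :: "real \<times> real \<Rightarrow> real \<Rightarrow> real \<Rightarrow> real \<Rightarrow> real \<Rightarrow> real \<Rightarrow> real" where
  "consistency_const X \<epsilon> \<gamma> M B K = \<epsilon> * B
     + \<gamma> * (8 * sup_const X * (sup_const X * f_const B)) * K
     + M * (area X * (sup_const X * (2 * f_const B))) * K"

context nonlinearity begin

abbreviation rhs where "rhs \<equiv> pde_rhs X \<epsilon> \<gamma> M \<omega>"

abbreviation CC where "CC \<equiv> consistency_const X \<epsilon> \<gamma> M B K"

text \<open>The size of the spatial error.\<close>

definition hsq :: real where "hsq = (h1 X N)\<^sup>2 + (h2 X N)\<^sup>2"

lemma hsq_nonneg: "hsq \<ge> 0" by (simp add: hsq_def)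

lemma rhs_consistency:
  assumes v: "bounded_C4 X B v"
  shows "\<bar>rhs v (gpt X N k) - (\<epsilon> * Lh (on_grid X N v) k + Fh (on_grid X N v) k)\<bar> \<le> CC * hsq"
proof -
  let ?x = "gpt X N k" and ?g = "\<lambda>p. f (v p) - \<omega>"
  have v4: "Ck 4 v" and vB: "\<And>e p. e \<in> dirs \<Longrightarrow> \<bar>(pd e ^^ 4) v p\<bar> \<le> B" and per: "periodic X v"
    using v by (auto simp: bounded_C4_def)
  note g = bounded_C4_f[OF v, where \<omega> = \<omega>]
  have og: "on_grid X N v = trace v 0" by (simp add: on_grid_gpt)
  have df: "\<bar>deriv f (v ?x)\<bar> \<le> K" by (rule df_bd[OF bounded_C4_abs_le[OF v]])
  have a: "\<bar>laplacian v ?x - Lh (trace v 0) k\<bar> \<le> B * hsq"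
    using laplacian_consistency[OF v4 vB, of 0 k] by (simp add: hsq_def abs_minus_commute)
  have b: "\<bar>inv_neg_laplacian X ?g ?x - invh (trace ?g 0) k\<bar> \<le> 8 * SC * (SC * f_const B) * hsq"
    using inv_laplacian_consistency[OF g(1,2) g(3), of 0 k] by (simp add: hsq_def)
  have c: "\<bar>integral (torus X) ?g - inner_h X N (trace ?g 0) (\<lambda>_. 1)\<bar> \<le> area X * (SC * (2 * f_const B)) * hsq"
  proof -
    have "integral (torus X) ?g - inner_h X N (trace ?g 0) (\<lambda>_. 1)
      = area X * (integral (torus X) ?g / area X - gmean ?g 0)"
      using area_pos by (simp add: inner_h_one gmean_def field_simps)
    also have "\<bar>\<dots>\<bar> = area X * \<bar>gmean ?g 0 - integral (torus X) ?g / area X\<bar>"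
      using area_pos by (simp add: abs_mult abs_minus_commute)
    also have "\<dots> \<le> area X * (SC * (2 * f_const B) * ((h1 X N)\<^sup>2 + (h2 X N)\<^sup>2))"
      using area_pos by (intro mult_left_mono quadrature[OF g(1,2) g(3)]) auto
    finally show ?thesis by (simp add: hsq_def mult.assoc)
  qed
  have A: "\<bar>\<epsilon> * (laplacian v ?x - Lh (trace v 0) k)\<bar> \<le> \<epsilon> * (B * hsq)"
    using a eps by (simp add: abs_mult)
  have B': "\<bar>\<gamma> * ((inv_neg_laplacian X ?g ?x - invh (trace ?g 0) k) * deriv f (v ?x))\<bar>
     \<le> \<gamma> * (8 * SC * (SC * f_const B) * hsq * K)"
  proof -
    have "\<bar>inv_neg_laplacian X ?g ?x - invh (trace ?g 0) k\<bar> * \<bar>deriv f (v ?x)\<bar> \<le> 8 * SC * (SC * f_const B) * hsq * K"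
      by (rule mult_mono[OF b df order_trans[OF abs_ge_zero b]]) simp
    then show ?thesis using gam by (simp add: abs_mult)
  qed
  have C': "\<bar>M * ((integral (torus X) ?g - inner_h X N (trace ?g 0) (\<lambda>_. 1)) * deriv f (v ?x))\<bar>
     \<le> M * (area X * (SC * (2 * f_const B)) * hsq * K)"
  proof -
    have "\<bar>integral (torus X) ?g - inner_h X N (trace ?g 0) (\<lambda>_. 1)\<bar> * \<bar>deriv f (v ?x)\<bar>
        \<le> area X * (SC * (2 * f_const B)) * hsq * K"
      by (rule mult_mono[OF c df order_trans[OF abs_ge_zero c]]) simp
    then show ?thesis using Mpos by (simp add: abs_mult)
  qed
  have eq: "rhs v ?x - (\<epsilon> * Lh (trace v 0) k + Fh (trace v 0) k)
    = \<epsilon> * (laplacian v ?x - Lh (trace v 0) k)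
      - \<gamma> * ((inv_neg_laplacian X ?g ?x - invh (trace ?g 0) k) * deriv f (v ?x))
      - M * ((integral (torus X) ?g - inner_h X N (trace ?g 0) (\<lambda>_. 1)) * deriv f (v ?x))"
  proof -
    have "\<epsilon> * l - w - \<gamma> * i * d - M * n * d - (\<epsilon> * l' + (- w - \<gamma> * i' * d - M * n' * d))
      = \<epsilon> * (l - l') - \<gamma> * ((i - i') * d) - M * ((n - n') * d)" for l l' w i i' d n n' :: real
      by (simp add: algebra_simps)
    then show ?thesis unfolding pde_rhs_def nonlin_h_def add_0 .
  qed
  have t: "\<bar>x - y - z\<bar> \<le> \<bar>x\<bar> + \<bar>y\<bar> + \<bar>z\<bar>" for x y z :: real by linarith
  have le: "\<bar>rhs v ?x - (\<epsilon> * Lh (trace v 0) k + Fh (trace v 0) k)\<bar>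
    \<le> \<epsilon> * (B * hsq) + \<gamma> * (8 * SC * (SC * f_const B) * hsq * K) + M * (area X * (SC * (2 * f_const B)) * hsq * K)"
    unfolding eq by (rule order_trans[OF t add_mono[OF add_mono[OF A B'] C']])
  have "\<epsilon> * (B * hsq) + \<gamma> * (8 * SC * (SC * f_const B) * hsq * K) + M * (area X * (SC * (2 * f_const B)) * hsq * K)
     = CC * hsq" unfolding consistency_const_def by (simp only: distrib_right distrib_left mult_ac)
  with le show ?thesis unfolding og by (simp only:)
qed

end

context torus_box begin

lemma rhs_regular:
  assumes v: "bounded_C4 X B v"
  shows "periodic X (pde_rhs X \<epsilon> \<gamma> M \<omega> v)" "continuous_on UNIV (pde_rhs X \<epsilon> \<gamma> M \<omega> v)"
proof -
  have v4: "Ck 4 v" and v2: "Ck 2 v" and per: "periodic X v"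
    using v Ck_mono[of 2 4 v] by (auto simp: bounded_C4_def)
  note i = inv_neg_laplacian_regular[OF bounded_C4_f(1,2)[OF v, where \<omega> = \<omega>]]
  have eq: "pde_rhs X \<epsilon> \<gamma> M \<omega> v = (\<lambda>x. \<epsilon> * laplacian v x - 1 / \<epsilon> * deriv W (v x)
     - \<gamma> * inv_neg_laplacian X (\<lambda>y. f (v y) - \<omega>) x * deriv f (v x)
     - M * integral (torus X) (\<lambda>y. f (v y) - \<omega>) * deriv f (v x))"
    by (simp add: fun_eq_iff pde_rhs_def)
  show "periodic X (pde_rhs X \<epsilon> \<gamma> M \<omega> v)"
    using periodic_laplacian[OF per] i(1) per unfolding eq periodic_def by simp
  show "continuous_on UNIV (pde_rhs X \<epsilon> \<gamma> M \<omega> v)"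
    unfolding eq deriv_W deriv_f
    by (intro continuous_intros continuous_laplacian v2 i(2) Ck_continuous[OF v4])
qed

end

section \<open>Regularity in time\<close>

lemma AE_negligible:
  assumes "AE x in lborel. P (x::'a::euclidean_space)"
  obtains S where "negligible S" "\<And>x. x \<notin> S \<Longrightarrow> P x"
proof -
  obtain S where "{x \<in> space lborel. \<not> P x} \<subseteq> S" "S \<in> null_sets lborel"
    using assms unfolding eventually_ae_filter by blast
  then show ?thesis
    by (intro that[of S]) (auto simp: negligible_iff_null_sets intro: null_sets_completionI)
qed

text \<open>The complement of a null set is dense in the box.\<close>

lemma le_off_negligible:
  fixes F :: "'a::euclidean_space \<Rightarrow> real"
  assumes cont: "continuous_on (cbox a b) F" and S: "negligible S" and ne: "box a b \<noteq> {}"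
    and le: "\<And>x. x \<in> box a b \<Longrightarrow> x \<notin> S \<Longrightarrow> F x \<le> c" and x: "x \<in> cbox a b"
  shows "F x \<le> c"
proof -
  have "F y \<le> c" if y: "y \<in> box a b" for y
  proof (rule ccontr)
    assume "\<not> F y \<le> c"
    let ?O = "box a b \<inter> F -` {c<..}"
    have "open ?O"
      by (rule continuous_open_preimage[OF continuous_on_subset[OF cont box_subset_cbox]]) auto
    moreover have "?O \<noteq> {}" using y \<open>\<not> F y \<le> c\<close> by auto
    ultimately have "\<not> negligible ?O" by (rule open_not_negligible)
    moreover have "?O \<subseteq> S" using le by force
    ultimately show False using S negligible_subset by blast
  qed
  moreover have "closure (box a b) = cbox a b" by (rule closure_box[OF ne])
  ultimately show ?thesis using continuous_le_on_closure[of "box a b" F x c] cont x by simp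
qed

lemma integral_diff_AE_bounded:
  fixes g :: "real \<Rightarrow> real"
  assumes g: "g \<in> borel_measurable borel" and S: "negligible S"
    and bd: "\<And>s. s \<in> {0..T} \<Longrightarrow> s \<notin> S \<Longrightarrow> \<bar>g s\<bar> \<le> B"
    and st: "0 \<le> s" "s \<le> t" "t \<le> T"
  shows "\<bar>integral {0..t} g - integral {0..s} g\<bar> \<le> \<bar>B\<bar> * (t - s)"
proof -
  \<comment> \<open>a bounded measurable version of \<open>g\<close>, whose integrability is available\<close>
  define g' where "g' x = (if \<bar>g x\<bar> \<le> B then g x else 0)" for x
  have m: "g' \<in> borel_measurable borel" unfolding g'_def using g by measurable
  have gB: "\<bar>g' x\<bar> \<le> \<bar>B\<bar>" for x by (auto simp: g'_def)
  have "set_integrable lborel {0..T} g'"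
    unfolding set_integrable_def
  proof (rule integrableI_bounded_set_indicator[of _ _ _ "\<bar>B\<bar>"])
    show "emeasure lborel {0..T} < \<infinity>" by (simp add: emeasure_lborel_Icc_eq)
    show "g' \<in> borel_measurable lborel" using m by simp
  qed (use gB in auto)
  then have "g' integrable_on {0..T}" by (rule set_borel_integral_eq_integral)
  then have gi: "g integrable_on {0..T}"
    by (rule integrable_spike[OF _ S]) (use bd in \<open>auto simp: g'_def\<close>)
  then have "g integrable_on {0..t}" by (rule integrable_on_subinterval) (use st in auto)
  then have "integral {0..t} g - integral {0..s} g = integral {s..t} g"
    using Henstock_Kurzweil_Integration.integral_combine[OF st(1,2), of g] by simp
  also have "\<dots> = integral {s..t} g'"
    by (rule integral_spike[OF S]) (use bd st in \<open>auto simp: g'_def\<close>)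
  also have "norm \<dots> \<le> \<bar>B\<bar> * (t - s)"
  proof -
    have "g' integrable_on {s..t}"
      by (rule integrable_on_subinterval[OF \<open>g' integrable_on {0..T}\<close>]) (use st in auto)
    then have "(g' has_integral integral {s..t} g') {s..t}" by (rule integrable_integral)
    from has_integral_bound[of "\<bar>B\<bar>" g' _ s t, unfolded cbox_interval, OF _ this] show ?thesis
      using gB st by simp
  qed
  finally show ?thesis by simp
qed

lemma AE_swap_bound:
  fixes \<psi> :: "real \<times> (real \<times> real) \<Rightarrow> real"
  assumes m: "\<psi> \<in> borel_measurable borel"
    and bd: "AE p in lborel. p \<in> {0..T} \<times> torus X \<longrightarrow> \<bar>\<psi> p\<bar> \<le> B"
  shows "AE x in lborel. x \<in> torus X \<longrightarrow> (AE s in lborel. s \<in> {0..T} \<longrightarrow> \<bar>\<psi> (s, x)\<bar> \<le> B)"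
proof -
  have m': "\<psi> \<in> borel_measurable (lborel \<Otimes>\<^sub>M lborel)" using m by (simp add: lborel_prod)
  have c: "closed (torus X)" unfolding torus_def by (rule closed_cbox)
  \<comment> \<open>the two almost-everywhere quantifiers of Fubini may be interchanged for measurable sets\<close>
  have meas: "{z \<in> space (lborel \<Otimes>\<^sub>M lborel). fst z \<in> {0..T} \<and> snd z \<in> torus X \<longrightarrow> \<bar>\<psi> (fst z, snd z)\<bar> \<le> B}
      \<in> sets (lborel \<Otimes>\<^sub>M lborel)"
  proof -
    note m'[measurable]
    have [measurable]: "torus X \<in> sets borel" using c by (rule borel_closed)
    show ?thesis unfolding prod.collapse by measurable
  qed
  have "AE z in lborel \<Otimes>\<^sub>M lborel. z \<in> {0..T} \<times> torus X \<longrightarrow> \<bar>\<psi> z\<bar> \<le> B"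
    using bd unfolding lborel_prod .
  then have "AE s in lborel. AE x in lborel. (s, x) \<in> {0..T} \<times> torus X \<longrightarrow> \<bar>\<psi> (s, x)\<bar> \<le> B"
    by (rule lborel_pair.AE_pair)
  then have "AE s in lborel. AE x in lborel. s \<in> {0..T} \<and> x \<in> torus X \<longrightarrow> \<bar>\<psi> (s, x)\<bar> \<le> B" by simp
  then have "AE x in lborel. AE s in lborel. s \<in> {0..T} \<and> x \<in> torus X \<longrightarrow> \<bar>\<psi> (s, x)\<bar> \<le> B"
    by (subst (asm) lborel_pair.AE_commute[OF meas])
  then show ?thesis
  proof eventually_elim
    case (elim x)
    then show ?case by (cases "x \<in> torus X") simp_all
  qed
qed

text \<open>The derivative exists everywhere but is bounded only off a null set, so the mean value theorem does not apply.
The fundamental theorem for the Henstock-Kurzweil integral does, as it needs no integrability hypothesis.\<close>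

lemma increment_bound:
  fixes F p :: "real \<Rightarrow> real"
  assumes ab: "a \<le> b" and K: "K \<ge> 0" and S: "negligible S"
    and der: "\<And>s. s \<in> {a..b} \<Longrightarrow> (F has_real_derivative p s) (at s within {a..b})"
    and bd: "\<And>s. s \<in> {a..b} \<Longrightarrow> s \<notin> S \<Longrightarrow> \<bar>p s - c\<bar> \<le> K"
  shows "\<bar>F b - F a - c * (b - a)\<bar> \<le> K * (b - a)"
proof -
  have "((\<lambda>s. p s - c) has_integral (F b - c * b) - (F a - c * a)) {a..b}"
  proof (rule fundamental_theorem_of_calculus[OF ab])
    fix s assume "s \<in> {a..b}"
    then have "((\<lambda>s. F s - c * s) has_real_derivative p s - c) (at s within {a..b})"
      by (auto intro!: derivative_eq_intros der)
    then show "((\<lambda>s. F s - c * s) has_vector_derivative p s - c) (at s within {a..b})"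
      by (simp add: has_real_derivative_iff_has_vector_derivative)
  qed
  then have "((\<lambda>s. if s \<in> S then 0 else p s - c) has_integral (F b - c * b) - (F a - c * a)) {a..b}"
    by (rule has_integral_spike[OF S, rotated]) auto
  from has_integral_bound[OF K this[unfolded cbox_interval[symmetric]]]
  have "norm ((F b - c * b) - (F a - c * a)) \<le> K * (b - a)"
    using bd ab K by simp
  then show ?thesis by (simp add: algebra_simps)
qed

context torus_box begin

text \<open>The bound on the second time derivative makes the right-hand side of the equation Lipschitz in time, first for
almost every point \<open>x\<close> and then, by continuity and periodicity in \<open>x\<close>, for every point. Continuity requires
the solution of the Poisson problem to exist, whence the restriction to times at which \<open>\<phi>\<close> is of class C4.\<close>

lemma rhs_time_lipschitz:
  assumes T: "T > 0" and ex: "exact_solution X T \<epsilon> \<gamma> M \<omega> \<phi>0 \<phi>" and tt: "tt_Linf X T \<phi>"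
  obtains C where "C \<ge> 0" "\<And>s t x. s \<in> {0..T} \<Longrightarrow> t \<in> {0..T} \<Longrightarrow> bounded_C4 X B (\<phi> s) \<Longrightarrow> bounded_C4 X B (\<phi> t) \<Longrightarrow>
    \<bar>pde_rhs X \<epsilon> \<gamma> M \<omega> (\<phi> t) x - pde_rhs X \<epsilon> \<gamma> M \<omega> (\<phi> s) x\<bar> \<le> C * \<bar>t - s\<bar>"
proof -
  let ?r = "\<lambda>t. pde_rhs X \<epsilon> \<gamma> M \<omega> (\<phi> t)"
  obtain \<psi> :: "real \<times> (real \<times> real) \<Rightarrow> real" and D where m: "\<psi> \<in> borel_measurable borel"
    and bd: "AE p in lborel. p \<in> {0..T} \<times> torus X \<longrightarrow> \<bar>\<psi> p\<bar> \<le> D"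
    and rep: "\<And>t. t \<in> {0..T} \<Longrightarrow> AE x in lborel. x \<in> torus X \<longrightarrow>
           time_deriv T \<phi> t x = time_deriv T \<phi> 0 x + integral {0..t} (\<lambda>s. \<psi> (s, x))"
    using tt unfolding tt_Linf_def by blast
  have td: "time_deriv T \<phi> t x = ?r t x" if t: "t \<in> {0..T}" for t x
  proof -
    have "((\<lambda>s. \<phi> s x) has_real_derivative ?r t x) (at t within {0..T})"
      using ex t unfolding exact_solution_def by blast
    then have "((\<lambda>s. \<phi> s x) has_vector_derivative ?r t x) (at t within {0..T})"
      by (simp add: has_real_derivative_iff_has_vector_derivative)
    then show ?thesis unfolding time_deriv_def
      by (rule vector_derivative_within_closed_interval[OF T t])
  qed
  have main: "\<bar>?r t x - ?r s x\<bar> \<le> \<bar>D\<bar> * (t - s)"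
    if st: "s \<in> {0..T}" "t \<in> {0..T}" "s \<le> t" and g: "bounded_C4 X B (\<phi> s)" "bounded_C4 X B (\<phi> t)" for s t x
  proof -
    have "AE x in lborel. x \<in> torus X \<longrightarrow> \<bar>?r t x - ?r s x\<bar> \<le> \<bar>D\<bar> * (t - s)"
      using rep[OF st(1)] rep[OF st(2)] AE_swap_bound[OF m bd]
    proof eventually_elim
      case (elim x)
      show ?case
      proof
        assume x: "x \<in> torus X"
        then have "AE s in lborel. s \<in> {0..T} \<longrightarrow> \<bar>\<psi> (s, x)\<bar> \<le> D" using elim by blast
        then obtain S where S: "negligible S" "\<And>s. s \<notin> S \<Longrightarrow> s \<in> {0..T} \<longrightarrow> \<bar>\<psi> (s, x)\<bar> \<le> D"
          by (rule AE_negligible) blast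
        have mx: "(\<lambda>s. \<psi> (s, x)) \<in> borel_measurable borel"
          using measurable_compose[OF _ m, of "\<lambda>s. (s, x)" borel] by (simp add: borel_measurable_Pair)
        have "\<bar>integral {0..t} (\<lambda>s. \<psi> (s, x)) - integral {0..s} (\<lambda>s. \<psi> (s, x))\<bar> \<le> \<bar>D\<bar> * (t - s)"
          by (rule integral_diff_AE_bounded[OF mx S(1)]) (use S(2) st in auto)
        moreover have "?r t x = time_deriv T \<phi> 0 x + integral {0..t} (\<lambda>s. \<psi> (s, x))"
          "?r s x = time_deriv T \<phi> 0 x + integral {0..s} (\<lambda>s. \<psi> (s, x))"
          using elim(1,2) x td[OF st(1), of x] td[OF st(2), of x] by simp_all
        ultimately show "\<bar>?r t x - ?r s x\<bar> \<le> \<bar>D\<bar> * (t - s)" by simp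
      qed
    qed
    then obtain S where S: "negligible S" "\<And>x. x \<notin> S \<Longrightarrow> x \<in> torus X \<longrightarrow> \<bar>?r t x - ?r s x\<bar> \<le> \<bar>D\<bar> * (t - s)"
      by (rule AE_negligible) blast
    have ne: "box (- X) X \<noteq> {}"
    proof -
      have "0 \<in> box (- X) X" using X1 X2 by (cases X) (auto simp: mem_box Basis_prod_def inner_prod_def)
      then show ?thesis by blast
    qed
    \<comment> \<open>the estimate is known on the box only; periodicity transfers it to \<open>x\<close>\<close>
    obtain q where q: "q \<in> torus X" "\<And>u. periodic X u \<Longrightarrow> u q = u x"
      by (rule torus_rep[OF X1 X2]) blast
    have "\<bar>?r t q - ?r s q\<bar> \<le> \<bar>D\<bar> * (t - s)"
    proof (rule le_off_negligible[OF _ S(1) ne])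
      show "continuous_on (cbox (- X) X) (\<lambda>x. \<bar>?r t x - ?r s x\<bar>)"
        by (intro continuous_intros continuous_on_subset[OF rhs_regular(2)[OF g(2)]]
            continuous_on_subset[OF rhs_regular(2)[OF g(1)]]) auto
      show "\<bar>?r t x - ?r s x\<bar> \<le> \<bar>D\<bar> * (t - s)" if "x \<in> box (- X) X" "x \<notin> S" for x
        using S(2)[OF that(2)] that(1) box_subset_cbox[of "- X" X] by (auto simp: torus_def)
      show "q \<in> cbox (- X) X" using q(1) by (simp add: torus_def)
    qed
    then show ?thesis using q(2)[OF rhs_regular(1)[OF g(1)]] q(2)[OF rhs_regular(1)[OF g(2)]] by simp
  qed
  show ?thesis
  proof (rule that[of "\<bar>D\<bar>"])
    fix s t x
    assume st: "s \<in> {0..T}" "t \<in> {0..T}" and g: "bounded_C4 X B (\<phi> s)" "bounded_C4 X B (\<phi> t)"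
    show "\<bar>?r t x - ?r s x\<bar> \<le> \<bar>D\<bar> * \<bar>t - s\<bar>"
    proof (cases "s \<le> t")
      case True then show ?thesis using main[OF st True g] by simp
    next
      case False
      then show ?thesis using main[OF st(2,1) _ g(2,1), of x] by (simp add: abs_minus_commute)
    qed
  qed simp
qed

end

section \<open>The residual of the exact solution and convergence\<close>

text \<open>A bound for the time derivative of the exact solution at the grid points.\<close>

definition speed_const :: "real \<times> real \<Rightarrow> real \<Rightarrow> real \<Rightarrow> real \<Rightarrow> real \<Rightarrow> real \<Rightarrow> real" where
  "speed_const X \<epsilon> \<gamma> M B K = \<epsilon> * (2 * B + B * poincare_const X) + lip_const X \<epsilon> \<gamma> M K * B
     + consistency_const X \<epsilon> \<gamma> M B K * poincare_const X"

text \<open>The exact solution seen from a fixed grid. Outside a null set \<open>S\<close> of times it is of class C4 with bounds, and at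
such times its time derivative is Lipschitz with constant \<open>C\<close>.\<close>

locale exact_on_grid = nonlinearity +
  fixes T C :: real and \<phi> :: "real \<Rightarrow> real \<times> real \<Rightarrow> real" and S :: "real set"
  assumes B1: "B \<ge> 1" and T: "T > 0" and C: "C \<ge> 0" and S: "negligible S"
    and per: "\<And>t. t \<in> {0..T} \<Longrightarrow> periodic X (\<phi> t)"
    and der: "\<And>t x. t \<in> {0..T} \<Longrightarrow> ((\<lambda>s. \<phi> s x) has_real_derivative rhs (\<phi> t) x) (at t within {0..T})"
    and good: "\<And>t. t \<in> {0<..<T} \<Longrightarrow> t \<notin> S \<Longrightarrow> bounded_C4 X B (\<phi> t)"
    and rhs_lip: "\<And>s t x. s \<in> {0..T} \<Longrightarrow> t \<in> {0..T} \<Longrightarrow> bounded_C4 X B (\<phi> s) \<Longrightarrow> bounded_C4 X B (\<phi> t) \<Longrightarrow>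
      \<bar>rhs (\<phi> t) x - rhs (\<phi> s) x\<bar> \<le> C * \<bar>t - s\<bar>"
begin

abbreviation SP where "SP \<equiv> speed_const X \<epsilon> \<gamma> M B K"
abbreviation P where "P t \<equiv> on_grid X N (\<phi> t)"

lemma continuous_phi: "continuous_on {0..T} (\<lambda>t. \<phi> t x)"
  by (rule DERIV_continuous_on) (rule der)

lemma phi_bound:
  assumes t: "t \<in> {0..T}"
  shows "\<bar>\<phi> t x\<bar> \<le> B"
proof (rule le_off_negligible[of 0 T "\<lambda>t. \<bar>\<phi> t x\<bar>" S])
  show "continuous_on (cbox 0 T) (\<lambda>t. \<bar>\<phi> t x\<bar>)"
    unfolding cbox_interval by (intro continuous_intros continuous_phi)
  show "\<bar>\<phi> s x\<bar> \<le> B" if "s \<in> box 0 T" "s \<notin> S" for s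
    using bounded_C4_abs_le[OF good[OF _ that(2)]] that(1) by simp
qed (use T t S in auto)

lemma P_gridfun: "t \<in> {0..T} \<Longrightarrow> P t \<in> gridfuns N"
  using trace_gridfun[OF per, of t 0] by (simp add: on_grid_gpt)

lemma P_bound: "t \<in> {0..T} \<Longrightarrow> \<bar>P t k\<bar> \<le> B"
  by (simp add: on_grid_gpt phi_bound)

lemma CC_nonneg: "CC \<ge> 0"
  unfolding consistency_const_def f_const_def
  using eps gam Mpos K B1 SC_nonneg area_pos by (intro add_nonneg_nonneg mult_nonneg_nonneg) auto

lemma hsq_le: "hsq \<le> PC"
proof -
  have "1 \<le> real (fst N)" "1 \<le> real (snd N)" using N1 N2 by linarith+
  then have "h1 X N \<le> 2 * fst X" "h2 X N \<le> 2 * snd X"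
    using h1N h2N h1_pos h2_pos
      mult_left_mono[of 1 "real (fst N)" "h1 X N"] mult_left_mono[of 1 "real (snd N)" "h2 X N"]
    by simp_all
  then have "(h1 X N)\<^sup>2 \<le> (2 * fst X)\<^sup>2" "(h2 X N)\<^sup>2 \<le> (2 * snd X)\<^sup>2"
    using h1_pos h2_pos power_mono[of "h1 X N" "2 * fst X" 2] power_mono[of "h2 X N" "2 * snd X" 2] by auto
  then show ?thesis by (simp add: hsq_def poincare_const_def power_mult_distrib)
qed

lemma SP_nonneg: "SP \<ge> 0"
  unfolding speed_const_def using eps B1 PC_pos LC_nonneg CC_nonneg by simp

lemma rhs_bound:
  assumes g: "bounded_C4 X B v"
  shows "\<bar>rhs v (gpt X N k)\<bar> \<le> SP"
proof -
  have v4: "Ck 4 v" and vB: "\<And>e p. e \<in> dirs \<Longrightarrow> \<bar>(pd e ^^ 4) v p\<bar> \<le> B" and per: "periodic X v"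
    using g by (auto simp: bounded_C4_def)
  have og: "on_grid X N v = trace v 0" by (simp add: on_grid_gpt)
  have vg: "on_grid X N v \<in> gridfuns N" unfolding og by (rule trace_gridfun[OF per])
  have "\<bar>Lh (on_grid X N v) k - laplacian v (0 + gpt X N k)\<bar> \<le> B * hsq"
    unfolding og hsq_def by (rule laplacian_consistency[OF v4 vB])
  moreover have "B * hsq \<le> B * PC" using hsq_le B1 by (intro mult_left_mono) auto
  ultimately have "\<bar>Lh (on_grid X N v) k\<bar> \<le> 2 * B + B * PC"
    using bounded_C4_laplacian[OF g, of "0 + gpt X N k"] by linarith
  then have L: "\<bar>\<epsilon> * Lh (on_grid X N v) k\<bar> \<le> \<epsilon> * (2 * B + B * PC)"
    using eps by (simp add: abs_mult)
  have F: "\<bar>Fh (on_grid X N v) k\<bar> \<le> LC * B"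
  proof -
    \<comment> \<open>the derivatives of \<open>W\<close> and of \<open>f\<close> vanish at 0, hence so does the whole nonlinearity\<close>
    have "Fh (\<lambda>_. 0) k = 0" by (simp add: nonlin_h_def deriv_W deriv_f)
    moreover have "\<bar>Fh (on_grid X N v) k - Fh (\<lambda>_. 0) k\<bar> \<le> LC * B"
      by (rule nonlin_sup[OF vg gridfuns_const]) (use B1 bounded_C4_abs_le[OF g] in \<open>auto simp: on_grid_gpt\<close>)
    ultimately show ?thesis by simp
  qed
  have "CC * hsq \<le> CC * PC" using hsq_le CC_nonneg by (rule mult_left_mono)
  then show ?thesis using L F rhs_consistency[OF g, of k] unfolding speed_const_def by linarith
qed

text \<open>The end points are added, since the bounds are known for interior times only.\<close>

abbreviation S' where "S' \<equiv> S \<union> {0, T}"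

lemma S': "negligible S'"
  using S by (simp add: negligible_Un)

lemma good': "t \<in> {0..T} \<Longrightarrow> t \<notin> S' \<Longrightarrow> bounded_C4 X B (\<phi> t)"
  by (rule good) auto

lemma der_sub:
  assumes "0 \<le> a" "b \<le> T" "s \<in> {a..b}"
  shows "((\<lambda>s. \<phi> s x) has_real_derivative rhs (\<phi> s) x) (at s within {a..b})"
  by (rule DERIV_subset[OF der]) (use assms in auto)

lemma P_lipschitz:
  assumes "s \<in> {0..T}" "t \<in> {0..T}"
  shows "\<bar>P t k - P s k\<bar> \<le> SP * \<bar>t - s\<bar>"
proof -
  have *: "\<bar>P b k - P a k\<bar> \<le> SP * \<bar>b - a\<bar>" if ab: "0 \<le> a" "a \<le> b" "b \<le> T" for a b
  proof -
    have "\<bar>\<phi> b (gpt X N k) - \<phi> a (gpt X N k) - 0 * (b - a)\<bar> \<le> SP * (b - a)"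
      by (rule increment_bound[OF ab(2) SP_nonneg S' der_sub[OF ab(1,3)]])
        (use rhs_bound[OF good'] ab in auto)
    then show ?thesis using ab by (simp add: on_grid_gpt)
  qed
  show ?thesis using *[of s t] *[of t s] assms by (cases "s \<le> t") (auto simp: abs_minus_commute)
qed

text \<open>The semidiscrete right-hand side. For a fixed grid it is continuous at all times, whereas the right-hand side
of the equation is under control only at almost all times.\<close>

abbreviation Rh where "Rh k t \<equiv> \<epsilon> * Lh (P t) k + Fh (P t) k"

lemma continuous_Rh: "continuous_on {0..T} (Rh k)"
proof -
  have "continuous_on {0..T} (\<lambda>t. Lh (P t) k)"
    unfolding laplacian_h_sdiff sdiff_def on_grid_gpt
    using h1_pos h2_pos by (intro continuous_intros continuous_phi) auto
  moreover have "continuous_on {0..T} (\<lambda>t. Fh (P t) k)"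
  proof (rule lipschitz_on_continuous_on[of "LC * SP"], rule lipschitz_onI)
    fix s t assume st: "s \<in> {0..T}" "t \<in> {0..T}"
    have "\<bar>Fh (P s) k - Fh (P t) k\<bar> \<le> LC * (SP * \<bar>s - t\<bar>)"
      by (rule nonlin_sup) (use st in \<open>auto intro: P_gridfun P_bound P_lipschitz\<close>)
    then show "dist (Fh (P s) k) (Fh (P t) k) \<le> LC * SP * dist s t"
      by (simp add: dist_real_def mult.assoc)
  qed (use LC_nonneg SP_nonneg in simp)
  ultimately show ?thesis
    by (intro continuous_on_add continuous_on_mult continuous_on_const)
qed

text \<open>At almost all times \<open>s\<close> and \<open>t\<close> between \<open>a\<close> and \<open>b\<close>, the time derivative at \<open>s\<close> differs from that at
\<open>t\<close> by at most \<open>C * (b - a)\<close>, and the latter from the semidiscrete right-hand side at \<open>t\<close> by the spatial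
error. Letting \<open>t\<close> tend to \<open>b\<close> removes the exceptional times.\<close>

lemma time_residual:
  assumes ab: "0 \<le> a" "a < b" "b \<le> T"
  shows "\<bar>P b k - P a k - Rh k b * (b - a)\<bar> \<le> (C * (b - a) + CC * hsq) * (b - a)"
proof -
  let ?x = "gpt X N k"
  have "\<bar>rhs (\<phi> s) ?x - Rh k b\<bar> \<le> C * (b - a) + CC * hsq" if s: "s \<in> {a..b}" "s \<notin> S'" for s
  proof (rule le_off_negligible[of a b "\<lambda>t. \<bar>rhs (\<phi> s) ?x - Rh k t\<bar>" S'])
    show "continuous_on (cbox a b) (\<lambda>t. \<bar>rhs (\<phi> s) ?x - Rh k t\<bar>)"
      unfolding cbox_interval
      by (intro continuous_on_rabs continuous_on_diff continuous_on_const
          continuous_on_subset[OF continuous_Rh]) (use ab in auto)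
    fix t assume t: "t \<in> box a b" "t \<notin> S'"
    have gs: "bounded_C4 X B (\<phi> s)" and gt: "bounded_C4 X B (\<phi> t)" using good' s t ab by auto
    have "\<bar>rhs (\<phi> s) ?x - rhs (\<phi> t) ?x\<bar> \<le> C * \<bar>s - t\<bar>"
      by (rule rhs_lip[OF _ _ gt gs]) (use s t ab in auto)
    also have "\<dots> \<le> C * (b - a)" using C s t by (intro mult_left_mono) auto
    finally show "\<bar>rhs (\<phi> s) ?x - Rh k t\<bar> \<le> C * (b - a) + CC * hsq"
      using rhs_consistency[OF gt, of k] by linarith
  qed (use ab S' in auto)
  then have "\<bar>\<phi> b ?x - \<phi> a ?x - Rh k b * (b - a)\<bar> \<le> (C * (b - a) + CC * hsq) * (b - a)"
    by (intro increment_bound[OF _ _ S' der_sub[OF ab(1,3)]])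
      (use ab C CC_nonneg hsq_nonneg in auto)
  then show ?thesis by (simp add: on_grid_gpt)
qed

lemma scheme_residual:
  assumes ab: "0 \<le> a" "a < b" "b \<le> T" and \<kappa>: "\<kappa> > 0"
  defines "\<tau> \<equiv> b - a"
  shows "\<bar>(1 / \<tau> + \<kappa> / \<epsilon>) * (P b k - P a k) - \<epsilon> * Lh (P b) k - Fh (P a) k\<bar>
     \<le> (C + CC + \<kappa> / \<epsilon> * SP + LC * SP) * (\<tau> + hsq)"
proof -
  have \<tau>: "\<tau> > 0" using ab by (simp add: \<tau>_def)
  have "\<bar>(P b k - P a k) / \<tau> - Rh k b\<bar> * \<tau> = \<bar>P b k - P a k - Rh k b * \<tau>\<bar>"
  proof -
    have "((P b k - P a k) / \<tau> - Rh k b) * \<tau> = P b k - P a k - Rh k b * \<tau>"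
      using \<tau> by (simp add: left_diff_distrib[of "_ / _"])
    then show ?thesis using \<tau> by (metis abs_mult abs_of_pos)
  qed
  also have "\<dots> \<le> (C * \<tau> + CC * hsq) * \<tau>" unfolding \<tau>_def by (rule time_residual[OF ab])
  finally have 1: "\<bar>(P b k - P a k) / \<tau> - Rh k b\<bar> \<le> C * \<tau> + CC * hsq" using \<tau> by simp
  have lip: "\<bar>P b l - P a l\<bar> \<le> SP * \<tau>" for l
    using P_lipschitz[of a b l] ab by (simp add: \<tau>_def)
  have 2: "\<bar>\<kappa> / \<epsilon> * (P b k - P a k)\<bar> \<le> \<kappa> / \<epsilon> * (SP * \<tau>)"
    unfolding abs_mult using lip[of k] \<kappa> eps by (simp add: mult_left_mono divide_right_mono)
  have 3: "\<bar>Fh (P b) k - Fh (P a) k\<bar> \<le> LC * (SP * \<tau>)"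
    by (rule nonlin_sup) (use ab lip in \<open>auto intro: P_gridfun P_bound\<close>)
  have "(1 / \<tau> + \<kappa> / \<epsilon>) * (P b k - P a k) - \<epsilon> * Lh (P b) k - Fh (P a) k
    = ((P b k - P a k) / \<tau> - Rh k b) + \<kappa> / \<epsilon> * (P b k - P a k) + (Fh (P b) k - Fh (P a) k)"
    by (simp add: distrib_right)
  then have "\<bar>(1 / \<tau> + \<kappa> / \<epsilon>) * (P b k - P a k) - \<epsilon> * Lh (P b) k - Fh (P a) k\<bar>
     \<le> (C * \<tau> + CC * hsq) + \<kappa> / \<epsilon> * (SP * \<tau>) + LC * (SP * \<tau>)"
    using 1 2 3 by linarith
  also have "\<dots> \<le> (C + CC + \<kappa> / \<epsilon> * SP + LC * SP) * (\<tau> + hsq)"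
  proof -
    have "0 \<le> C * hsq" "0 \<le> CC * \<tau>" "0 \<le> \<kappa> / \<epsilon> * SP * hsq" "0 \<le> LC * SP * hsq"
      using C CC_nonneg \<kappa> eps SP_nonneg LC_nonneg hsq_nonneg \<tau> by auto
    then show ?thesis unfolding distrib_left distrib_right mult.assoc by linarith
  qed
  finally show ?thesis .
qed

lemma convergence:
  assumes \<kappa>: "\<kappa> > 0" and Nt: "Nt > 0"
    and stab: "stabilizing X N \<kappa> \<epsilon> \<gamma> M \<omega>"
    and init: "\<Phi> 0 = P 0" and P01: "\<And>x. \<phi> 0 x \<in> {0..1}"
    and \<Phi>: "\<And>n. n \<in> {1..Nt} \<Longrightarrow> \<Phi> n \<in> gridfuns N"
    and scheme: "\<And>n. n < Nt \<Longrightarrow> scheme_step X N (T / real Nt) \<kappa> \<epsilon> \<gamma> M \<omega> (\<Phi> n) (\<Phi> (Suc n))"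
    and n: "n \<le> Nt"
  shows "norm_L2_h X N (\<lambda>k. P (real n * (T / real Nt)) k - \<Phi> n k)
    \<le> sqrt (area X) * T * exp (LC * T) * (C + CC + \<kappa> / \<epsilon> * SP + LC * SP)
        * (T / real Nt + (h1 X N)\<^sup>2 + (h2 X N)\<^sup>2)"
proof -
  let ?\<tau> = "T / real Nt" and ?R = "C + CC + \<kappa> / \<epsilon> * SP + LC * SP"
  have \<tau>: "?\<tau> > 0" using T Nt by simp
  have tn: "real m * ?\<tau> \<in> {0..T}" if "m \<le> Nt" for m
    using that T Nt by (auto simp: field_simps)
  have "norm_L2_h X N (\<lambda>k. P (real n * ?\<tau>) k - \<Phi> n k)
     \<le> sqrt (area X) * (real n * ?\<tau> * exp (LC * (real n * ?\<tau>)) * (?R * (?\<tau> + hsq)))"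
  proof (rule discrete_convergence[where P = "\<lambda>m. P (real m * ?\<tau>)" and \<tau> = ?\<tau> and \<kappa> = \<kappa> and Nt = Nt])
    show "P (real m * ?\<tau>) \<in> gridfuns N" if "m \<le> Nt" for m by (rule P_gridfun[OF tn[OF that]])
    show "\<bar>P (real m * ?\<tau>) k\<bar> \<le> B" if "m \<le> Nt" for m k by (rule P_bound[OF tn[OF that]])
    show "P (real 0 * ?\<tau>) k \<in> {0..1}" for k using P01 by (simp add: on_grid_gpt)
    show "\<Phi> 0 = P (real 0 * ?\<tau>)" using init by simp
    fix m k assume m: "m < Nt"
    have d: "real (Suc m) * ?\<tau> - real m * ?\<tau> = ?\<tau>" unfolding left_diff_distrib[symmetric] by simp
    show "\<bar>(1 / ?\<tau> + \<kappa> / \<epsilon>) * (P (real (Suc m) * ?\<tau>) k - P (real m * ?\<tau>) k)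
        - \<epsilon> * Lh (P (real (Suc m) * ?\<tau>)) k - Fh (P (real m * ?\<tau>)) k\<bar> \<le> ?R * (?\<tau> + hsq)"
    proof (rule scheme_residual[OF _ _ _ \<kappa>, of "real m * ?\<tau>" "real (Suc m) * ?\<tau>" k, unfolded d])
      show "0 \<le> real m * ?\<tau>" "real (Suc m) * ?\<tau> \<le> T" using tn[of m] tn[of "Suc m"] m by auto
      show "real m * ?\<tau> < real (Suc m) * ?\<tau>" using d \<tau> by linarith
    qed
  qed (fact \<tau> \<kappa> B1 \<Phi> scheme stab n)+
  also have "\<dots> \<le> sqrt (area X) * (T * exp (LC * T) * (?R * (?\<tau> + hsq)))"
  proof -
    have "0 \<le> ?R * (?\<tau> + hsq)"
      using C CC_nonneg \<kappa> eps SP_nonneg LC_nonneg hsq_nonneg \<tau>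
      by (intro mult_nonneg_nonneg add_nonneg_nonneg) auto
    moreover have "real n * ?\<tau> * exp (LC * (real n * ?\<tau>)) \<le> T * exp (LC * T)"
    proof (rule mult_mono)
      show "exp (LC * (real n * ?\<tau>)) \<le> exp (LC * T)"
        using tn[OF n] LC_nonneg mult_left_mono[of "real n * ?\<tau>" T LC] unfolding exp_le_cancel_iff by auto
    qed (use tn[OF n] T in auto)
    ultimately show ?thesis using area_pos by (intro mult_left_mono mult_right_mono) auto
  qed
  finally show ?thesis by (simp add: hsq_def mult.assoc add.assoc)
qed

end

theorem theorem4p3:
  fixes X :: "real \<times> real" and T \<epsilon> \<gamma> M \<omega> :: real
    and \<phi>0 :: "real \<times> real \<Rightarrow> real" and \<phi> :: "real \<Rightarrow> real \<times> real \<Rightarrow> real"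
  assumes "fst X > 0" and "snd X > 0" and "T > 0"
    and "\<epsilon> > 0" and "\<gamma> > 0" and "M > 0" and "0 < \<omega>" and "\<omega> < 1"
    and "\<forall>k. Ck k \<phi>0" and "periodic X \<phi>0" and "\<forall>x. 0 \<le> \<phi>0 x \<and> \<phi>0 x \<le> 1"
    and "exact_solution X T \<epsilon> \<gamma> M \<omega> \<phi>0 \<phi>"
    and "sufficiently_smooth X T \<phi>"
  shows "\<exists>\<tau>0>0. \<forall>\<kappa>>0. \<exists>C>0.
    \<forall>(N :: nat \<times> nat) (Nt :: nat) (\<Phi> :: nat \<Rightarrow> gridfun).
      fst N > 0 \<and> even (fst N) \<and> snd N > 0 \<and> even (snd N) \<and>
      Nt > 0 \<and> T / real Nt \<le> \<tau>0 \<and>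
      stabilizing X N \<kappa> \<epsilon> \<gamma> M \<omega> \<and>
      \<Phi> 0 = on_grid X N \<phi>0 \<and>
      (\<forall>n\<in>{1..Nt}. \<Phi> n \<in> gridfuns N) \<and>
      (\<forall>n<Nt. scheme_step X N (T / real Nt) \<kappa> \<epsilon> \<gamma> M \<omega> (\<Phi> n) (\<Phi> (Suc n)))
      \<longrightarrow> (\<forall>n\<in>{1..Nt}.
            norm_L2_h X N (\<lambda>k. on_grid X N (\<phi> (real n * (T / real Nt))) k - \<Phi> n k)
              \<le> C * (T / real Nt + (h1 X N)\<^sup>2 + (h2 X N)\<^sup>2))"
proof -
  interpret box: torus_box X by unfold_locales (fact assms(1,2))+
  have ex: "\<And>t. t \<in> {0..T} \<Longrightarrow> periodic X (\<phi> t)" "\<And>x. \<phi> 0 x = \<phi>0 x"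
    "\<And>t x. t \<in> {0..T} \<Longrightarrow> ((\<lambda>s. \<phi> s x) has_real_derivative pde_rhs X \<epsilon> \<gamma> M \<omega> (\<phi> t) x) (at t within {0..T})"
    using assms(12) unfolding exact_solution_def by blast+
  have tt: "tt_Linf X T \<phi>" and C4: "Linf_C4 T \<phi>"
    using assms(13) by (auto simp: sufficiently_smooth_def)
  obtain B0 where "AE t in lborel. t \<in> {0<..<T} \<longrightarrow>
        Ck 4 (\<phi> t) \<and> (\<forall>j k x. j + k \<le> 4 \<longrightarrow> \<bar>(pd1 ^^ j) ((pd2 ^^ k) (\<phi> t)) x\<bar> \<le> B0)"
    using C4 unfolding Linf_C4_def by blast
  then obtain S where S: "negligible S" "\<And>t. t \<notin> S \<Longrightarrow> t \<in> {0<..<T} \<longrightarrow>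
        Ck 4 (\<phi> t) \<and> (\<forall>j k x. j + k \<le> 4 \<longrightarrow> \<bar>(pd1 ^^ j) ((pd2 ^^ k) (\<phi> t)) x\<bar> \<le> B0)"
    by (rule AE_negligible) blast
  have pd1: "pd1 = pd (1, 0)" and pd2: "pd2 = pd (0, 1)" by (rule ext, rule pd1_eq pd2_eq)+
  define B where "B = max B0 1"
  have good: "bounded_C4 X B (\<phi> t)" if t: "t \<in> {0<..<T}" "t \<notin> S" for t
  proof -
    have bd: "\<bar>(pd1 ^^ j) ((pd2 ^^ k) (\<phi> t)) x\<bar> \<le> B0" if "j + k \<le> 4" for j k x
      using S(2)[OF t(2)] t(1) that by blast
    have "\<bar>(pd e ^^ j) (\<phi> t) p\<bar> \<le> B" if e: "e \<in> dirs" and j: "j \<le> 4" for e j p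
    proof -
      have "\<bar>(pd (1, 0) ^^ j) (\<phi> t) p\<bar> \<le> B0" "\<bar>(pd (0, 1) ^^ j) (\<phi> t) p\<bar> \<le> B0"
        using bd[of j 0 p] bd[of 0 j p] j unfolding pd1 pd2 by simp_all
      then show ?thesis using e by (auto simp: dirs_def B_def)
    qed
    then show ?thesis using ex(1)[of t] S(2)[OF t(2)] t(1) by (simp add: bounded_C4_def)
  qed
  obtain C where C: "C \<ge> 0" "\<And>s t x. s \<in> {0..T} \<Longrightarrow> t \<in> {0..T} \<Longrightarrow> bounded_C4 X B (\<phi> s) \<Longrightarrow> bounded_C4 X B (\<phi> t) \<Longrightarrow>
    \<bar>pde_rhs X \<epsilon> \<gamma> M \<omega> (\<phi> t) x - pde_rhs X \<epsilon> \<gamma> M \<omega> (\<phi> s) x\<bar> \<le> C * \<bar>t - s\<bar>"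
    using box.rhs_time_lipschitz[OF assms(3,12) tt] by blast
  obtain K where K: "K \<ge> 0"
    "\<And>a. \<bar>a\<bar> \<le> B \<Longrightarrow> \<bar>f a\<bar> \<le> K" "\<And>a. \<bar>a\<bar> \<le> B \<Longrightarrow> \<bar>deriv f a\<bar> \<le> K"
    "\<And>a b. \<bar>a\<bar> \<le> B \<Longrightarrow> \<bar>b\<bar> \<le> B \<Longrightarrow> \<bar>deriv W a - deriv W b\<bar> \<le> K * \<bar>a - b\<bar>"
    "\<And>a b. \<bar>a\<bar> \<le> B \<Longrightarrow> \<bar>b\<bar> \<le> B \<Longrightarrow> \<bar>f a - f b\<bar> \<le> K * \<bar>a - b\<bar>"
    "\<And>a b. \<bar>a\<bar> \<le> B \<Longrightarrow> \<bar>b\<bar> \<le> B \<Longrightarrow> \<bar>deriv f a - deriv f b\<bar> \<le> K * \<bar>a - b\<bar>"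
    by (rule poly_bounds[of B]) (auto simp: B_def)
  have grid: "exact_on_grid X N \<epsilon> \<gamma> M \<omega> B K T C \<phi> S" if "fst N > 0" "snd N > 0" for N
  proof (unfold_locales)
    show "B \<ge> 1" by (simp add: B_def)
  qed (use that assms(1-8) K C S(1) ex good in \<open>assumption | blast\<close>)+
  show ?thesis
  \<comment> \<open>the estimate holds for every step size, so any threshold will do\<close>
  proof (rule exI[of _ 1], intro conjI allI impI)
    fix \<kappa> :: real assume \<kappa>: "\<kappa> > 0"
    let ?L = "lip_const X \<epsilon> \<gamma> M K"
    let ?C = "sqrt (area X) * T * exp (?L * T) * (C + consistency_const X \<epsilon> \<gamma> M B K
        + \<kappa> / \<epsilon> * speed_const X \<epsilon> \<gamma> M B K + ?L * speed_const X \<epsilon> \<gamma> M B K)"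
    show "\<exists>C>0. \<forall>(N :: nat \<times> nat) (Nt :: nat) (\<Phi> :: nat \<Rightarrow> gridfun).
      fst N > 0 \<and> even (fst N) \<and> snd N > 0 \<and> even (snd N) \<and>
      Nt > 0 \<and> T / real Nt \<le> 1 \<and>
      stabilizing X N \<kappa> \<epsilon> \<gamma> M \<omega> \<and>
      \<Phi> 0 = on_grid X N \<phi>0 \<and>
      (\<forall>n\<in>{1..Nt}. \<Phi> n \<in> gridfuns N) \<and>
      (\<forall>n<Nt. scheme_step X N (T / real Nt) \<kappa> \<epsilon> \<gamma> M \<omega> (\<Phi> n) (\<Phi> (Suc n)))
      \<longrightarrow> (\<forall>n\<in>{1..Nt}.
            norm_L2_h X N (\<lambda>k. on_grid X N (\<phi> (real n * (T / real Nt))) k - \<Phi> n k)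
              \<le> C * (T / real Nt + (h1 X N)\<^sup>2 + (h2 X N)\<^sup>2))"
    \<comment> \<open>the absolute value and the summand 1 ensure positivity\<close>
    proof (rule exI[of _ "\<bar>?C\<bar> + 1"], intro conjI allI impI ballI)
      show "0 < \<bar>?C\<bar> + 1" by linarith
      fix N :: "nat \<times> nat" and Nt n :: nat and \<Phi> :: "nat \<Rightarrow> gridfun"
      assume H: "fst N > 0 \<and> even (fst N) \<and> snd N > 0 \<and> even (snd N) \<and>
        Nt > 0 \<and> T / real Nt \<le> 1 \<and>
        stabilizing X N \<kappa> \<epsilon> \<gamma> M \<omega> \<and>
        \<Phi> 0 = on_grid X N \<phi>0 \<and>
        (\<forall>n\<in>{1..Nt}. \<Phi> n \<in> gridfuns N) \<and>
        (\<forall>n<Nt. scheme_step X N (T / real Nt) \<kappa> \<epsilon> \<gamma> M \<omega> (\<Phi> n) (\<Phi> (Suc n)))"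
        and n: "n \<in> {1..Nt}"
      interpret G: exact_on_grid X N \<epsilon> \<gamma> M \<omega> B K T C \<phi> S using grid H by blast
      have \<phi>0: "\<phi> 0 = \<phi>0" by (rule ext) (rule ex(2))
      have "norm_L2_h X N (\<lambda>k. on_grid X N (\<phi> (real n * (T / real Nt))) k - \<Phi> n k)
          \<le> ?C * (T / real Nt + (h1 X N)\<^sup>2 + (h2 X N)\<^sup>2)"
        by (rule G.convergence[OF \<kappa>]) (use H n assms(11) in \<open>auto simp: \<phi>0\<close>)
      also have "\<dots> \<le> (\<bar>?C\<bar> + 1) * (T / real Nt + (h1 X N)\<^sup>2 + (h2 X N)\<^sup>2)"
      proof (rule mult_right_mono)
        show "?C \<le> \<bar>?C\<bar> + 1" by (rule order_trans[OF abs_ge_self]) linarith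
      qed (use assms(3) in auto)
      finally show "norm_L2_h X N (\<lambda>k. on_grid X N (\<phi> (real n * (T / real Nt))) k - \<Phi> n k)
          \<le> (\<bar>?C\<bar> + 1) * (T / real Nt + (h1 X N)\<^sup>2 + (h2 X N)\<^sup>2)" .
    qed
  qed simp
qed

end
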